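(* Let $U_*(z)=\frac{1}{18}(3z^2-\pi^2)$ for $z\in[-\pi,\pi]$, extended $2\pi$-periodically, and $c_*=\pi^2/9$, so that $c_*-U_*(z)=\frac16(\pi^2-z^2)$ on $[-\pi,\pi]$. Consider the operator $A:\mathrm{dom}(A)\subset\dot L^2_{\rm per}\to\dot L^2_{\rm per}$, $$(Av)(z)=\partial_z\big[(c_*-U_*(z))v(z)\big]+(\partial_z^{-1}v)(z),\quad z\in(-\pi,\pi),$$ with maximal domain $\mathrm{dom}(A)=\{v\in\dot L^2_{\rm per}:\ \partial_z[(c_*-U_* )v]\in\dot L^2_{\rm per}\}$. Then $$\sigma(A)=\Big\{\lambda\in\mathbb{C}:\ -\tfrac{\pi}{6}\le \mathrm{Re}(\lambda)\le\tfrac{\pi}{6}\Big\}.$$ In particular $\sigma(A)\not\subset i\mathbb{R}$, i.e. the peaked wave $U_*$ of the reduced Ostrovsky equation $u_t+uu_x=\partial_x^{-1}u$ is spectrally unstable.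
   Context: $\dot L^2_{\rm per}$ denotes the Hilbert space of $2\pi$-periodic functions in $L^2(-\pi,\pi)$ (complex-valued) with zero mean $\int_{-\pi}^{\pi}v\,dz=0$. $\partial_z^{-1}:\dot L^2_{\rm per}\to\dot L^2_{\rm per}$ denotes the antiderivative with zero mean. Derivatives are taken in the distributional sense on $(-\pi,\pi)$. A traveling wave is called spectrally stable if $\sigma(A)\subset i\mathbb{R}$ and spectrally unstable otherwise. Spectrum: $\rho(T)=\{\lambda:\ker(T-\lambda I)=\{0\},\ \mathrm{ran}(T-\lambda I)=X,\ (T-\lambda I)^{-1}\text{ bounded}\}$, $\sigma(T)=\mathbb{C}\setminus\rho(T)$. *)

theory Defs
  imports "HOL-Analysis.Analysis"
begin

text \<open>Elements of the space of 2pi-periodic zero-mean L2 functions are represented by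
  complex-valued functions on the reals; only their values on [-pi,pi] matter,
  and equalities are understood almost everywhere.\<close>

definition L2per0 :: "(real \<Rightarrow> complex) \<Rightarrow> bool" where
  "L2per0 v \<longleftrightarrow>
     set_borel_measurable lebesgue {-pi..pi} v \<and>
     set_integrable lebesgue {-pi..pi} (\<lambda>z. (cmod (v z))\<^sup>2) \<and>
     (LINT z:{-pi..pi}|lebesgue. v z) = 0"

definition L2norm :: "(real \<Rightarrow> complex) \<Rightarrow> real" where
  "L2norm v = sqrt (LINT z:{-pi..pi}|lebesgue. (cmod (v z))\<^sup>2)"

definition ae_eq_on :: "(real \<Rightarrow> complex) \<Rightarrow> (real \<Rightarrow> complex) \<Rightarrow> bool" where
  "ae_eq_on f g \<longleftrightarrow> (AE z in lebesgue. z \<in> {-pi..pi} \<longrightarrow> f z = g z)"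

definition antideriv0 :: "(real \<Rightarrow> complex) \<Rightarrow> real \<Rightarrow> complex" where
  "antideriv0 v z =
     (LINT t:{-pi..z}|lebesgue. v t)
     - complex_of_real (1 / (2 * pi)) * (LINT s:{-pi..pi}|lebesgue. (LINT t:{-pi..s}|lebesgue. v t))"

definition test_fun :: "(real \<Rightarrow> real) \<Rightarrow> bool" where
  "test_fun \<phi> \<longleftrightarrow>
     (\<forall>n x. ((deriv ^^ n) \<phi>) differentiable (at x)) \<and>
     (\<exists>a b. -pi < a \<and> b < pi \<and> (\<forall>x. x \<notin> {a..b} \<longrightarrow> \<phi> x = 0))"

definition dist_deriv :: "(real \<Rightarrow> complex) \<Rightarrow> (real \<Rightarrow> complex) \<Rightarrow> bool" where
  "dist_deriv f g \<longleftrightarrow>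
     (\<forall>\<phi>. test_fun \<phi> \<longrightarrow>
        (LINT z:{-pi<..<pi}|lebesgue. f z * complex_of_real (deriv \<phi> z))
        = - (LINT z:{-pi<..<pi}|lebesgue. g z * complex_of_real (\<phi> z)))"

definition U_star :: "real \<Rightarrow> real" where
  "U_star z = (let y = z - 2 * pi * of_int \<lfloor>(z + pi) / (2 * pi)\<rfloor> in (3 * y\<^sup>2 - pi\<^sup>2) / 18)"

definition c_star :: real where
  "c_star = pi\<^sup>2 / 9"

definition A_graph :: "(real \<Rightarrow> complex) \<Rightarrow> (real \<Rightarrow> complex) \<Rightarrow> bool" where
  "A_graph v w \<longleftrightarrow> L2per0 v \<and>
     (\<exists>g. L2per0 g \<and> dist_deriv (\<lambda>z. complex_of_real (c_star - U_star z) * v z) g \<and>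
          ae_eq_on w (\<lambda>z. g z + antideriv0 v z))"

definition resolvent_A :: "complex set" where
  "resolvent_A = {lam.
     (\<forall>v w. A_graph v w \<and> ae_eq_on (\<lambda>z. w z - lam * v z) (\<lambda>z. 0) \<longrightarrow> ae_eq_on v (\<lambda>z. 0)) \<and>
     (\<forall>f. L2per0 f \<longrightarrow> (\<exists>v w. A_graph v w \<and> ae_eq_on (\<lambda>z. w z - lam * v z) f)) \<and>
     (\<exists>C. \<forall>v w. A_graph v w \<longrightarrow> L2norm v \<le> C * L2norm (\<lambda>z. w z - lam * v z))}"

definition spectrum_A :: "complex set" where
  "spectrum_A = - resolvent_A"

end

theory Submission
  imports Defs "HOL-Real_Asymp.Real_Asymp"
begin

text \<open>Let \<open>p = c_star - U_star = (pi^2 - z^2) / 6\<close> and let \<open>E = exp (- lam * ell)\<close> with \<open>ell' = 1 / p\<close>. For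
  \<open>v = u'\<close> the equation \<open>(A - lam) v = f\<close> becomes \<open>p u'' + (p' - lam) u' + u = f\<close>, whose homogeneous form
  has a quadratic polynomial solution \<open>P\<close>, while \<open>E P\<close> solves the transposed equation.

  In the open strip \<open>\<bar>Re lam\<bar> < pi / 6\<close> the function \<open>E P\<close> is square integrable with mean zero and
  annihilates the range of \<open>A - lam\<close>. If a point \<open>lam0\<close> of the closed strip had a resolvent bounded by \<open>C\<close>,
  take \<open>lam\<close> in the open strip with \<open>\<bar>lam - lam0\<bar> C < 1\<close> and solve \<open>(A - lam0) v = cnj (E P)\<close>; pairing with
  \<open>E P\<close> gives \<open>\<parallel>E P\<parallel>^2 \<le> \<bar>lam - lam0\<bar> C \<parallel>E P\<parallel>^2\<close>, a contradiction.

  For \<open>Re lam > pi / 6\<close> the equation is integrated from the right endpoint: \<open>v = V (f - u)\<close>, where the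
  Volterra operator \<open>V\<close> has norm at most \<open>1 / (Re lam - pi / 6)\<close> by a Schur test. With \<open>u = 0\<close> at the right
  endpoint this is a contraction for \<open>u\<close> in an exponentially weighted supremum norm, and a multiple of \<open>P'\<close>
  restores the zero mean of \<open>v\<close>. The reflection \<open>z \<mapsto> - z\<close> turns \<open>A\<close> into \<open>- A\<close> and covers the other
  half plane.\<close>

subsection \<open>Integration by parts for absolutely continuous functions\<close>

text \<open>The number \<open>pi / 6\<close> is half the slope of \<open>p\<close> at its zeros,
  where \<open>p'\<close> is \<open>- pi / 3\<close> (at \<open>pi\<close>) and
  \<open>pi / 3\<close> (at \<open>- pi\<close>). Since
  \<open>\<bar>E\<bar>^2 = ((pi - z) / (pi + z)) powr (6 Re lam / pi)\<close>, the factor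
  \<open>E\<close> is square integrable exactly for \<open>\<bar>Re lam\<bar> < pi / 6\<close>. On
  the edges of the strip it is not, so \<open>E P\<close> is no longer an annihilator in the space;
  this is why an edge point is treated through an interior point close to it, with the resolvent
  bound controlling the error. Outside the strip, solutions of \<open>(p v)' - lam v = 0\<close> are
  multiples of \<open>1 / (p E)\<close>, of order \<open>(pi - z) powr (- 1 - 3 Re lam / pi)\<close>
  at \<open>pi\<close> and \<open>(pi + z) powr (3 Re lam / pi - 1)\<close> at \<open>- pi\<close>.
  For \<open>Re lam > pi / 6\<close> they are square integrable at \<open>- pi\<close> but not at
  \<open>pi\<close>: square integrability itself imposes the condition at \<open>pi\<close> and
  leaves \<open>- pi\<close> free, hence the integration from the right. One scalar, the mean of
  \<open>v\<close>, remains to be adjusted; \<open>P'\<close> can do this because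
  \<open>P pi - P (- pi) = 6 pi lam\<close> is not 0.\<close>

lemma constant_if_superlinear_increment:
  fixes N :: "real \<Rightarrow> 'a::real_normed_vector" and h :: "real \<Rightarrow> real"
  assumes "a \<le> b" and h: "continuous_on {a..b} h"
    and N: "\<And>x y. \<lbrakk>x \<in> {a..b}; y \<in> {a..b}\<rbrakk> \<Longrightarrow> norm (N y - N x) \<le> C * \<bar>y - x\<bar> * \<bar>h y - h x\<bar>"
  shows "N b = N a"
proof -
  \<comment> \<open>The factor \<open>h y - h x\<close> tends to 0 by continuity of
    \<open>h\<close>, so the increment of \<open>N\<close> is of smaller order than
    \<open>y - x\<close> at every point, without an exceptional null set.\<close>
  have "(N has_derivative (\<lambda>h. 0)) (at x within {a..b})" if x: "x \<in> {a..b}" for x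
    unfolding has_derivative_within
  proof (intro conjI bounded_linear_zero)
    have "(h \<longlongrightarrow> h x) (at x within {a..b})"
      using h x unfolding continuous_on_def by blast
    then have "((\<lambda>y. h y - h x) \<longlongrightarrow> h x - h x) (at x within {a..b})"
      by (intro tendsto_diff tendsto_const)
    then have "((\<lambda>y. C * \<bar>h y - h x\<bar>) \<longlongrightarrow> C * \<bar>h x - h x\<bar>) (at x within {a..b})"
      by (intro tendsto_mult_left tendsto_rabs)
    then have lim: "((\<lambda>y. C * \<bar>h y - h x\<bar>) \<longlongrightarrow> 0) (at x within {a..b})" by simp
    show "((\<lambda>y. (1 / norm (y - x)) *\<^sub>R (N y - (N x + 0))) \<longlongrightarrow> 0) (at x within {a..b})"
    proof (rule Lim_null_comparison[OF _ lim])
      show "\<forall>\<^sub>F y in at x within {a..b}.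
        norm ((1 / norm (y - x)) *\<^sub>R (N y - (N x + 0))) \<le> C * \<bar>h y - h x\<bar>"
        unfolding eventually_at_filter
      proof (intro always_eventually allI impI)
        fix y assume y: "y \<noteq> x" "y \<in> {a..b}"
        show "norm ((1 / norm (y - x)) *\<^sub>R (N y - (N x + 0))) \<le> C * \<bar>h y - h x\<bar>"
          using N[OF x y(2)] y(1) by (simp add: divide_le_eq mult.commute mult.left_commute)
      qed
    qed
  qed
  then obtain c where "\<And>x. x \<in> {a..b} \<Longrightarrow> N x = c"
    using has_derivative_zero_constant[of "{a..b}" N] by auto
  then show ?thesis using \<open>a \<le> b\<close> by simp
qed

text \<open>The difference of both sides, as a function of the upper limit, has derivative 0 everywhere; no
  form of Fubini's theorem is needed.\<close>

lemma ac_by_parts: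
  fixes g G \<Phi> \<phi> :: "real \<Rightarrow> 'a::{real_normed_field,euclidean_space}"
  assumes "a \<le> b"
    and g: "g absolutely_integrable_on {a..b}"
    and G: "\<And>x. x \<in> {a..b} \<Longrightarrow> G x = G a + integral {a..x} g"
    and \<Phi>: "\<And>x. x \<in> {a..b} \<Longrightarrow> (\<Phi> has_vector_derivative \<phi> x) (at x within {a..b})"
    and \<phi>: "continuous_on {a..b} \<phi>"
  shows "(\<lambda>x. g x * \<Phi> x) absolutely_integrable_on {a..b}"
    and "continuous_on {a..b} G"
    and "integral {a..b} (\<lambda>x. g x * \<Phi> x) = G b * \<Phi> b - G a * \<Phi> a - integral {a..b} (\<lambda>x. G x * \<phi> x)"
proof -
  have gi: "g integrable_on {a..b}" using g absolutely_integrable_on_def by blast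
  have ngi: "(\<lambda>x. norm (g x)) integrable_on {a..b}" using g absolutely_integrable_on_def by blast
  have "continuous_on {a..b} (\<lambda>x. G a + integral {a..x} g)"
    by (intro continuous_intros indefinite_integral_continuous_1 gi)
  then show contG: "continuous_on {a..b} G" using continuous_on_cong[of "{a..b}" _ G, OF refl G] by blast
  have cont\<Phi>: "continuous_on {a..b} \<Phi>"
    using \<Phi> by (meson continuous_on_eq_continuous_within has_vector_derivative_continuous)
  have "(\<lambda>x. \<Phi> x * g x) absolutely_integrable_on {a..b}"
  proof (rule absolutely_integrable_bounded_measurable_product[OF bilinear_times _ _ _ g])
    show "\<Phi> \<in> borel_measurable (lebesgue_on {a..b})"
      by (intro continuous_imp_measurable_on_sets_lebesgue cont\<Phi>) auto
    show "bounded (\<Phi> ` {a..b})"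
      using compact_continuous_image[OF cont\<Phi>] compact_imp_bounded by auto
  qed auto
  then show ag\<Phi>: "(\<lambda>x. g x * \<Phi> x) absolutely_integrable_on {a..b}" by (simp add: mult.commute)
  then have g\<Phi>: "(\<lambda>x. g x * \<Phi> x) integrable_on {a..b}" using absolutely_integrable_on_def by blast
  have G\<phi>: "(\<lambda>x. G x * \<phi> x) integrable_on {a..b}"
    by (intro integrable_continuous_real continuous_intros contG \<phi>)
  obtain M where M: "\<And>x. x \<in> {a..b} \<Longrightarrow> norm (\<phi> x) \<le> M" "M > 0"
    using compact_imp_bounded[OF compact_continuous_image[OF \<phi> compact_Icc]]
    unfolding bounded_pos by blast
  \<comment> \<open>\<open>h\<close> accumulates the mass of \<open>g\<close>: it dominates the
    increments of \<open>G\<close> and is itself continuous.\<close>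
  define h where "h x = integral {a..x} (\<lambda>x. norm (g x))" for x
  define N where "N x = integral {a..x} (\<lambda>x. g x * \<Phi> x) + integral {a..x} (\<lambda>x. G x * \<phi> x) - G x * \<Phi> x" for x
  have split: "integral {a..y} f - integral {a..x} f = integral {x..y} f"
    if "f integrable_on {a..b}" "x \<in> {a..b}" "y \<in> {a..b}" "x \<le> y" for f :: "real \<Rightarrow> 'b::banach" and x y
    using Henstock_Kurzweil_Integration.integral_combine[of a x y f] that
    by (smt (verit) add_diff_cancel_left' atLeastAtMost_iff atLeastatMost_subset_iff integrable_on_subinterval)
  \<comment> \<open>Freezing \<open>\<Phi>\<close> at \<open>y\<close> and \<open>G\<close> at
    \<open>x\<close> reproduces the boundary terms exactly. What is left are two integrals of
    products of small quantities: \<open>\<Phi> t - \<Phi> y\<close> is at most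
    \<open>M * (y - x)\<close>, and \<open>G t - G x\<close> is at most
    \<open>h y - h x\<close>.\<close>
  have main: "norm (N y - N x) \<le> 2 * M * (y - x) * (h y - h x)"
    if x: "x \<in> {a..b}" and y: "y \<in> {a..b}" and xy: "x \<le> y" for x y
  proof -
    have sub: "{x..y} \<subseteq> {a..b}" using x y by auto
    have i: "f integrable_on {x..y}" if "f integrable_on {a..b}" for f :: "real \<Rightarrow> 'b::banach"
      using integrable_on_subinterval[OF that sub] .
    have hxy: "h y - h x = integral {x..y} (\<lambda>x. norm (g x))"
      unfolding h_def by (rule split[OF ngi x y xy])
    have hpos: "h y - h x \<ge> 0" unfolding hxy by (rule integral_nonneg[OF i[OF ngi]]) simp
    have \<Phi>d: "\<Phi> t - \<Phi> s = integral {s..t} \<phi>" if "s \<in> {x..y}" "t \<in> {x..y}" "s \<le> t" for s t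
    proof -
      have "(\<phi> has_integral (\<Phi> t - \<Phi> s)) {s..t}"
        using that sub by (intro fundamental_theorem_of_calculus has_vector_derivative_within_subset[OF \<Phi>]) auto
      then show ?thesis by (simp add: integral_unique)
    qed
    have \<Phi>b: "norm (\<Phi> t - \<Phi> y) \<le> M * (y - x)" if t: "t \<in> {x..y}" for t
    proof -
      have "norm (\<Phi> y - \<Phi> t) = norm (integral {t..y} \<phi>)" using \<Phi>d[of t y] t by auto
      also have "\<dots> \<le> M * (y - t)"
        using t sub by (intro integral_bound) (auto intro!: M continuous_on_subset[OF \<phi>])
      also have "\<dots> \<le> M * (y - x)" using t M by auto
      finally show ?thesis by (simp add: norm_minus_commute)
    qed
    have Gb: "norm (G t - G x) \<le> h y - h x" if t: "t \<in> {x..y}" for t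
    proof -
      have tab: "t \<in> {a..b}" using t sub by auto
      have "G t - G x = integral {x..t} g" using G[OF x] G[OF tab] split[OF gi x tab] t by auto
      also have "norm \<dots> \<le> integral {x..t} (\<lambda>x. norm (g x))"
        using t by (intro integral_norm_bound_integral) (auto intro: integrable_on_subinterval[OF i[OF gi]] integrable_on_subinterval[OF i[OF ngi]])
      also have "\<dots> \<le> integral {x..y} (\<lambda>x. norm (g x))"
        using t by (intro integral_subset_le) (auto intro: integrable_on_subinterval[OF i[OF ngi]] i[OF ngi])
      finally show ?thesis by (simp add: hxy)
    qed
    have G\<Phi>: "G y * \<Phi> y - G x * \<Phi> x = integral {x..y} g * \<Phi> y + G x * integral {x..y} \<phi>"
      using split[OF gi x y xy] G[OF x] G[OF y] \<Phi>d[of x y] xy by (auto simp: algebra_simps)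
    have e1: "integral {x..y} (\<lambda>t. g t * \<Phi> t) - integral {x..y} g * \<Phi> y = integral {x..y} (\<lambda>t. g t * (\<Phi> t - \<Phi> y))"
      by (simp add: right_diff_distrib integral_diff i[OF g\<Phi>] i[OF gi] integrable_on_mult_left)
    have e2: "integral {x..y} (\<lambda>t. G t * \<phi> t) - G x * integral {x..y} \<phi> = integral {x..y} (\<lambda>t. (G t - G x) * \<phi> t)"
      using i[OF integrable_continuous_real[OF \<phi>]]
      by (simp add: left_diff_distrib integral_diff i[OF G\<phi>] integrable_on_mult_right)
    have "N y - N x = integral {x..y} (\<lambda>t. g t * (\<Phi> t - \<Phi> y)) + integral {x..y} (\<lambda>t. (G t - G x) * \<phi> t)"
      unfolding N_def e1[symmetric] e2[symmetric]
      using split[OF g\<Phi> x y xy] split[OF G\<phi> x y xy] G\<Phi> by (simp add: algebra_simps)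
    also have "norm \<dots> \<le> M * (y - x) * (h y - h x) + (h y - h x) * M * (y - x)"
    proof (rule order_trans[OF norm_triangle_ineq add_mono])
      have "norm (integral {x..y} (\<lambda>t. g t * (\<Phi> t - \<Phi> y))) \<le> integral {x..y} (\<lambda>t. M * (y - x) * norm (g t))"
      proof (rule integral_norm_bound_integral)
        show "(\<lambda>t. g t * (\<Phi> t - \<Phi> y)) integrable_on {x..y}"
          using integrable_diff[OF i[OF g\<Phi>] integrable_on_mult_left[OF i[OF gi], of "\<Phi> y"]]
          by (simp add: right_diff_distrib)
      next
        fix t assume "t \<in> {x..y}"
        then show "norm (g t * (\<Phi> t - \<Phi> y)) \<le> M * (y - x) * norm (g t)"
          using mult_left_mono[OF \<Phi>b[of t], of "norm (g t)"] by (simp add: norm_mult mult.commute)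
      qed (intro integrable_on_mult_right i ngi)
      then show "norm (integral {x..y} (\<lambda>t. g t * (\<Phi> t - \<Phi> y))) \<le> M * (y - x) * (h y - h x)"
        by (simp add: hxy)
      show "norm (integral {x..y} (\<lambda>t. (G t - G x) * \<phi> t)) \<le> (h y - h x) * M * (y - x)"
      proof (rule integral_bound[OF xy])
        show "continuous_on {x..y} (\<lambda>t. (G t - G x) * \<phi> t)"
          by (intro continuous_intros continuous_on_subset[OF contG sub] continuous_on_subset[OF \<phi> sub])
      next
        fix t assume t: "t \<in> {x..y}"
        then show "norm ((G t - G x) * \<phi> t) \<le> (h y - h x) * M"
          unfolding norm_mult using Gb[OF t] M(1)[of t] sub hpos by (intro mult_mono) auto
      qed
    qed
    finally show ?thesis by (simp add: algebra_simps)
  qed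
  have "N b = N a"
  proof (rule constant_if_superlinear_increment[OF \<open>a \<le> b\<close>])
    show "continuous_on {a..b} h" unfolding h_def by (rule indefinite_integral_continuous_1[OF ngi])
    fix x y assume x: "x \<in> {a..b}" and y: "y \<in> {a..b}"
    have *: "2 * M * u * v \<le> 2 * M * \<bar>u\<bar> * \<bar>v\<bar>" for u v
      using mult_left_mono[OF abs_ge_self[of "u * v"], of "2 * M"] M(2) by (simp add: abs_mult mult.assoc)
    show "norm (N y - N x) \<le> 2 * M * \<bar>y - x\<bar> * \<bar>h y - h x\<bar>"
    proof (cases "x \<le> y")
      case True then show ?thesis using main[OF x y] *[of "y - x" "h y - h x"] by linarith
    next
      case False then show ?thesis using main[OF y x] *[of "x - y" "h x - h y"] by (simp add: norm_minus_commute abs_minus_commute)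
    qed
  qed
  then show "integral {a..b} (\<lambda>x. g x * \<Phi> x) = G b * \<Phi> b - G a * \<Phi> a - integral {a..b} (\<lambda>x. G x * \<phi> x)"
    by (simp add: N_def algebra_simps)
qed

subsection \<open>Test functions and the du Bois-Reymond lemma\<close>

lemma integral_eq_zero_on: "(\<And>x. x \<in> S \<Longrightarrow> f x = 0) \<Longrightarrow> integral S f = 0"
  using integral_cong[of S f "\<lambda>x. 0"] by simp

text \<open>The recursion peels derivatives off on the inside, so that closure under products and
  affine substitution follows by induction on \<open>n\<close> with the function generalized;
  \<open>times_differentiable_higher_deriv\<close> connects it with the iterates
  \<open>deriv ^^ n\<close> in \<open>test_fun\<close>.\<close>

fun times_differentiable :: "nat \<Rightarrow> (real \<Rightarrow> real) \<Rightarrow> bool" where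
  "times_differentiable 0 f \<longleftrightarrow> (\<forall>x. f differentiable at x)"
| "times_differentiable (Suc n) f \<longleftrightarrow> (\<forall>x. f differentiable at x) \<and> times_differentiable n (deriv f)"

lemma times_differentiable_imp: "times_differentiable n f \<Longrightarrow> f differentiable at x"
  by (cases n) auto

lemma times_differentiable_Suc_imp: "times_differentiable (Suc n) f \<Longrightarrow> times_differentiable n f"
  by (induction n arbitrary: f) auto

lemma times_differentiable_higher_deriv:
  "times_differentiable n f \<Longrightarrow> (deriv ^^ n) f differentiable at x"
proof (induction n arbitrary: f)
  case (Suc n)
  then show ?case by (simp add: funpow_swap1)
qed auto

lemma has_deriv_if_differentiable:
  fixes f :: "real \<Rightarrow> real"
  shows "f differentiable at x \<Longrightarrow> (f has_real_derivative deriv f x) (at x)"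
  by (simp add: DERIV_deriv_iff_real_differentiable)

lemma DERIV_local_cong:
  "(g has_field_derivative D) (at x) \<Longrightarrow> \<forall>\<^sub>F y in nhds x. f y = g y \<Longrightarrow> (f has_field_derivative D) (at x)"
  using DERIV_cong_ev[of x x f g D D] by simp

lemma times_differentiable_SucI:
  assumes "\<And>x. (f has_real_derivative f' x) (at x)" "times_differentiable n f'"
  shows "times_differentiable (Suc n) f"
proof -
  have "deriv f = f'" using assms(1) by (auto simp: DERIV_imp_deriv)
  then show ?thesis using assms by (auto simp: real_differentiable_def)
qed

lemma times_differentiable_const: "times_differentiable n (\<lambda>x. c)"
proof (induction n arbitrary: c)
  case (Suc n)
  show ?case by (rule times_differentiable_SucI[OF DERIV_const Suc])
qed auto

lemma times_differentiable_add:
  assumes "times_differentiable n f" "times_differentiable n g"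
  shows "times_differentiable n (\<lambda>x. f x + g x)"
  using assms
proof (induction n arbitrary: f g)
  case (Suc n)
  show ?case
    by (rule times_differentiable_SucI[OF DERIV_add[OF has_deriv_if_differentiable has_deriv_if_differentiable]])
      (use Suc in auto)
qed auto

lemma times_differentiable_mult:
  assumes "times_differentiable n f" "times_differentiable n g"
  shows "times_differentiable n (\<lambda>x. f x * g x)"
  using assms
proof (induction n arbitrary: f g)
  case (Suc n)
  have "times_differentiable n f" "times_differentiable n g"
    using Suc.prems times_differentiable_Suc_imp by blast+
  moreover have "\<And>x. f differentiable at x" "\<And>x. g differentiable at x"
    "times_differentiable n (deriv f)" "times_differentiable n (deriv g)"
    using Suc.prems by auto
  ultimately show ?case
    by (intro times_differentiable_SucI[OF DERIV_mult[OF has_deriv_if_differentiable has_deriv_if_differentiable]])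
      (auto intro!: times_differentiable_add Suc.IH)
qed auto

lemma times_differentiable_affine:
  assumes "times_differentiable n f"
  shows "times_differentiable n (\<lambda>x. f (c * x + d))"
  using assms
proof (induction n arbitrary: f)
  case 0
  have "(\<lambda>x. c * x + d) differentiable at x within UNIV" for x
    by (intro derivative_intros)
  then show ?case using 0 differentiable_compose[of f "\<lambda>x. c * x + d" _ UNIV] by auto
next
  case (Suc n)
  have "((\<lambda>x. f (c * x + d)) has_real_derivative deriv f (c * x + d) * c) (at x)" for x
    by (rule DERIV_chain2[OF has_deriv_if_differentiable]) (use Suc.prems in \<open>auto intro!: derivative_eq_intros\<close>)
  then show ?case
    by (rule times_differentiable_SucI)
      (intro times_differentiable_mult times_differentiable_const Suc.IH, use Suc.prems in auto)
qed

text \<open>The classical flat function \<open>exp (- e / x)\<close> times a polynomial in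
  \<open>1 / x\<close>: this family is closed under differentiation, which gives smoothness by
  induction. The parameter \<open>e\<close> is kept because its limit 0 later turns bumps into
  indicators of intervals.\<close>

definition flat_exp :: "real \<Rightarrow> real poly \<Rightarrow> real \<Rightarrow> real" where
  "flat_exp e q x = (if x > 0 then poly q (1 / x) * exp (- e / x) else 0)"

text \<open>One half of the exponential absorbs the new factor \<open>y\<close>, the other half goes
  to the induction hypothesis; hence the generalization over \<open>e\<close>.\<close>

lemma poly_times_exp_tendsto_0:
  assumes "e > 0"
  shows "((\<lambda>y::real. poly q y * exp (- e * y)) \<longlongrightarrow> 0) at_top"
  using assms
proof (induction q arbitrary: e)
  case (pCons a q)
  have e2: "((\<lambda>y::real. exp (- (e / 2) * y)) \<longlongrightarrow> 0) at_top"
    using pCons.prems by real_asymp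
  have "((\<lambda>y::real. y * exp (- (e / 2) * y)) \<longlongrightarrow> 0) at_top"
    using pCons.prems by real_asymp
  then have "((\<lambda>y. a * (exp (- (e / 2) * y) * exp (- (e / 2) * y)) + (y * exp (- (e / 2) * y)) * (poly q y * exp (- (e / 2) * y))) \<longlongrightarrow> a * (0 * 0) + 0 * 0) at_top"
    using pCons.prems by (intro tendsto_add tendsto_mult tendsto_const e2 pCons.IH) auto
  moreover have "poly (pCons a q) y * exp (- e * y) =
      a * (exp (- (e / 2) * y) * exp (- (e / 2) * y)) + (y * exp (- (e / 2) * y)) * (poly q y * exp (- (e / 2) * y))" for y
  proof -
    have "exp (- e * y) = exp (- (e / 2) * y) * exp (- (e / 2) * y)"
      by (simp flip: exp_add)
    then show ?thesis by (simp add: algebra_simps)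
  qed
  ultimately show ?case by simp
qed auto

text \<open>In the variable \<open>y = 1 / x\<close> the product and chain rules replace
  \<open>q\<close> by \<open>y^2 (e q - q')\<close>.\<close>

lemma flat_exp_has_derivative:
  assumes "e > 0"
  shows "(flat_exp e q has_real_derivative flat_exp e ([:0,0,1:] * (smult e q - pderiv q)) x) (at x)"
proof -
  consider "x > 0" | "x < 0" | "x = 0" by linarith
  then show ?thesis
  proof cases
    case 1
    have "((\<lambda>x. poly q (1 / x) * exp (- e / x)) has_real_derivative flat_exp e ([:0,0,1:] * (smult e q - pderiv q)) x) (at x)"
      using 1 by (auto intro!: derivative_eq_intros poly_DERIV simp: flat_exp_def field_simps power2_eq_square)
    moreover have "\<forall>\<^sub>F y in nhds x. flat_exp e q y = poly q (1 / y) * exp (- e / y)"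
      using eventually_nhds_in_open[of "{0<..}" x] 1 by (auto elim!: eventually_mono simp: flat_exp_def)
    ultimately show ?thesis by (rule DERIV_local_cong)
  next
    case 2
    have "((\<lambda>x. 0) has_real_derivative flat_exp e ([:0,0,1:] * (smult e q - pderiv q)) x) (at x)"
      using 2 by (auto simp: flat_exp_def)
    moreover have "\<forall>\<^sub>F y in nhds x. flat_exp e q y = 0"
      using eventually_nhds_in_open[of "{..<0}" x] 2 by (auto elim!: eventually_mono simp: flat_exp_def)
    ultimately show ?thesis by (rule DERIV_local_cong)
  next
    case 3
    \<comment> \<open>With \<open>y = 1 / h\<close> the difference quotient at 0 from the right is
      \<open>y * poly q y * exp (- e * y)\<close>; the extra factor \<open>y\<close> is the
      \<open>pCons 0\<close>.\<close>
    have "((\<lambda>y::real. poly (pCons 0 q) y * exp (- e * y)) \<longlongrightarrow> 0) at_top"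
      by (rule poly_times_exp_tendsto_0[OF assms])
    then have "((\<lambda>h. poly (pCons 0 q) (inverse h) * exp (- e * inverse h)) \<longlongrightarrow> 0) (at_right 0)"
      by (rule filterlim_compose[OF _ filterlim_inverse_at_top_right])
    then have "((\<lambda>h. flat_exp e q h / h) \<longlongrightarrow> 0) (at_right 0)"
      by (rule Lim_transform_eventually)
        (auto simp: eventually_at_filter flat_exp_def field_simps)
    moreover have "((\<lambda>h. flat_exp e q h / h) \<longlongrightarrow> 0) (at_left 0)"
      by (rule Lim_transform_eventually[OF tendsto_const])
        (auto simp: eventually_at_filter flat_exp_def)
    ultimately have "((\<lambda>h. flat_exp e q h / h) \<longlongrightarrow> 0) (at 0)"
      by (rule filterlim_split_at[rotated])
    then show ?thesis using 3 by (simp add: DERIV_def flat_exp_def)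
  qed
qed

lemma times_differentiable_flat_exp:
  assumes "e > 0"
  shows "times_differentiable n (flat_exp e q)"
proof (induction n arbitrary: q)
  case 0
  then show ?case using flat_exp_has_derivative[OF assms] by (auto simp: real_differentiable_def)
next
  case (Suc n)
  then show ?case using times_differentiable_SucI[OF flat_exp_has_derivative[OF assms]] by blast
qed

definition bump :: "real \<Rightarrow> real \<Rightarrow> real \<Rightarrow> real \<Rightarrow> real" where
  "bump e a b x = flat_exp e 1 (x - a) * flat_exp e 1 (b - x)"

lemma times_differentiable_bump:
  assumes "e > 0"
  shows "times_differentiable n (bump e a b)"
proof -
  have "times_differentiable n (\<lambda>x. flat_exp e 1 (1 * x + - a) * flat_exp e 1 ((-1) * x + b))"
    by (intro times_differentiable_mult times_differentiable_affine times_differentiable_flat_exp assms)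
  then show ?thesis by (simp add: bump_def[abs_def])
qed

lemma bump_outside: "x \<notin> {a<..<b} \<Longrightarrow> bump e a b x = 0"
  by (auto simp: bump_def flat_exp_def)

lemma bump_inside: "x \<in> {a<..<b} \<Longrightarrow> bump e a b x = exp (- e / (x - a)) * exp (- e / (b - x))"
  by (auto simp: bump_def flat_exp_def)

lemma bump_bounds: "e > 0 \<Longrightarrow> bump e a b x \<in> {0..1}"
  by (auto simp: bump_def flat_exp_def intro!: mult_le_one)

lemma continuous_on_bump: "e > 0 \<Longrightarrow> continuous_on S (bump e a b)"
  by (intro continuous_at_imp_continuous_on ballI differentiable_imp_continuous_within times_differentiable_imp[of 0] times_differentiable_bump)

text \<open>Zero mean is what makes the primitive starting at \<open>- pi\<close> vanish again to
  the right of \<open>b\<close>, so that its support is compact in the open interval.\<close>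

lemma test_fun_antiderivative:
  assumes sm: "\<And>n. times_differentiable n \<psi>"
    and ab: "- pi < a" "a \<le> b" "b < pi" and out: "\<And>x. x \<notin> {a..b} \<Longrightarrow> \<psi> x = 0"
    and int0: "integral {-pi..pi} \<psi> = 0"
  obtains \<phi> where "test_fun \<phi>" "deriv \<phi> = \<psi>"
proof -
  define \<phi> where "\<phi> x = integral {-pi..x} \<psi>" for x
  have cont: "continuous_on S \<psi>" for S
    by (intro continuous_at_imp_continuous_on ballI differentiable_imp_continuous_within times_differentiable_imp[of 0] sm)
  \<comment> \<open>For \<open>x < - pi\<close> the interval is empty and the integral is 0 by
    convention, which is the value wanted.\<close>
  have left: "\<phi> x = 0" if "x < a" for x
    unfolding \<phi>_def using that by (intro integral_eq_zero_on out) auto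
  have D: "(\<phi> has_real_derivative \<psi> x) (at x)" for x
  proof (cases "x < a")
    case True
    have "((\<lambda>x. 0) has_real_derivative \<psi> x) (at x)" using out[of x] True by simp
    moreover have "\<forall>\<^sub>F y in nhds x. \<phi> y = 0"
      using eventually_nhds_in_open[of "{..<a}" x] True by (auto elim!: eventually_mono simp: left)
    ultimately show ?thesis by (rule DERIV_local_cong)
  next
    case False
    have "(\<phi> has_real_derivative \<psi> x) (at x within {-pi..x+1})"
      unfolding \<phi>_def using False ab by (intro integral_has_real_derivative cont) auto
    moreover have "at x within {-pi..x+1} = at x"
      using False ab by (intro at_within_interior) auto
    ultimately show ?thesis by simp
  qed
  then have d: "deriv \<phi> = \<psi>" by (auto simp: DERIV_imp_deriv)
  have "(deriv ^^ n) \<phi> differentiable at x" for n x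
    by (rule times_differentiable_higher_deriv, rule times_differentiable_Suc_imp, rule times_differentiable_SucI[OF D sm])
  moreover have "\<phi> x = 0" if "x \<notin> {a..b}" for x
  proof (cases "x < a")
    case False
    then have "x > b" using that by auto
    show ?thesis
    proof (cases "x \<le> pi")
      case True
      have "integral {-pi..x} \<psi> + integral {x..pi} \<psi> = integral {-pi..pi} \<psi>"
        using True \<open>x > b\<close> ab by (intro Henstock_Kurzweil_Integration.integral_combine integrable_continuous_real cont) auto
      moreover have "integral {x..pi} \<psi> = 0"
        using \<open>x > b\<close> by (intro integral_eq_zero_on out) auto
      ultimately show ?thesis by (simp add: \<phi>_def int0)
    next
      case False
      have "integral {-pi..pi} \<psi> + integral {pi..x} \<psi> = integral {-pi..x} \<psi>"
        using False \<open>x > b\<close> ab by (intro Henstock_Kurzweil_Integration.integral_combine integrable_continuous_real cont) auto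
      moreover have "integral {pi..x} \<psi> = 0"
        using \<open>x > b\<close> ab by (intro integral_eq_zero_on out) auto
      ultimately show ?thesis by (simp add: \<phi>_def int0)
    qed
  qed (rule left)
  ultimately have "test_fun \<phi>" unfolding test_fun_def using ab by blast
  then show ?thesis using d that by blast
qed

text \<open>The sets over which \<open>H\<close> integrates to 0 form a Dynkin system containing the
  half lines, hence contain all Borel sets. A Lebesgue set is an F-sigma set up to a null set, so
  \<open>H\<close> integrates to 0 over it as well, and \<open>density_zero\<close> applies.\<close>

lemma AE_zero_if_indefinite_integral_zero:
  fixes H :: "real \<Rightarrow> 'a::euclidean_space"
  assumes H: "H absolutely_integrable_on {a..b}"
    and int0: "\<And>x. x \<in> {a..b} \<Longrightarrow> integral {a..x} H = 0"
  shows "AE x in lebesgue. x \<in> {a..b} \<longrightarrow> H x = 0"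
proof -
  define H' where "H' x = indicator {a..b} x *\<^sub>R H x" for x
  have H': "integrable lebesgue H'" using H unfolding set_integrable_def H'_def .
  have sub: "set_integrable lebesgue A H'" if "A \<in> sets lebesgue" for A
    using H' integrable_mult_indicator[OF that H'] by (simp add: set_integrable_def)
  have SB: "sigma_sets UNIV (range (\<lambda>x::real. {..x})) = sets borel"
    by (simp add: borel_eq_atMost)
  have BL: "A \<in> sets lebesgue" if "A \<in> sets borel" for A :: "real set"
    using that by (simp add: sets_completionI_sets)
  have borel: "set_lebesgue_integral lebesgue A H' = 0" if "A \<in> sets borel" for A
  proof -
    have "A \<in> sigma_sets UNIV (range (\<lambda>x::real. {..x}))"
      using that by (simp add: borel_eq_atMost)
    then show ?thesis
    proof (induction rule: sigma_sets_induct_disjoint[rotated 2, consumes 1, case_names basic empty compl union int sub])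
      case (basic A)
      then obtain x where A: "A = {..x}" by auto
      have "(LINT t:A|lebesgue. H' t) = (LINT t:{a..min x b}|lebesgue. H t)"
        unfolding set_lebesgue_integral_def H'_def A
        by (rule Bochner_Integration.integral_cong) (simp_all add: indicator_def)
      also have "\<dots> = 0"
      proof (cases "a \<le> min x b")
        case True
        then have "H absolutely_integrable_on {a..min x b}"
          by (intro set_integrable_subset[OF H]) auto
        then show ?thesis using int0[of "min x b"] True by (simp add: set_lebesgue_integral_eq_integral)
      qed (simp add: set_lebesgue_integral_def)
      finally show ?case .
    next
      case empty
      show ?case by (simp add: set_lebesgue_integral_def)
    next
      case (compl A)
      then have A: "A \<in> sets lebesgue" "UNIV - A \<in> sets lebesgue"
        unfolding SB by (auto intro!: BL)
      have "(LINT t:A \<union> (UNIV - A)|lebesgue. H' t) = (LINT t:A|lebesgue. H' t) + (LINT t:UNIV - A|lebesgue. H' t)"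
        by (rule set_integral_Un) (use A sub in auto)
      moreover have "(LINT t:A \<union> (UNIV - A)|lebesgue. H' t) = (LINT t:{a..b}|lebesgue. H t)"
        unfolding set_lebesgue_integral_def H'_def
        by (rule Bochner_Integration.integral_cong) (simp_all add: indicator_def)
      moreover have "(LINT t:{a..b}|lebesgue. H t) = 0"
      proof (cases "a \<le> b")
        case True
        then show ?thesis using int0[of b] set_lebesgue_integral_eq_integral(2)[OF H] by simp
      qed (simp add: set_lebesgue_integral_def)
      ultimately show ?case using compl by simp
    next
      case (union A)
      then have A: "A i \<in> sets lebesgue" for i
        using range_subsetD[OF union(2)] unfolding SB by (intro BL)
      have "(LINT x:(\<Union>i. A i)|lebesgue. H' x) = (\<Sum>i. (LINT x:A i|lebesgue. H' x))"
        by (rule lebesgue_integral_countable_add)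
          (use A sub union(1) in \<open>auto simp: disjoint_family_on_def\<close>)
      then show ?case using union by simp
    next
      case int
      show ?case by (auto simp: Int_stable_def)
    next
      case sub
      show ?case by simp
    qed
  qed
  interpret finite_measure "lebesgue_on {a..b}"
    by (rule finite_measure_lebesgue_on) simp
  have "AE x in lebesgue_on {a..b}. H x = 0"
  proof (rule density_zero)
    show "integrable (lebesgue_on {a..b}) H"
      using H by (simp add: integrable_restrict_space set_integrable_def)
    fix A assume "A \<in> sets (lebesgue_on {a..b})"
    then have "A \<in> sets lebesgue" by (simp add: sets_restrict_space_iff)
    then obtain C T where CT: "fsigma C" "T \<in> null_sets lebesgue" "C \<union> T = A" "disjnt C T"
      by (rule lebesgue_set_almost_fsigma)
    have C: "C \<in> sets borel" using CT(1) by (cases rule: fsigma.cases) (auto intro!: borel_closed sets.countable_UN)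
    have T: "AE x in lebesgue. x \<notin> T"
      using CT(2) by (rule AE_not_in)
    have "(LINT x:A|lebesgue. H' x) = (LINT x:C|lebesgue. H' x)"
    proof (rule set_integral_cong_set)
      show "set_borel_measurable lebesgue A H'"
        using sub[OF \<open>A \<in> sets lebesgue\<close>]
        unfolding set_integrable_def set_borel_measurable_def by (rule borel_measurable_integrable)
      show "set_borel_measurable lebesgue C H'"
        using sub[OF BL[OF C]]
        unfolding set_integrable_def set_borel_measurable_def by (rule borel_measurable_integrable)
      show "AE x in lebesgue. (x \<in> C) = (x \<in> A)"
        using T by (rule AE_mp) (rule AE_I2, use CT(3) in blast)
    qed
    then have "(LINT x:A|lebesgue. H' x) = 0" using borel[OF C] by simp
    moreover have "(LINT x:A|lebesgue_on {a..b}. H x) = (LINT x:A|lebesgue. H' x)"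
      by (simp add: set_lebesgue_integral_def integral_restrict_space H'_def, simp add: mult.commute)
    ultimately show "(LINT x:A|lebesgue_on {a..b}. H x) = 0" by simp
  qed
  then show ?thesis by (simp add: AE_restrict_space_iff)
qed

section \<open>Functions with vanishing weak derivative\<close>

lemma LINT_Ioo_eq_integral:
  fixes f :: "real \<Rightarrow> 'a::euclidean_space"
  assumes "f absolutely_integrable_on {a..b}"
  shows "(LINT z:{a<..<b}|lebesgue. f z) = integral {a..b} f"
proof -
  have "f absolutely_integrable_on {a<..<b}"
    using assms by (simp add: absolutely_integrable_on_Icc_iff_Ioo)
  then show ?thesis
    by (simp add: set_lebesgue_integral_eq_integral(2) integral_open_interval_real)
qed

lemma absolutely_integrable_mult_continuous:
  fixes f g :: "real \<Rightarrow> 'a::{real_normed_field,euclidean_space}"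
  assumes "f absolutely_integrable_on {a..b}" "continuous_on {a..b} g"
  shows "(\<lambda>x. f x * g x) absolutely_integrable_on {a..b}"
proof -
  have "(\<lambda>x. g x * f x) absolutely_integrable_on {a..b}"
  proof (rule absolutely_integrable_bounded_measurable_product[OF bilinear_times _ _ _ assms(1)])
    show "g \<in> borel_measurable (lebesgue_on {a..b})"
      by (intro continuous_imp_measurable_on_sets_lebesgue assms) auto
    show "bounded (g ` {a..b})"
      using compact_continuous_image[OF assms(2)] compact_imp_bounded by auto
  qed auto
  then show ?thesis by (simp add: mult.commute)
qed

text \<open>Derivatives of test functions are exactly the smooth, compactly supported functions of
  zero mean, so every bump is corrected by a multiple of one fixed bump \<open>\<eta>\<close>.
  Sharpening the bumps to indicators then shows that \<open>F - c\<close> integrates to 0 over every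
  subinterval.\<close>

lemma du_Bois_Reymond:
  fixes F :: "real \<Rightarrow> complex"
  assumes F: "F absolutely_integrable_on {-pi..pi}"
    and test: "\<And>\<phi>. test_fun \<phi> \<Longrightarrow> (LINT z:{-pi<..<pi}|lebesgue. F z * complex_of_real (deriv \<phi> z)) = 0"
  obtains c where "AE z in lebesgue. z \<in> {-pi..pi} \<longrightarrow> F z = c"
proof -
  have pi1: "1 < pi" using pi_gt3 by simp
  define \<eta> where "\<eta> = bump 1 (-1) 1"
  have c\<eta>: "continuous_on {-pi..pi} \<eta>" unfolding \<eta>_def by (rule continuous_on_bump) simp
  define I0 where "I0 = integral {-pi..pi} \<eta>"
  have "I0 \<noteq> 0"
  proof
    assume "I0 = 0"
    moreover have "(\<eta> has_integral I0) (cbox (-pi) pi)"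
      unfolding I0_def using integrable_continuous_real[OF c\<eta>] by auto
    ultimately have "\<eta> 0 = 0"
      using c\<eta> bump_bounds[of 1 "-1" 1] pi1 by (intro has_integral_0_cbox_imp_0[of "-pi" pi \<eta>]) (auto simp: \<eta>_def)
    then show False by (simp add: \<eta>_def bump_inside)
  qed
  \<comment> \<open>The only constant for which \<open>F - c\<close> is orthogonal to
    \<open>\<eta>\<close>.\<close>
  define c where "c = integral {-pi..pi} (\<lambda>z. F z * of_real (\<eta> z)) / of_real I0"
  define H where "H z = F z - c" for z
  have H: "H absolutely_integrable_on {-pi..pi}"
    unfolding H_def by (intro set_integral_diff(1) F absolutely_integrable_continuous_real continuous_intros)
  have H\<psi>: "integral {-pi..pi} (\<lambda>z. H z * of_real (bump e a b z)) = 0"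
    if e: "e > 0" and ab: "- pi < a" "a < b" "b < pi" for e a b
  proof -
    define \<psi> where "\<psi> = bump e a b"
    define s where "s = integral {-pi..pi} \<psi> / I0"
    have c\<psi>: "continuous_on {-pi..pi} \<psi>" unfolding \<psi>_def by (rule continuous_on_bump[OF e])
    note ii = integrable_continuous_real[OF c\<psi>] integrable_continuous_real[OF c\<eta>]
    have td: "times_differentiable n (\<lambda>x. \<psi> x + (- s) * \<eta> x)" for n
      unfolding \<psi>_def \<eta>_def
      by (intro times_differentiable_add times_differentiable_mult times_differentiable_const times_differentiable_bump e) simp
    have "integral {-pi..pi} (\<lambda>x. \<psi> x + (- s) * \<eta> x) = integral {-pi..pi} \<psi> + integral {-pi..pi} (\<lambda>x. (- s) * \<eta> x)"
      by (intro integral_add integrable_on_mult_right ii)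
    also have "\<dots> = integral {-pi..pi} \<psi> + (- s) * I0"
      unfolding I0_def by (simp only: integral_mult_right)
    also have "\<dots> = 0" using \<open>I0 \<noteq> 0\<close> by (simp add: s_def)
    finally have int0: "integral {-pi..pi} (\<lambda>x. \<psi> x + (- s) * \<eta> x) = 0" .
    obtain \<phi> where \<phi>: "test_fun \<phi>" "deriv \<phi> = (\<lambda>x. \<psi> x + (- s) * \<eta> x)"
    proof (rule test_fun_antiderivative[OF td _ _ _ _ int0, of "min a (-1)" "max b 1"])
      show "- pi < min a (-1)" "min a (-1) \<le> max b 1" "max b 1 < pi" using ab pi1 by auto
      show "\<psi> x + (- s) * \<eta> x = 0" if "x \<notin> {min a (-1)..max b 1}" for x
      proof -
        have "x \<notin> {a<..<b}" "x \<notin> {-1<..<1}" using that by auto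
        from this[THEN bump_outside] show ?thesis unfolding \<psi>_def \<eta>_def by simp
      qed
    qed (use that in blast)
    have aF: "(\<lambda>z. F z * of_real (\<psi> z)) absolutely_integrable_on {-pi..pi}"
        "(\<lambda>z. F z * of_real (\<eta> z)) absolutely_integrable_on {-pi..pi}"
      by (intro absolutely_integrable_mult_continuous[OF F] continuous_intros c\<psi> c\<eta>)+
    have iF: "(\<lambda>z. F z * of_real (\<psi> z)) integrable_on {-pi..pi}"
        "(\<lambda>z. F z * of_real (\<eta> z)) integrable_on {-pi..pi}"
      by (rule aF[THEN set_lebesgue_integral_eq_integral(1)])+
    have eq: "F z * of_real (deriv \<phi> z) = F z * of_real (\<psi> z) - of_real s * (F z * of_real (\<eta> z))" for z
      by (simp add: \<phi>(2) algebra_simps)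
    have "0 = (LINT z:{-pi<..<pi}|lebesgue. F z * complex_of_real (deriv \<phi> z))" using test[OF \<phi>(1)] by simp
    also have "\<dots> = integral {-pi..pi} (\<lambda>z. F z * of_real (\<psi> z) - of_real s * (F z * of_real (\<eta> z)))"
      unfolding eq by (intro LINT_Ioo_eq_integral set_integral_diff(1) aF set_integrable_mult_right)
    also have "\<dots> = integral {-pi..pi} (\<lambda>z. F z * of_real (\<psi> z)) - of_real s * (c * of_real I0)"
      using iF \<open>I0 \<noteq> 0\<close> by (simp add: integral_diff c_def integrable_on_mult_right)
    finally have e1: "integral {-pi..pi} (\<lambda>z. F z * of_real (\<psi> z)) = c * of_real (integral {-pi..pi} \<psi>)"
      using \<open>I0 \<noteq> 0\<close> by (simp add: s_def)
    have "integral {-pi..pi} (\<lambda>z. H z * of_real (\<psi> z)) = integral {-pi..pi} (\<lambda>z. F z * of_real (\<psi> z) - c * of_real (\<psi> z))"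
      by (simp add: H_def algebra_simps)
    also have "\<dots> = integral {-pi..pi} (\<lambda>z. F z * of_real (\<psi> z)) - integral {-pi..pi} (\<lambda>z. c * of_real (\<psi> z))"
      by (intro integral_diff iF integrable_continuous_real continuous_intros c\<psi>)
    also have "\<dots> = 0"
      using e1 integral_linear[OF ii(1) bounded_linear_of_real[where 'a=complex]] by (simp add: o_def)
    finally show ?thesis by (simp add: \<psi>_def)
  qed
  have zero: "integral {a..b} H = 0" if ab: "- pi < a" "a < b" "b < pi" for a b
  proof -
    \<comment> \<open>As \<open>e = 1 / (k + 1)\<close> decreases to 0, the bump tends to 1 inside
      \<open>{a<..<b}\<close> and stays 0 outside; being at most 1, it allows
      \<open>norm (H z)\<close> as dominating function.\<close>
    define f where "f k z = H z * of_real (bump (1 / (real k + 1)) a b z)" for k z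
    have fi: "f k integrable_on {-pi..pi}" for k
      unfolding f_def
      by (intro set_lebesgue_integral_eq_integral(1) absolutely_integrable_mult_continuous H
          continuous_on_of_real continuous_on_bump) simp
    have conv: "(\<lambda>k. f k x) \<longlonglongrightarrow> (if x \<in> {a<..<b} then H x else 0)" for x
    proof (cases "x \<in> {a<..<b}")
      case True
      define p q where "p = x - a" and "q = b - x"
      have "p > 0" "q > 0" using True by (auto simp: p_def q_def)
      have lim0: "(\<lambda>k. - (1 / (real k + 1))) \<longlonglongrightarrow> 0" by real_asymp
      have "(\<lambda>k. exp (- (1 / (real k + 1)) / p) * exp (- (1 / (real k + 1)) / q)) \<longlonglongrightarrow> exp (0 / p) * exp (0 / q)"
        using \<open>p > 0\<close> \<open>q > 0\<close> by (intro tendsto_mult tendsto_exp tendsto_divide lim0 tendsto_const) auto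
      then have "(\<lambda>k. exp (- (1 / (real k + 1)) / p) * exp (- (1 / (real k + 1)) / q)) \<longlonglongrightarrow> 1 * 1" by simp
      then have "(\<lambda>k. of_real (exp (- (1 / (real k + 1)) / p) * exp (- (1 / (real k + 1)) / q))) \<longlonglongrightarrow> (of_real (1 * 1) :: complex)"
        by (rule tendsto_of_real)
      then have "(\<lambda>k. H x * of_real (bump (1 / (real k + 1)) a b x)) \<longlonglongrightarrow> H x * of_real (1 * 1)"
        unfolding bump_inside[OF True] p_def q_def by (rule tendsto_mult_left)
      then show ?thesis using True by (simp add: f_def)
    next
      case False
      then show ?thesis unfolding f_def bump_outside[OF False] if_not_P[OF False] by simp
    qed
    have "(\<lambda>k. integral {-pi..pi} (f k)) \<longlonglongrightarrow> integral {-pi..pi} (\<lambda>x. if x \<in> {a<..<b} then H x else 0)"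
    proof (rule dominated_convergence(2)[OF fi])
      show "(\<lambda>z. norm (H z)) integrable_on {-pi..pi}" using H absolutely_integrable_on_def by blast
      show "norm (f k x) \<le> norm (H x)" for k x
        using bump_bounds[of "1 / (real k + 1)" a b x] unfolding f_def norm_mult
        by (intro mult_left_le) auto
      show "(\<lambda>k. f k x) \<longlonglongrightarrow> (if x \<in> {a<..<b} then H x else 0)" for x by (rule conv)
    qed
    moreover have "integral {-pi..pi} (f k) = 0" for k
      unfolding f_def by (rule H\<psi>[OF _ ab]) simp
    ultimately have "integral {-pi..pi} (\<lambda>x. if x \<in> {a<..<b} then H x else 0) = 0"
      using LIMSEQ_unique[of "\<lambda>k. 0"] by (simp add: LIMSEQ_const_iff)
    moreover have "integral {-pi..pi} (\<lambda>x. if x \<in> {a<..<b} then H x else 0) = integral ({a<..<b} \<inter> {-pi..pi}) H"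
      using integral_restrict_Int[of "{-pi..pi}" "{a<..<b}" H] by simp
    moreover have "{a<..<b} \<inter> {-pi..pi} = {a<..<b}" using ab by auto
    ultimately show ?thesis by (simp add: integral_open_interval_real)
  qed
  have Hi: "H integrable_on {-pi..pi}" using H absolutely_integrable_on_def by blast
  have cont: "continuous_on {-pi..pi} (\<lambda>x. integral {-pi..x} H)"
    by (rule indefinite_integral_continuous_1[OF Hi])
  have const: "integral {-pi..x} H = integral {-pi..0} H" if "x \<in> {-pi<..<pi}" for x
  proof -
    consider "x < 0" | "x = 0" | "x > 0" by linarith
    then show ?thesis
    proof cases
      case 1
      have "integral {-pi..x} H + integral {x..0} H = integral {-pi..0} H"
        using that 1 by (intro Henstock_Kurzweil_Integration.integral_combine integrable_on_subinterval[OF Hi]) auto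
      then show ?thesis using zero[of x 0] that 1 by simp
    next
      case 3
      have "integral {-pi..0} H + integral {0..x} H = integral {-pi..x} H"
        using that 3 by (intro Henstock_Kurzweil_Integration.integral_combine integrable_on_subinterval[OF Hi]) auto
      then show ?thesis using zero[of 0 x] that 3 by simp
    qed simp
  qed
  \<comment> \<open>Bumps do not reach the endpoints. The indefinite integral is constant on the
    open interval, hence by continuity on the closed one, and it is 0 at
    \<open>- pi\<close>.\<close>
  have const': "integral {-pi..x} H = integral {-pi..0} H" if "x \<in> {-pi..pi}" for x
  proof (rule continuous_constant_on_closure[of "{-pi<..<pi}" "\<lambda>x. integral {-pi..x} H"])
    show "continuous_on (closure {-pi<..<pi}) (\<lambda>x. integral {-pi..x} H)" using cont pi1 by simp
    show "x \<in> closure {-pi<..<pi}" using that pi1 by simp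
  qed (rule const)
  have "integral {-pi..x} H = 0" if "x \<in> {-pi..pi}" for x
    using const'[OF that] const'[of "-pi"] pi1 by simp
  from AE_zero_if_indefinite_integral_zero[OF H this]
  show thesis using that[of c] by (auto simp: H_def)
qed

subsection \<open>Square integrable functions\<close>

text \<open>Measurability is a separate conjunct because integrability of the squared norm does not
  imply it.\<close>

definition sq_integrable_on :: "(real \<Rightarrow> 'a::{real_normed_field,euclidean_space}) \<Rightarrow> real set \<Rightarrow> bool" where
  "sq_integrable_on f S \<longleftrightarrow>
     f \<in> borel_measurable (lebesgue_on S) \<and> (\<lambda>x. (norm (f x))\<^sup>2) absolutely_integrable_on S"

definition sq_norm_on :: "(real \<Rightarrow> 'a::{real_normed_field,euclidean_space}) \<Rightarrow> real set \<Rightarrow> real" where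
  "sq_norm_on f S = sqrt (integral S (\<lambda>x. (norm (f x))\<^sup>2))"

lemma sq_integrable_on_measurable: "sq_integrable_on f S \<Longrightarrow> f \<in> borel_measurable (lebesgue_on S)"
  by (simp add: sq_integrable_on_def)

lemma sq_integrable_on_square: "sq_integrable_on f S \<Longrightarrow> (\<lambda>x. (norm (f x))\<^sup>2) integrable_on S"
  by (simp add: sq_integrable_on_def set_lebesgue_integral_eq_integral(1))

lemma sq_norm_on_nonneg: "sq_norm_on f S \<ge> 0"
  by (cases "(\<lambda>x. (norm (f x))\<^sup>2) integrable_on S")
    (auto simp: sq_norm_on_def integral_nonneg not_integrable_integral)

lemma sq_norm_on_power2:
  "(sq_norm_on f S)\<^sup>2 = integral S (\<lambda>x. (norm (f x))\<^sup>2)"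
  by (cases "(\<lambda>x. (norm (f x))\<^sup>2) integrable_on S")
    (auto simp: sq_norm_on_def integral_nonneg not_integrable_integral)

lemma sq_integrable_on_bound:
  fixes f :: "real \<Rightarrow> 'a::{real_normed_field,euclidean_space}" and g :: "real \<Rightarrow> 'b::{real_normed_field,euclidean_space}"
  assumes "S \<in> sets lebesgue" "f \<in> borel_measurable (lebesgue_on S)" "sq_integrable_on g S"
    and "\<And>x. x \<in> S \<Longrightarrow> norm (f x) \<le> C * norm (g x)"
  shows "sq_integrable_on f S"
  unfolding sq_integrable_on_def
proof (intro conjI assms(2) measurable_bounded_by_integrable_imp_absolutely_integrable[OF _ assms(1)])
  show "(\<lambda>x. (norm (f x))\<^sup>2) \<in> borel_measurable (lebesgue_on S)"
    using assms(2) by measurable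
  show "(\<lambda>x. C\<^sup>2 * (norm (g x))\<^sup>2) integrable_on S"
    by (intro integrable_on_mult_right sq_integrable_on_square assms)
  show "norm ((norm (f x))\<^sup>2) \<le> C\<^sup>2 * (norm (g x))\<^sup>2" if "x \<in> S" for x
    using power_mono[OF assms(4)[OF that] norm_ge_zero, of 2] by (simp add: power_mult_distrib)
qed

lemma sq_integrable_on_continuous:
  fixes f :: "real \<Rightarrow> 'a::{real_normed_field,euclidean_space}"
  assumes "continuous_on {a..b} f"
  shows "sq_integrable_on f {a..b}"
  unfolding sq_integrable_on_def
  by (intro conjI continuous_imp_measurable_on_sets_lebesgue absolutely_integrable_continuous_real
      continuous_intros assms) auto

lemma sq_integrable_on_product:
  fixes f g :: "real \<Rightarrow> 'a::{real_normed_field,euclidean_space}"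
  assumes S: "S \<in> sets lebesgue" and f: "sq_integrable_on f S" and g: "sq_integrable_on g S"
  shows "(\<lambda>x. f x * g x) absolutely_integrable_on S"
proof (rule measurable_bounded_by_integrable_imp_absolutely_integrable[OF _ S])
  show "(\<lambda>x. f x * g x) \<in> borel_measurable (lebesgue_on S)"
    using f g by (intro borel_measurable_times sq_integrable_on_measurable)
  show "(\<lambda>x. (norm (f x))\<^sup>2 + (norm (g x))\<^sup>2) integrable_on S"
    by (intro integrable_add sq_integrable_on_square f g)
  show "norm (f x * g x) \<le> (norm (f x))\<^sup>2 + (norm (g x))\<^sup>2" for x
    using sum_squares_bound[of "norm (f x)" "norm (g x)"]
      mult_nonneg_nonneg[OF norm_ge_zero[of "f x"] norm_ge_zero[of "g x"]]
    unfolding norm_mult by linarith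
qed

lemma sq_integrable_on_imp_absolutely_integrable:
  fixes f :: "real \<Rightarrow> 'a::{real_normed_field,euclidean_space}"
  assumes "sq_integrable_on f {a..b}"
  shows "f absolutely_integrable_on {a..b}"
  using sq_integrable_on_product[OF _ assms sq_integrable_on_continuous[of a b "\<lambda>x. 1"]] by simp

lemma sq_integrable_on_norm:
  assumes "sq_integrable_on f S"
  shows "sq_integrable_on (\<lambda>x. norm (f x)) S"
  using assms by (auto simp: sq_integrable_on_def)

lemma sq_integrable_on_cmult:
  fixes f :: "real \<Rightarrow> 'a::{real_normed_field,euclidean_space}"
  assumes "S \<in> sets lebesgue" "sq_integrable_on f S"
  shows "sq_integrable_on (\<lambda>x. c * f x) S"
  by (rule sq_integrable_on_bound[OF assms(1) _ assms(2), where C = "norm c"])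
    (use assms in \<open>auto simp: sq_integrable_on_def norm_mult\<close>)

lemma sq_integrable_on_add:
  fixes f g :: "real \<Rightarrow> 'a::{real_normed_field,euclidean_space}"
  assumes S: "S \<in> sets lebesgue" and f: "sq_integrable_on f S" and g: "sq_integrable_on g S"
  shows "sq_integrable_on (\<lambda>x. f x + g x) S"
  unfolding sq_integrable_on_def
proof (intro conjI measurable_bounded_by_integrable_imp_absolutely_integrable[OF _ S])
  have fg: "f \<in> borel_measurable (lebesgue_on S)" "g \<in> borel_measurable (lebesgue_on S)"
    using f g by (auto simp: sq_integrable_on_def)
  then show m: "(\<lambda>x. f x + g x) \<in> borel_measurable (lebesgue_on S)"
    by measurable
  from fg show "(\<lambda>x. (norm (f x + g x))\<^sup>2) \<in> borel_measurable (lebesgue_on S)" by measurable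
  show "(\<lambda>x. 2 * (norm (f x))\<^sup>2 + 2 * (norm (g x))\<^sup>2) integrable_on S"
    by (intro integrable_add integrable_on_mult_right sq_integrable_on_square f g)
  show "norm ((norm (f x + g x))\<^sup>2) \<le> 2 * (norm (f x))\<^sup>2 + 2 * (norm (g x))\<^sup>2" for x
    using power_mono[OF norm_triangle_ineq[of "f x" "g x"] norm_ge_zero, of 2]
      sum_squares_bound[of "norm (f x)" "norm (g x)"]
    by (simp add: power2_sum)
qed

lemma sq_integrable_on_diff:
  fixes f g :: "real \<Rightarrow> 'a::{real_normed_field,euclidean_space}"
  assumes S: "S \<in> sets lebesgue" and f: "sq_integrable_on f S" and g: "sq_integrable_on g S"
  shows "sq_integrable_on (\<lambda>x. f x - g x) S"
  using sq_integrable_on_add[OF S f sq_integrable_on_cmult[OF S g, of "-1"]] by simp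

lemma sq_integrable_on_subset:
  assumes "sq_integrable_on f T" "S \<subseteq> T" "S \<in> sets lebesgue"
  shows "sq_integrable_on f S"
  unfolding sq_integrable_on_def
proof
  have f: "f \<in> borel_measurable (lebesgue_on T)" "(\<lambda>x. (norm (f x))\<^sup>2) absolutely_integrable_on T"
    using assms(1) by (simp_all add: sq_integrable_on_def)
  show "f \<in> borel_measurable (lebesgue_on S)"
    by (rule measurable_restrict_mono[OF f(1) assms(2)])
  show "(\<lambda>x. (norm (f x))\<^sup>2) absolutely_integrable_on S"
    by (rule set_integrable_subset[OF f(2) assms(3,2)])
qed

text \<open>The integral of \<open>(f - t g)^2\<close> is a nonnegative quadratic polynomial in
  \<open>t\<close>; for \<open>B > 0\<close> its value at the minimum \<open>t = M / B\<close> is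
  the claim.\<close>

lemma Cauchy_Schwarz_integral:
  fixes f g :: "real \<Rightarrow> real"
  assumes S: "S \<in> sets lebesgue" and f: "sq_integrable_on f S" and g: "sq_integrable_on g S"
  shows "(integral S (\<lambda>x. f x * g x))\<^sup>2 \<le> integral S (\<lambda>x. (f x)\<^sup>2) * integral S (\<lambda>x. (g x)\<^sup>2)"
proof -
  define A B M where "A = integral S (\<lambda>x. (f x)\<^sup>2)" and "B = integral S (\<lambda>x. (g x)\<^sup>2)"
    and "M = integral S (\<lambda>x. f x * g x)"
  have i: "(\<lambda>x. (f x)\<^sup>2) integrable_on S" "(\<lambda>x. (g x)\<^sup>2) integrable_on S" "(\<lambda>x. f x * g x) integrable_on S"
    using sq_integrable_on_square[OF f] sq_integrable_on_square[OF g]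
      set_lebesgue_integral_eq_integral(1)[OF sq_integrable_on_product[OF S f g]] by auto
  have q: "0 \<le> A + t\<^sup>2 * B - 2 * t * M" for t
  proof -
    have "0 \<le> integral S (\<lambda>x. (f x)\<^sup>2 + t\<^sup>2 * (g x)\<^sup>2 - 2 * t * (f x * g x))"
    proof (rule integral_nonneg)
      show "(\<lambda>x. (f x)\<^sup>2 + t\<^sup>2 * (g x)\<^sup>2 - 2 * t * (f x * g x)) integrable_on S"
        by (intro integrable_diff integrable_add integrable_on_mult_right i)
      show "0 \<le> (f x)\<^sup>2 + t\<^sup>2 * (g x)\<^sup>2 - 2 * t * (f x * g x)" for x
        using zero_le_power2[of "f x - t * g x"] by (simp add: power2_diff power_mult_distrib algebra_simps)
    qed
    also have "\<dots> = A + t\<^sup>2 * B - 2 * t * M"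
      unfolding A_def B_def M_def
      by (simp add: integral_diff integral_add integrable_add integrable_on_mult_right i)
    finally show ?thesis .
  qed
  have "A \<ge> 0" "B \<ge> 0" unfolding A_def B_def by (intro integral_nonneg i; simp)+
  have "M\<^sup>2 \<le> A * B"
  proof (cases "B = 0")
    case True
    have "M = 0"
    proof (rule ccontr)
      assume "M \<noteq> 0"
      \<comment> \<open>With \<open>B = 0\<close> this \<open>t\<close> gives the quadratic the
        value \<open>- 1\<close>.\<close>
      then show False using q[of "(A + 1) / (2 * M)"] True by (simp add: field_simps)
    qed
    then show ?thesis using True by simp
  next
    case False
    then have "B > 0" using \<open>B \<ge> 0\<close> by simp
    have "0 \<le> A + (M / B)\<^sup>2 * B - 2 * (M / B) * M" by (rule q)
    also have "\<dots> = A - M\<^sup>2 / B" using \<open>B > 0\<close> by (simp add: field_simps power2_eq_square)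
    finally show ?thesis using \<open>B > 0\<close> by (simp add: field_simps)
  qed
  then show ?thesis by (simp add: A_def B_def M_def)
qed

lemma integral_norm_product_le:
  fixes f g :: "real \<Rightarrow> 'a::{real_normed_field,euclidean_space}"
  assumes S: "S \<in> sets lebesgue" and f: "sq_integrable_on f S" and g: "sq_integrable_on g S"
  shows "integral S (\<lambda>x. norm (f x) * norm (g x)) \<le> sq_norm_on f S * sq_norm_on g S"
proof (rule power2_le_imp_le)
  show "(integral S (\<lambda>x. norm (f x) * norm (g x)))\<^sup>2 \<le> (sq_norm_on f S * sq_norm_on g S)\<^sup>2"
    using Cauchy_Schwarz_integral[OF S sq_integrable_on_norm[OF f] sq_integrable_on_norm[OF g]]
    by (simp add: power_mult_distrib sq_norm_on_power2)
qed (simp add: sq_norm_on_nonneg)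

lemma norm_integral_product_le:
  fixes f g :: "real \<Rightarrow> 'a::{real_normed_field,euclidean_space}"
  assumes S: "S \<in> sets lebesgue" and f: "sq_integrable_on f S" and g: "sq_integrable_on g S"
  shows "norm (integral S (\<lambda>x. f x * g x)) \<le> sq_norm_on f S * sq_norm_on g S"
proof -
  have "norm (integral S (\<lambda>x. f x * g x)) \<le> integral S (\<lambda>x. norm (f x) * norm (g x))"
  proof (rule integral_norm_bound_integral)
    show "(\<lambda>x. f x * g x) integrable_on S"
      using sq_integrable_on_product[OF S f g] by (rule set_lebesgue_integral_eq_integral(1))
    show "(\<lambda>x. norm (f x) * norm (g x)) integrable_on S"
      using sq_integrable_on_product[OF S sq_integrable_on_norm[OF f] sq_integrable_on_norm[OF g]]
      by (rule set_lebesgue_integral_eq_integral(1))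
  qed (simp add: norm_mult)
  then show ?thesis using integral_norm_product_le[OF S f g] by linarith
qed

lemma sq_norm_on_triangle:
  fixes f g :: "real \<Rightarrow> 'a::{real_normed_field,euclidean_space}"
  assumes S: "S \<in> sets lebesgue" and f: "sq_integrable_on f S" and g: "sq_integrable_on g S"
  shows "sq_norm_on (\<lambda>x. f x + g x) S \<le> sq_norm_on f S + sq_norm_on g S"
proof (rule power2_le_imp_le)
  have i: "(\<lambda>x. norm (f x) * norm (g x)) integrable_on S"
    using sq_integrable_on_product[OF S sq_integrable_on_norm[OF f] sq_integrable_on_norm[OF g]]
    by (rule set_lebesgue_integral_eq_integral(1))
  note ii = sq_integrable_on_square[OF f] sq_integrable_on_square[OF g] i
  have "(sq_norm_on (\<lambda>x. f x + g x) S)\<^sup>2 \<le> integral S (\<lambda>x. (norm (f x))\<^sup>2 + (norm (g x))\<^sup>2 + 2 * (norm (f x) * norm (g x)))"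
    unfolding sq_norm_on_power2
  proof (rule integral_le)
    show "(norm (f x + g x))\<^sup>2 \<le> (norm (f x))\<^sup>2 + (norm (g x))\<^sup>2 + 2 * (norm (f x) * norm (g x))" for x
      using power_mono[OF norm_triangle_ineq[of "f x" "g x"] norm_ge_zero, of 2] by (simp add: power2_sum)
  qed (intro sq_integrable_on_square sq_integrable_on_add S f g integrable_add integrable_on_mult_right i)+
  also have "\<dots> = (sq_norm_on f S)\<^sup>2 + (sq_norm_on g S)\<^sup>2 + 2 * integral S (\<lambda>x. norm (f x) * norm (g x))"
    unfolding sq_norm_on_power2 by (simp add: integral_add integrable_add integrable_on_mult_right ii)
  also have "\<dots> \<le> (sq_norm_on f S + sq_norm_on g S)\<^sup>2"
    using integral_norm_product_le[OF S f g] by (simp add: power2_sum)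
  finally show "(sq_norm_on (\<lambda>x. f x + g x) S)\<^sup>2 \<le> (sq_norm_on f S + sq_norm_on g S)\<^sup>2" .
qed (simp add: sq_norm_on_nonneg)

lemma sq_norm_on_cmult:
  fixes f :: "real \<Rightarrow> 'a::{real_normed_field,euclidean_space}"
  shows "sq_norm_on (\<lambda>x. c * f x) S = norm c * sq_norm_on f S"
  by (simp add: sq_norm_on_def norm_mult power_mult_distrib real_sqrt_mult)

lemma sq_norm_on_mono:
  assumes "sq_integrable_on f S" "sq_integrable_on g S" "\<And>x. x \<in> S \<Longrightarrow> norm (f x) \<le> norm (g x)"
  shows "sq_norm_on f S \<le> sq_norm_on g S"
  unfolding sq_norm_on_def
  by (intro real_sqrt_le_mono integral_le sq_integrable_on_square assms power_mono) auto

lemma sq_norm_on_AE_cong: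
  assumes "AE x in lebesgue. x \<in> S \<longrightarrow> f x = g x"
  shows "sq_norm_on f S = sq_norm_on g S"
proof -
  obtain N where N: "N \<in> null_sets lebesgue" "{x. \<not> (x \<in> S \<longrightarrow> f x = g x)} \<subseteq> N"
    using assms by (auto simp: eventually_ae_filter)
  have "integral S (\<lambda>x. (norm (f x))\<^sup>2) = integral S (\<lambda>x. (norm (g x))\<^sup>2)"
    by (rule integral_spike[of N]) (use N in \<open>auto simp: negligible_iff_null_sets\<close>)
  then show ?thesis by (simp add: sq_norm_on_def)
qed

section \<open>The given space and norm in terms of gauge integrals\<close>

lemma L2per0_iff: "L2per0 v \<longleftrightarrow> sq_integrable_on v {-pi..pi} \<and> integral {-pi..pi} v = 0"
proof -
  have "set_borel_measurable lebesgue {-pi..pi} v \<longleftrightarrow> v \<in> borel_measurable (lebesgue_on {-pi..pi})"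
    by (simp add: set_borel_measurable_def borel_measurable_restrict_space_iff)
  moreover have "(LINT z:{-pi..pi}|lebesgue. v z) = integral {-pi..pi} v" if "sq_integrable_on v {-pi..pi}"
    by (rule set_lebesgue_integral_eq_integral(2)[OF sq_integrable_on_imp_absolutely_integrable[OF that]])
  ultimately show ?thesis unfolding L2per0_def sq_integrable_on_def by auto
qed

lemma L2norm_eq:
  assumes "sq_integrable_on v {-pi..pi}"
  shows "L2norm v = sq_norm_on v {-pi..pi}"
  using assms unfolding L2norm_def sq_norm_on_def sq_integrable_on_def
  by (simp add: set_lebesgue_integral_eq_integral(2))

lemma sq_integrable_on_AE_cong:
  fixes f g :: "real \<Rightarrow> 'a::{real_normed_field,euclidean_space}"
  assumes S: "S \<in> sets lebesgue" and g: "sq_integrable_on g S"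
    and fg: "AE x in lebesgue. x \<in> S \<longrightarrow> f x = g x"
  shows "sq_integrable_on f S"
  unfolding sq_integrable_on_def
proof
  obtain N where N: "N \<in> null_sets lebesgue" "{x. \<not> (x \<in> S \<longrightarrow> f x = g x)} \<subseteq> N"
    using fg by (auto simp: eventually_ae_filter)
  have "(\<lambda>x. indicator S x *\<^sub>R g x) \<in> borel_measurable lebesgue"
    using g S by (simp add: sq_integrable_on_def borel_measurable_restrict_space_iff)
  moreover have "AE x in lebesgue. indicator S x *\<^sub>R g x = indicator S x *\<^sub>R f x"
    using fg by (rule AE_mp) (rule AE_I2, auto simp: indicator_def)
  ultimately have "(\<lambda>x. indicator S x *\<^sub>R f x) \<in> borel_measurable lebesgue"
    by (rule borel_measurable_AE)
  then show "f \<in> borel_measurable (lebesgue_on S)"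
    using S by (simp add: borel_measurable_restrict_space_iff)
  show "(\<lambda>x. (norm (f x))\<^sup>2) absolutely_integrable_on S"
    by (rule absolutely_integrable_spike[where f = "\<lambda>x. (norm (g x))\<^sup>2" and S = N])
      (use g N in \<open>auto simp: sq_integrable_on_def negligible_iff_null_sets\<close>)
qed

subsection \<open>Explicit solutions\<close>

text \<open>The coefficient \<open>c_star - U_star\<close> on one period as a plain polynomial, free
  of the floor function.\<close>

definition wave_gap :: "real \<Rightarrow> real" where
  "wave_gap z = (pi\<^sup>2 - z\<^sup>2) / 6"

text \<open>The primitive of \<open>6 / (pi^2 - z^2)\<close> that vanishes at 0; the factor
  \<open>3 / pi\<close> comes from partial fractions.\<close>

definition ell :: "real \<Rightarrow> real" where
  "ell z = (3 / pi) * (ln (pi + z) - ln (pi - z))"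

text \<open>The integrating factor with \<open>p E' = - lam E\<close>. Its modulus behaves like
  \<open>(pi - z) powr (3 Re lam / pi)\<close> at \<open>pi\<close> and like
  \<open>(pi + z) powr (- (3 Re lam / pi))\<close> at \<open>- pi\<close>.\<close>

definition hom_factor :: "complex \<Rightarrow> real \<Rightarrow> complex" where
  "hom_factor lam z = exp (- lam * of_real (ell z))"

text \<open>With \<open>p = wave_gap\<close>, the polynomial \<open>u = poly_sol lam\<close> solves \<open>p u'' + (p' - lam) u' + u = 0\<close>, which is
  \<open>(A - lam) v = 0\<close> for \<open>v = u'\<close>; this is Jacobi's equation of degree 2. The function \<open>w = adj_sol lam\<close>
  solves the transposed equation \<open>(p w')' + lam w' + w = 0\<close>, and \<open>adj_flux = p w' + lam w\<close>.\<close>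

definition poly_sol :: "complex \<Rightarrow> real \<Rightarrow> complex" where
  "poly_sol lam z = (of_real z)\<^sup>2 + 3 * lam * of_real z + 3 * lam\<^sup>2 - (of_real pi)\<^sup>2 / 3"

definition poly_sol' :: "complex \<Rightarrow> real \<Rightarrow> complex" where
  "poly_sol' lam z = 2 * of_real z + 3 * lam"

definition adj_sol :: "complex \<Rightarrow> real \<Rightarrow> complex" where
  "adj_sol lam z = hom_factor lam z * poly_sol lam z"

definition adj_flux :: "complex \<Rightarrow> real \<Rightarrow> complex" where
  "adj_flux lam z = of_real (wave_gap z) * hom_factor lam z * poly_sol' lam z"

lemma wave_gap_factor: "wave_gap z = (pi - z) * (pi + z) / 6"
  by (simp add: wave_gap_def power2_eq_square algebra_simps)

lemma wave_gap_pos: "z \<in> {-pi<..<pi} \<Longrightarrow> wave_gap z > 0"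
  by (simp add: wave_gap_factor)

lemma wave_gap_nonneg: "z \<in> {-pi..pi} \<Longrightarrow> wave_gap z \<ge> 0"
  by (simp add: wave_gap_factor)

lemma continuous_on_wave_gap: "continuous_on S wave_gap"
  unfolding wave_gap_def by (intro continuous_intros) auto

lemma ell_has_derivative:
  assumes "z \<in> {-pi<..<pi}"
  shows "(ell has_real_derivative 1 / wave_gap z) (at z)"
proof -
  have nz: "pi + z > 0" "pi - z > 0" using assms by auto
  have "(ell has_real_derivative (3 / pi) * (1 / (pi + z) + 1 / (pi - z))) (at z)"
    unfolding ell_def using nz by (auto intro!: derivative_eq_intros)
  moreover have "(3 / pi) * (1 / (pi + z) + 1 / (pi - z)) = 1 / wave_gap z"
  proof -
    have "1 / (pi + z) + 1 / (pi - z) = 2 * pi / ((pi + z) * (pi - z))"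
      using nz by (simp add: field_simps)
    then show ?thesis using nz by (simp add: wave_gap_factor mult.commute)
  qed
  ultimately show ?thesis by simp
qed

lemma hom_factor_has_derivative:
  assumes "z \<in> {-pi<..<pi}"
  shows "(hom_factor lam has_vector_derivative - lam * hom_factor lam z / of_real (wave_gap z)) (at z)"
proof -
  have "((\<lambda>z. complex_of_real (ell z)) has_vector_derivative of_real (1 / wave_gap z)) (at z)"
    using ell_has_derivative[OF assms]
    by (intro has_vector_derivative_of_real) (simp add: has_real_derivative_iff_has_vector_derivative)
  then have "((\<lambda>z. - lam * complex_of_real (ell z)) has_vector_derivative - lam * of_real (1 / wave_gap z)) (at z)"
    by (rule has_vector_derivative_mult_right)
  from field_vector_diff_chain_at[OF this, of exp, OF DERIV_exp]
  show ?thesis by (simp add: hom_factor_def[abs_def] o_def field_simps)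
qed

lemma hom_factor_nonzero [simp]: "hom_factor lam z \<noteq> 0"
  by (simp add: hom_factor_def)

lemma norm_hom_factor: "cmod (hom_factor lam z) = exp (- Re lam * ell z)"
  by (simp add: hom_factor_def)

lemma poly_sol_has_derivative: "(poly_sol lam has_vector_derivative poly_sol' lam z) (at z within S)"
  unfolding poly_sol_def[abs_def] poly_sol'_def power2_eq_square
  by (auto intro!: derivative_eq_intros simp: algebra_simps)

lemma poly_sol'_has_derivative: "(poly_sol' lam has_vector_derivative 2) (at z within S)"
  unfolding poly_sol'_def[abs_def]
  by (auto intro!: derivative_eq_intros)

lemma wave_gap_has_derivative:
  "((\<lambda>z. complex_of_real (wave_gap z)) has_vector_derivative of_real (- z / 3)) (at z within S)"
  unfolding wave_gap_def
  by (rule has_vector_derivative_of_real)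
    (auto intro!: derivative_eq_intros simp: has_real_derivative_iff_has_vector_derivative[symmetric])

lemma adj_sol_has_derivative:
  assumes "z \<in> {-pi<..<pi}"
  shows "(adj_sol lam has_vector_derivative
    (hom_factor lam z * poly_sol' lam z + - lam * hom_factor lam z / of_real (wave_gap z) * poly_sol lam z)) (at z)"
  unfolding adj_sol_def[abs_def]
  by (intro has_vector_derivative_mult hom_factor_has_derivative poly_sol_has_derivative assms)

lemma adj_flux_has_derivative:
  assumes z: "z \<in> {-pi<..<pi}"
  shows "(adj_flux lam has_vector_derivative - adj_sol lam z) (at z)"
proof -
  let ?p = "complex_of_real (wave_gap z)" and ?E = "hom_factor lam z"
  have nz: "?p \<noteq> 0" using wave_gap_pos[OF z] by simp
  have "(adj_flux lam has_vector_derivative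
      (?p * ?E * 2 + (?p * (- lam * ?E / ?p) + of_real (- z / 3) * ?E) * poly_sol' lam z)) (at z)"
    unfolding adj_flux_def[abs_def]
    by (intro has_vector_derivative_mult hom_factor_has_derivative poly_sol'_has_derivative wave_gap_has_derivative z)
  also have "?p * ?E * 2 + (?p * (- lam * ?E / ?p) + of_real (- z / 3) * ?E) * poly_sol' lam z
      = ?E * (2 * ?p + (- lam - of_real z / 3) * poly_sol' lam z)"
    using nz by (simp add: algebra_simps)
  \<comment> \<open>This is the equation \<open>p P'' + (p' - lam) P' = - P\<close> of the
    polynomial solution, with \<open>P'' = 2\<close> and \<open>p' = - z / 3\<close>.\<close>
  also have "2 * ?p + (- lam - of_real z / 3) * poly_sol' lam z = - poly_sol lam z"
    by (simp add: wave_gap_def poly_sol_def poly_sol'_def field_simps power2_eq_square)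
  finally show ?thesis by (simp add: adj_sol_def)
qed

lemma continuous_on_poly_sol: "continuous_on S (poly_sol lam)"
  by (meson continuous_on_eq_continuous_within has_vector_derivative_continuous poly_sol_has_derivative)

lemma continuous_on_poly_sol': "continuous_on S (poly_sol' lam)"
  by (meson continuous_on_eq_continuous_within has_vector_derivative_continuous poly_sol'_has_derivative)

lemma continuous_on_ell: "S \<subseteq> {-pi<..<pi} \<Longrightarrow> continuous_on S ell"
  by (meson DERIV_isCont continuous_at_imp_continuous_on ell_has_derivative subsetD)

lemma continuous_on_hom_factor: "S \<subseteq> {-pi<..<pi} \<Longrightarrow> continuous_on S (hom_factor lam)"
  unfolding hom_factor_def by (intro continuous_intros continuous_on_ell)

lemma continuous_on_adj_sol: "S \<subseteq> {-pi<..<pi} \<Longrightarrow> continuous_on S (adj_sol lam)"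
  unfolding adj_sol_def by (intro continuous_intros continuous_on_hom_factor continuous_on_poly_sol)

lemma continuous_on_adj_flux: "S \<subseteq> {-pi<..<pi} \<Longrightarrow> continuous_on S (adj_flux lam)"
  unfolding adj_flux_def
  by (intro continuous_intros continuous_on_hom_factor continuous_on_poly_sol' continuous_on_wave_gap)

section \<open>Growth of \<open>ell\<close> and square integrability of the integrating
  factor\<close>

lemma ell_mono:
  assumes "- pi < x" "x \<le> y" "y < pi"
  shows "ell x \<le> ell y"
  unfolding ell_def using assms by (intro mult_left_mono diff_mono) auto

lemma ell_minus: "ell (- z) = - ell z"
  by (simp add: ell_def algebra_simps)

lemma ell_0: "ell 0 = 0"
  by (simp add: ell_def)

lemma exp_ell:
  assumes "z \<in> {-pi<..<pi}"
  shows "(pi - z) * exp (pi / 3 * ell z) = pi + z"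
proof -
  have "pi / 3 * ell z = ln (pi + z) - ln (pi - z)" by (simp add: ell_def)
  then have "exp (pi / 3 * ell z) = exp (ln (pi + z) - ln (pi - z))" by (simp only:)
  also have "\<dots> = (pi + z) / (pi - z)" using assms by (simp add: exp_diff)
  finally have "exp (pi / 3 * ell z) = (pi + z) / (pi - z)" .
  then show ?thesis using assms by simp
qed

lemma ell_at_top: "filterlim ell at_top (at_left pi)"
proof -
  have "((\<lambda>z. ln (pi + z)) \<longlongrightarrow> ln (pi + pi)) (at_left pi)"
    by (intro tendsto_intros) auto
  moreover have "filterlim (\<lambda>z. - ln (pi - z)) at_top (at_left pi)"
    by real_asymp
  ultimately have "filterlim (\<lambda>z. ln (pi + z) + - ln (pi - z)) at_top (at_left pi)"
    by (rule filterlim_tendsto_add_at_top)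
  then have "filterlim (\<lambda>z. (3 / pi) * (ln (pi + z) + - ln (pi - z))) at_top (at_left pi)"
    by (intro filterlim_tendsto_pos_mult_at_top[OF tendsto_const]) auto
  then show ?thesis by (simp add: ell_def[abs_def])
qed

text \<open>In the open strip the endpoint singularity of \<open>hom_factor\<close> is weaker than an inverse square
  root, and antiderivatives of square integrable functions that vanish there do so like a square root.\<close>

lemma sqrt_times_exp_ell_tendsto_0:
  assumes "\<bar>r\<bar> < pi / 6"
  shows "((\<lambda>z. sqrt (pi - z) * exp (- r * ell z)) \<longlongrightarrow> 0) (at_left pi)"
proof -
  \<comment> \<open>By \<open>exp_ell\<close>, \<open>pi - z\<close> equals
    \<open>(pi + z) * exp (- pi / 3 * ell z)\<close>, so for \<open>z > 0\<close> the square of the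
    function is at most \<open>2 * pi * exp (- c * ell z)\<close> with this \<open>c\<close>, which
    is positive exactly in the open strip.\<close>
  define c where "c = pi / 3 - 2 * \<bar>r\<bar>"
  have "c > 0" using assms by (simp add: c_def)
  have "((\<lambda>y. exp (- c * y)) \<longlongrightarrow> 0) at_top"
    using \<open>c > 0\<close> by real_asymp
  from filterlim_compose[OF this ell_at_top]
  have "((\<lambda>z. 2 * pi * exp (- c * ell z)) \<longlongrightarrow> 2 * pi * 0) (at_left pi)"
    by (rule tendsto_mult_left)
  then have "((\<lambda>z. sqrt (2 * pi * exp (- c * ell z))) \<longlongrightarrow> sqrt 0) (at_left pi)"
    by (intro tendsto_real_sqrt) simp
  then have lim: "((\<lambda>z. sqrt (2 * pi * exp (- c * ell z))) \<longlongrightarrow> 0) (at_left pi)" by simp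
  show ?thesis
  proof (rule Lim_null_comparison[OF _ lim])
    have "\<forall>\<^sub>F z in at_left pi. z \<in> {0<..<pi}"
      by (rule eventually_at_leftI[of 0]) auto
    then show "\<forall>\<^sub>F z in at_left pi. norm (sqrt (pi - z) * exp (- r * ell z)) \<le> sqrt (2 * pi * exp (- c * ell z))"
    proof eventually_elim
      case (elim z)
      then have z: "z \<in> {-pi<..<pi}" by auto
      have "ell z \<ge> 0" using ell_mono[of 0 z] elim by (simp add: ell_0)
      then have "- r * ell z \<le> \<bar>r\<bar> * ell z" by (intro mult_right_mono) auto
      then have "2 * (- r * ell z) \<le> pi / 3 * ell z + - c * ell z" by (simp add: c_def algebra_simps)
      then have "exp (2 * (- r * ell z)) \<le> exp (pi / 3 * ell z) * exp (- c * ell z)"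
        by (simp flip: exp_add)
      then have "(pi - z) * exp (2 * (- r * ell z)) \<le> (pi - z) * (exp (pi / 3 * ell z) * exp (- c * ell z))"
        using elim by (intro mult_left_mono) auto
      also have "\<dots> = (pi + z) * exp (- c * ell z)" using exp_ell[OF z] by (simp flip: mult.assoc)
      also have "\<dots> \<le> 2 * pi * exp (- c * ell z)" using elim by (intro mult_right_mono) auto
      finally have "sqrt ((pi - z) * exp (2 * (- r * ell z))) \<le> sqrt (2 * pi * exp (- c * ell z))"
        by (rule real_sqrt_le_mono)
      moreover have "exp (2 * (- r * ell z)) = (exp (- r * ell z))\<^sup>2" by (rule exp_double)
      ultimately show ?case using elim by (simp add: real_sqrt_mult)
    qed
  qed
qed

lemma exp_ell_powr:
  assumes "z \<in> {-pi<..<pi}"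
  shows "exp (a * ell z) = (pi + z) powr (3 * a / pi) * (pi - z) powr (- (3 * a / pi))"
  using assms by (simp add: powr_def ell_def field_simps flip: exp_add)

lemma integrable_powr_endpoints:
  assumes "q < 1"
  shows "(\<lambda>z. (pi - z) powr (- q)) integrable_on {-pi..pi}"
    and "(\<lambda>z. (pi + z) powr (- q)) integrable_on {-pi..pi}"
proof -
  have "((\<lambda>z. (pi - z) powr (- q)) has_integral - ((pi - pi) powr (1 - q)) / (1 - q) - - ((pi - - pi) powr (1 - q)) / (1 - q)) {-pi..pi}"
  proof (rule fundamental_theorem_of_calculus_interior)
    show "continuous_on {-pi..pi} (\<lambda>z. - ((pi - z) powr (1 - q)) / (1 - q))"
      using assms by (intro continuous_intros continuous_on_powr') auto
    show "((\<lambda>z. - ((pi - z) powr (1 - q)) / (1 - q)) has_vector_derivative (pi - x) powr (- q)) (at x)"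
      if "x \<in> {-pi<..<pi}" for x
      using assms that unfolding has_real_derivative_iff_has_vector_derivative[symmetric]
      by (auto intro!: derivative_eq_intros)
  qed auto
  then show 1: "(\<lambda>z. (pi - z) powr (- q)) integrable_on {-pi..pi}" by blast
  then show "(\<lambda>z. (pi + z) powr (- q)) integrable_on {-pi..pi}"
    using Henstock_Kurzweil_Integration.integrable_reflect_real[where f = "\<lambda>z. (pi + z) powr (- q)" and a = "-pi" and b = pi] by simp
qed

text \<open>The squared modulus is a power of \<open>(pi - z) / (pi + z)\<close> with exponent
  \<open>6 * Re lam / pi\<close>. It is singular at no more than one endpoint, with order
  \<open>q < 1\<close>; the sum of two powers in the bound serves both signs of
  \<open>Re lam\<close>.\<close>

lemma sq_integrable_hom_factor:
  assumes "\<bar>Re lam\<bar> < pi / 6"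
  shows "sq_integrable_on (hom_factor lam) {-pi..pi}"
proof -
  define q where "q = \<bar>6 * Re lam / pi\<bar>"
  have q: "0 \<le> q" "q < 1" using assms by (auto simp: q_def abs_less_iff field_simps)
  have m: "hom_factor lam \<in> borel_measurable (lebesgue_on {-pi..pi})"
    unfolding hom_factor_def[abs_def] ell_def[abs_def]
    by (intro measurable_completion measurable_restrict_space1) measurable
  have bd: "(cmod (hom_factor lam z))\<^sup>2 \<le> (2 * pi) powr q * ((pi - z) powr (- q) + (pi + z) powr (- q))"
    if z: "z \<in> {-pi<..<pi}" for z
  proof -
    have e: "(cmod (hom_factor lam z))\<^sup>2 = exp ((- 2 * Re lam) * ell z)"
      by (simp add: norm_hom_factor flip: exp_double)
    have le: "(pi + z) powr q \<le> (2 * pi) powr q" "(pi - z) powr q \<le> (2 * pi) powr q"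
      using z q by (auto intro!: powr_mono2)
    have "6 * Re lam / pi = q \<or> 6 * Re lam / pi = - q" by (auto simp: q_def)
    then show ?thesis
    proof
      assume "6 * Re lam / pi = q"
      then have "(cmod (hom_factor lam z))\<^sup>2 = (pi + z) powr (- q) * (pi - z) powr q"
        unfolding e exp_ell_powr[OF z] by (simp add: mult.commute)
      also have "\<dots> \<le> (pi + z) powr (- q) * (2 * pi) powr q" using le by (intro mult_left_mono) auto
      also have "\<dots> \<le> (2 * pi) powr q * ((pi - z) powr (- q) + (pi + z) powr (- q))"
        by (simp add: algebra_simps)
      finally show ?thesis .
    next
      assume "6 * Re lam / pi = - q"
      then have "(cmod (hom_factor lam z))\<^sup>2 = (pi + z) powr q * (pi - z) powr (- q)"
        unfolding e exp_ell_powr[OF z] by (simp add: minus_divide_left[symmetric])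
      also have "\<dots> \<le> (2 * pi) powr q * (pi - z) powr (- q)" using le by (intro mult_right_mono) auto
      also have "\<dots> \<le> (2 * pi) powr q * ((pi - z) powr (- q) + (pi + z) powr (- q))"
        by (simp add: algebra_simps)
      finally show ?thesis .
    qed
  qed
  have "(\<lambda>z. (cmod (hom_factor lam z))\<^sup>2) absolutely_integrable_on {-pi<..<pi}"
  proof (rule measurable_bounded_by_integrable_imp_absolutely_integrable)
    have "hom_factor lam \<in> borel_measurable (lebesgue_on {-pi<..<pi})"
      by (rule measurable_restrict_mono[OF m]) auto
    then show "(\<lambda>z. (cmod (hom_factor lam z))\<^sup>2) \<in> borel_measurable (lebesgue_on {-pi<..<pi})"
      by measurable
    show "(\<lambda>z. (2 * pi) powr q * ((pi - z) powr (- q) + (pi + z) powr (- q))) integrable_on {-pi<..<pi}"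
      using integrable_powr_endpoints[OF q(2)]
      by (intro integrable_on_mult_right integrable_add) (simp_all add: integrable_on_Icc_iff_Ioo)
    show "norm ((cmod (hom_factor lam z))\<^sup>2) \<le> (2 * pi) powr q * ((pi - z) powr (- q) + (pi + z) powr (- q))"
      if "z \<in> {-pi<..<pi}" for z using bd[OF that] by simp
  qed simp
  then show ?thesis using m unfolding sq_integrable_on_def
    by (simp add: absolutely_integrable_on_Icc_iff_Ioo)
qed

subsection \<open>The domain of the operator\<close>

text \<open>Absolute continuity of \<open>G\<close> with derivative \<open>g\<close>, in the
  integrated form that a weak derivative delivers and that is insensitive to changes of
  \<open>g\<close> on null sets.\<close>

definition antiderivative_on :: "(real \<Rightarrow> 'a::{real_normed_field,euclidean_space}) \<Rightarrow> (real \<Rightarrow> 'a) \<Rightarrow> real \<Rightarrow> real \<Rightarrow> bool" where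
  "antiderivative_on G g a b \<longleftrightarrow>
     g absolutely_integrable_on {a..b} \<and> (\<forall>x\<in>{a..b}. G x = G a + integral {a..x} g)"

lemma antiderivative_on_absolutely_integrable:
  "antiderivative_on G g a b \<Longrightarrow> g absolutely_integrable_on {a..b}"
  by (simp add: antiderivative_on_def)

lemma antiderivative_onI:
  assumes "g absolutely_integrable_on {a..b}" "\<And>x. x \<in> {a..b} \<Longrightarrow> G x = G a + integral {a..x} g"
  shows "antiderivative_on G g a b"
  using assms unfolding antiderivative_on_def by blast

lemma antiderivative_onD:
  "antiderivative_on G g a b \<Longrightarrow> x \<in> {a..b} \<Longrightarrow> G x = G a + integral {a..x} g"
  unfolding antiderivative_on_def by blast

lemma antiderivative_on_integrable: "antiderivative_on G g a b \<Longrightarrow> g integrable_on {a..b}"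
  unfolding antiderivative_on_def by (blast intro: set_lebesgue_integral_eq_integral(1))

lemma antiderivative_on_diff:
  assumes "antiderivative_on G g a b" "a \<le> c" "c \<le> d" "d \<le> b"
  shows "G d - G c = integral {c..d} g"
proof -
  have "g integrable_on {a..d}"
    using assms by (intro integrable_on_subinterval[OF antiderivative_on_integrable[OF assms(1)]]) auto
  from Henstock_Kurzweil_Integration.integral_combine[OF assms(2,3) this]
  have "integral {a..c} g + integral {c..d} g = integral {a..d} g" .
  moreover have "c \<in> {a..b}" "d \<in> {a..b}" using assms by auto
  then have "G c = G a + integral {a..c} g" "G d = G a + integral {a..d} g"
    using assms(1) unfolding antiderivative_on_def by blast+
  ultimately show ?thesis by (simp add: algebra_simps)
qed

lemma antiderivative_on_subinterval:
  assumes "antiderivative_on G g a b" "a \<le> c" "d \<le> b"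
  shows "antiderivative_on G g c d"
  unfolding antiderivative_on_def
proof
  show "g absolutely_integrable_on {c..d}"
    using assms by (intro set_integrable_subset[OF antiderivative_on_absolutely_integrable[OF assms(1)]]) auto
  show "\<forall>x\<in>{c..d}. G x = G c + integral {c..x} g"
  proof
    fix x assume x: "x \<in> {c..d}"
    then have "c \<le> x" "x \<le> b" using assms(3) by auto
    then have "G x - G c = integral {c..x} g"
      by (rule antiderivative_on_diff[OF assms(1,2)])
    then show "G x = G c + integral {c..x} g" by (simp only: diff_eq_eq add.commute[of "G c"])
  qed
qed

lemma antiderivative_on_by_parts:
  assumes "antiderivative_on G g a b" "a \<le> b"
    and "\<And>x. x \<in> {a..b} \<Longrightarrow> (\<Phi> has_vector_derivative \<phi> x) (at x within {a..b})"
    and "continuous_on {a..b} \<phi>"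
  shows "integral {a..b} (\<lambda>x. g x * \<Phi> x) = G b * \<Phi> b - G a * \<Phi> a - integral {a..b} (\<lambda>x. G x * \<phi> x)"
  by (rule ac_by_parts(3)[OF assms(2) antiderivative_on_absolutely_integrable[OF assms(1)]
        antiderivative_onD[OF assms(1)] assms(3,4)])

lemma antiderivative_on_continuous:
  assumes "antiderivative_on G g a b"
  shows "continuous_on {a..b} G"
proof -
  have "continuous_on {a..b} (\<lambda>x. G a + integral {a..x} g)"
    by (intro continuous_intros indefinite_integral_continuous_1 antiderivative_on_integrable[OF assms])
  then show ?thesis
    by (rule continuous_on_eq) (rule antiderivative_onD[OF assms, symmetric])
qed

section \<open>The zero-mean antiderivative\<close>

lemma antideriv0_antiderivative:
  fixes v :: "real \<Rightarrow> complex"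
  assumes v: "v absolutely_integrable_on {-pi..pi}"
  shows "antiderivative_on (antideriv0 v) v (-pi) pi"
    and "integral {-pi..pi} (antideriv0 v) = 0"
proof -
  have sub: "(LINT t:{-pi..x}|lebesgue. v t) = integral {-pi..x} v" if "x \<in> {-pi..pi}" for x
    using that by (intro set_lebesgue_integral_eq_integral(2) set_integrable_subset[OF v]) auto
  define m where "m = complex_of_real (1 / (2 * pi)) * (LINT s:{-pi..pi}|lebesgue. (LINT t:{-pi..s}|lebesgue. v t))"
  have u: "antideriv0 v x = integral {-pi..x} v - m" if "x \<in> {-pi..pi}" for x
    using sub[OF that] by (simp add: antideriv0_def m_def)
  show "antiderivative_on (antideriv0 v) v (-pi) pi"
    by (rule antiderivative_onI[OF v]) (simp add: u)
  have cont: "continuous_on {-pi..pi} (\<lambda>x. integral {-pi..x} v)"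
    by (intro indefinite_integral_continuous_1 set_lebesgue_integral_eq_integral(1) v)
  have "(LINT s:{-pi..pi}|lebesgue. (LINT t:{-pi..s}|lebesgue. v t)) = (LINT s:{-pi..pi}|lebesgue. integral {-pi..s} v)"
    by (intro set_lebesgue_integral_cong) (auto simp: sub)
  also have "\<dots> = integral {-pi..pi} (\<lambda>s. integral {-pi..s} v)"
    by (intro set_lebesgue_integral_eq_integral(2) absolutely_integrable_continuous_real cont)
  finally have m: "m = complex_of_real (1 / (2 * pi)) * integral {-pi..pi} (\<lambda>s. integral {-pi..s} v)"
    by (simp add: m_def)
  have "integral {-pi..pi} (antideriv0 v) = integral {-pi..pi} (\<lambda>x. integral {-pi..x} v - m)"
    by (rule integral_cong) (rule u)
  also have "\<dots> = integral {-pi..pi} (\<lambda>s. integral {-pi..s} v) - integral {-pi..pi} (\<lambda>x. m)"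
    by (intro integral_diff integrable_continuous_real cont continuous_intros)
  also have "\<dots> = 0" by (simp add: m scaleR_conv_of_real)
  finally show "integral {-pi..pi} (antideriv0 v) = 0" .
qed

text \<open>Two primitives of \<open>v\<close> differ by a constant, which the zero mean fixes. This
  is how a primitive constructed by other means is recognized as
  \<open>antideriv0 v\<close>.\<close>

lemma antideriv0_unique:
  assumes u: "antiderivative_on u v (-pi) pi" and int0: "integral {-pi..pi} u = 0"
    and x: "x \<in> {-pi..pi}"
  shows "antideriv0 v x = u x"
proof -
  have v: "v absolutely_integrable_on {-pi..pi}" using u by (rule antiderivative_on_absolutely_integrable)
  note a = antideriv0_antiderivative[OF v]
  define c where "c = antideriv0 v (-pi) - u (-pi)"
  have eq: "antideriv0 v y = u y + c" if "y \<in> {-pi..pi}" for y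
  proof -
    have "u y = u (-pi) + integral {-pi..y} v" "antideriv0 v y = antideriv0 v (-pi) + integral {-pi..y} v"
      using u a(1) that unfolding antiderivative_on_def by blast+
    then show ?thesis by (simp add: c_def)
  qed
  have "integral {-pi..pi} (antideriv0 v) = integral {-pi..pi} (\<lambda>y. u y + c)"
    by (rule integral_cong) (rule eq)
  also have "\<dots> = integral {-pi..pi} u + integral {-pi..pi} (\<lambda>y. c)"
    by (intro integral_add integrable_continuous_real continuous_intros antiderivative_on_continuous[OF u])
  finally have "c = 0" using a(2) int0 by simp
  then show ?thesis using eq[OF x] by simp
qed

text \<open>Logarithmic divergence: truncating at distance \<open>s\<close> from \<open>b\<close>,
  the integral of the lower bound already exceeds the supposed total.\<close>

lemma not_integrable_inverse_linear:
  fixes f :: "real \<Rightarrow> real"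
  assumes ab: "a < b" and C: "C > 0" and f: "f integrable_on {a..b}" and N: "negligible N"
    and nn: "\<And>x. x \<in> {a..b} \<Longrightarrow> f x \<ge> 0"
    and ge: "\<And>x. x \<in> {a..<b} - N \<Longrightarrow> f x \<ge> C / (b - x)"
  shows False
proof -
  \<comment> \<open>Changing \<open>f\<close> on the null set makes the lower bound hold at every
    point of \<open>{a..<b}\<close>; at \<open>b\<close> the quotient is 0 by convention, which
    keeps \<open>f'\<close> nonnegative.\<close>
  define f' where "f' x = (if x \<in> N then C / (b - x) else f x)" for x
  have f': "f' integrable_on {a..b}"
    by (rule integrable_spike[OF f N]) (simp add: f'_def)
  have nn': "f' x \<ge> 0" if "x \<in> {a..b}" for x using nn[OF that] C that by (simp add: f'_def)
  define K where "K = integral {a..b} f'"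
  \<comment> \<open>Solves \<open>C * ln ((b - a) / s) = K + 1\<close>, the left side being the
    integral of \<open>C / (b - x)\<close> up to \<open>b - s\<close>.\<close>
  define s where "s = (b - a) * exp (- (K + 1) / C)"
  have "K \<ge> 0" unfolding K_def by (rule integral_nonneg[OF f' nn'])
  then have "exp (- (K + 1) / C) < 1" using C by (simp add: divide_neg_pos)
  then have s: "0 < s" "s < b - a"
    using ab mult_strict_left_mono[of "exp (- (K + 1) / C)" 1 "b - a"] by (auto simp: s_def)
  have "((\<lambda>x. C / (b - x)) has_integral - C * ln (b - (b - s)) - - C * ln (b - a)) {a..b - s}"
    using s ab C unfolding has_real_derivative_iff_has_vector_derivative[symmetric]
    by (intro fundamental_theorem_of_calculus)
      (auto intro!: derivative_eq_intros simp: has_real_derivative_iff_has_vector_derivative[symmetric])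
  moreover have "- C * ln (b - (b - s)) - - C * ln (b - a) = K + 1"
  proof -
    have "ln s = ln (b - a) + - (K + 1) / C"
      unfolding s_def using ab by (subst ln_mult) auto
    then have "C * ln s = C * ln (b - a) - (K + 1)" using C by (simp add: field_simps)
    then show ?thesis by simp
  qed
  ultimately have i: "((\<lambda>x. C / (b - x)) has_integral K + 1) {a..b - s}" by simp
  have "K + 1 = integral {a..b-s} (\<lambda>x. C / (b - x))" using i by (simp add: integral_unique)
  also have "\<dots> \<le> integral {a..b-s} f'"
  proof (rule integral_le)
    show "f' integrable_on {a..b-s}" using s by (intro integrable_on_subinterval[OF f']) auto
    show "C / (b - x) \<le> f' x" if "x \<in> {a..b-s}" for x
      using that s ge[of x] by (auto simp: f'_def)
  qed (use i in blast)
  also have "\<dots> \<le> K" unfolding K_def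
    using s by (intro integral_subset_le integrable_on_subinterval[OF f']) (auto intro: f' nn')
  finally show False by simp
qed

text \<open>If \<open>G pi\<close> were nonzero, \<open>v = G / p\<close> would grow like
  \<open>1 / (pi - z)\<close>, which is not integrable. Thus membership in the maximal domain
  carries its own boundary conditions.\<close>

lemma gap_product_vanishes_right:
  fixes v G :: "real \<Rightarrow> complex"
  assumes v: "v absolutely_integrable_on {-pi..pi}" and G: "continuous_on {-pi..pi} G"
    and vG: "AE x in lebesgue. x \<in> {-pi..pi} \<longrightarrow> of_real (wave_gap x) * v x = G x"
  shows "G pi = 0"
proof (rule ccontr)
  assume "G pi \<noteq> 0"
  define e where "e = cmod (G pi) / 2"
  have "e > 0" using \<open>G pi \<noteq> 0\<close> by (simp add: e_def)
  have "pi \<in> {-pi..pi}" by simp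
  then have "\<exists>d>0. \<forall>x\<in>{-pi..pi}. dist x pi < d \<longrightarrow> dist (G x) (G pi) < e"
    using G \<open>e > 0\<close> unfolding continuous_on_iff by blast
  then obtain d where d: "d > 0" "\<And>x. x \<in> {-pi..pi} \<Longrightarrow> dist x pi < d \<Longrightarrow> dist (G x) (G pi) < e"
    by blast
  define a where "a = max (-pi) (pi - d / 2)"
  have a: "- pi \<le> a" "a < pi" "pi - a < d" using d(1) by (auto simp: a_def max_def)
  obtain N where N: "N \<in> null_sets lebesgue" "{x. \<not> (x \<in> {-pi..pi} \<longrightarrow> of_real (wave_gap x) * v x = G x)} \<subseteq> N"
    using vG by (auto simp: eventually_ae_filter)
  show False
  proof (rule not_integrable_inverse_linear[of a pi "3 * e / pi" "\<lambda>x. cmod (v x)" N])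
    have "v absolutely_integrable_on {a..pi}" using a by (intro set_integrable_subset[OF v]) auto
    then show "(\<lambda>x. cmod (v x)) integrable_on {a..pi}" using absolutely_integrable_on_def by blast
    show "negligible N" using N by (simp add: negligible_iff_null_sets)
    fix x assume x: "x \<in> {a..<pi} - N"
    then have xx: "x \<in> {-pi..pi}" "dist x pi < d" using a by (auto simp: dist_real_def)
    have eq: "of_real (wave_gap x) * v x = G x" using x xx N by auto
    have "cmod (G pi) \<le> cmod (G x) + dist (G x) (G pi)"
      by (metis dist_commute dist_norm norm_triangle_sub)
    then have "e \<le> cmod (G x)" using d(2)[OF xx] by (simp add: e_def)
    also have "\<dots> = wave_gap x * cmod (v x)" using wave_gap_nonneg[OF xx(1)] by (simp flip: eq add: norm_mult)
    \<comment> \<open>Near \<open>pi\<close> the gap is at most \<open>(pi - x) * pi / 3\<close>;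
      this is the origin of the constant \<open>3 * e / pi\<close>.\<close>
    also have "\<dots> \<le> (pi - x) * (2 * pi) / 6 * cmod (v x)"
      unfolding wave_gap_factor using xx x by (intro mult_right_mono divide_right_mono mult_left_mono) auto
    finally show "3 * e / pi / (pi - x) \<le> cmod (v x)" using x by (simp add: field_simps)
  qed (use a \<open>e > 0\<close> in auto)
qed

lemma AE_lebesgue_reflect:
  fixes P :: "real \<Rightarrow> bool"
  assumes "AE x in lebesgue. P x"
  shows "AE x in lebesgue. P (- x)"
proof -
  obtain N where N: "N \<in> null_sets lebesgue" "{x. \<not> P x} \<subseteq> N"
    using assms by (auto simp: eventually_ae_filter)
  have "negligible (uminus ` N)"
    using N(1) by (intro negligible_differentiable_image_negligible)
      (auto simp: negligible_iff_null_sets intro!: derivative_intros differentiable_on_minus differentiable_on_ident)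
  moreover have "{x. \<not> P (- x)} \<subseteq> uminus ` N" using N(2) by (force intro: image_eqI[of _ uminus "- _"])
  ultimately show ?thesis by (auto simp: eventually_ae_filter negligible_iff_null_sets)
qed

lemma gap_product_vanishes:
  fixes v G :: "real \<Rightarrow> complex"
  assumes v: "v absolutely_integrable_on {-pi..pi}" and G: "continuous_on {-pi..pi} G"
    and vG: "AE x in lebesgue. x \<in> {-pi..pi} \<longrightarrow> of_real (wave_gap x) * v x = G x"
  shows "G pi = 0" "G (-pi) = 0"
proof -
  show "G pi = 0" by (rule gap_product_vanishes_right[OF assms])
  have "(\<lambda>x. G (- x)) pi = 0"
  proof (rule gap_product_vanishes_right)
    show "(\<lambda>x. v (- x)) absolutely_integrable_on {-pi..pi}"
      using absolutely_integrable_reflect_real[where f = v and a = "-pi" and b = pi] v by simp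
    show "continuous_on {-pi..pi} (\<lambda>x. G (- x))"
      by (intro continuous_on_compose2[OF G] continuous_intros) auto
    show "AE x in lebesgue. x \<in> {-pi..pi} \<longrightarrow> of_real (wave_gap x) * v (- x) = G (- x)"
      using AE_lebesgue_reflect[OF vG] by (rule AE_mp) (auto simp: wave_gap_def)
  qed
  then show "G (-pi) = 0" by simp
qed

section \<open>The graph of the operator in terms of primitives\<close>

lemma c_star_minus_U_star: "z \<in> {-pi..<pi} \<Longrightarrow> c_star - U_star z = wave_gap z"
proof -
  assume z: "z \<in> {-pi..<pi}"
  then have "\<lfloor>(z + pi) / (2 * pi)\<rfloor> = 0" by (intro floor_unique) auto
  then show ?thesis by (simp add: c_star_def U_star_def wave_gap_def field_simps)
qed

lemma test_funD:
  assumes "test_fun \<phi>"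
  shows "(\<phi> has_real_derivative deriv \<phi> x) (at x)" "continuous_on S (deriv \<phi>)"
    "\<phi> pi = 0" "\<phi> (-pi) = 0"
proof -
  have d: "(deriv ^^ n) \<phi> differentiable at x" for n x using assms unfolding test_fun_def by blast
  show "(\<phi> has_real_derivative deriv \<phi> x) (at x)" using has_deriv_if_differentiable[OF d[of 0]] by simp
  show "continuous_on S (deriv \<phi>)"
    using d[of 1] by (intro continuous_at_imp_continuous_on ballI differentiable_imp_continuous_within) auto
  obtain a b where "-pi < a" "b < pi" "\<forall>x. x \<notin> {a..b} \<longrightarrow> \<phi> x = 0"
    using assms unfolding test_fun_def by blast
  then show "\<phi> pi = 0" "\<phi> (-pi) = 0" by auto
qed

lemma test_fun_has_vector_derivative:
  assumes "test_fun \<phi>"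
  shows "((\<lambda>x. complex_of_real (\<phi> x)) has_vector_derivative of_real (deriv \<phi> x)) (at x within S)"
  using test_funD(1)[OF assms, of x]
  by (intro has_vector_derivative_of_real has_vector_derivative_at_within)
    (simp add: has_real_derivative_iff_has_vector_derivative)

text \<open>Passes from the distributional derivative to a continuous primitive \<open>G\<close> of
  \<open>g\<close> representing \<open>p v\<close>. By \<open>gap_product_vanishes\<close> both
  boundary values are 0, which says more than the zero mean of \<open>g\<close>.\<close>

lemma A_graphE:
  assumes "A_graph v w"
  obtains G g where "sq_integrable_on v {-pi..pi}" "integral {-pi..pi} v = 0"
    "sq_integrable_on g {-pi..pi}" "antiderivative_on G g (-pi) pi" "G pi = 0" "G (-pi) = 0"
    "AE x in lebesgue. x \<in> {-pi..pi} \<longrightarrow> of_real (wave_gap x) * v x = G x"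
    "AE x in lebesgue. x \<in> {-pi..pi} \<longrightarrow> w x = g x + antideriv0 v x"
proof -
  obtain g where g: "L2per0 g" and dd: "dist_deriv (\<lambda>z. complex_of_real (c_star - U_star z) * v z) g"
    and w: "ae_eq_on w (\<lambda>z. g z + antideriv0 v z)" and v: "L2per0 v"
    using assms unfolding A_graph_def by blast
  have v': "sq_integrable_on v {-pi..pi}" "integral {-pi..pi} v = 0"
    and g': "sq_integrable_on g {-pi..pi}" using v g by (auto simp: L2per0_iff)
  note va = sq_integrable_on_imp_absolutely_integrable[OF v'(1)]
  note ga = sq_integrable_on_imp_absolutely_integrable[OF g']
  define G0 where "G0 x = integral {-pi..x} g" for x
  have G0: "antiderivative_on G0 g (-pi) pi" by (rule antiderivative_onI[OF ga]) (simp add: G0_def)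
  have cG0: "continuous_on {-pi..pi} G0" by (rule antiderivative_on_continuous[OF G0])
  define pv where "pv x = v x * complex_of_real (wave_gap x)" for x
  have pva: "pv absolutely_integrable_on {-pi..pi}"
    unfolding pv_def
    by (intro absolutely_integrable_mult_continuous va continuous_on_of_real continuous_on_wave_gap)
  have G0a: "G0 absolutely_integrable_on {-pi..pi}" by (rule absolutely_integrable_continuous_real[OF cG0])
  \<comment> \<open>Both \<open>pv\<close> and \<open>G0\<close> have weak derivative
    \<open>g\<close>, so their difference has weak derivative 0.\<close>
  define F where "F x = pv x - G0 x" for x
  have Fa: "F absolutely_integrable_on {-pi..pi}"
    unfolding F_def by (rule set_integral_diff(1)[OF pva G0a])
  obtain c where c: "AE z in lebesgue. z \<in> {-pi..pi} \<longrightarrow> F z = c"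
  proof (rule du_Bois_Reymond[OF Fa])
    fix \<phi> assume \<phi>: "test_fun \<phi>"
    have c\<phi>: "continuous_on {-pi..pi} \<phi>"
      using test_funD(1)[OF \<phi>] by (meson DERIV_continuous_on has_field_derivative_at_within)
    have cd: "continuous_on {-pi..pi} (\<lambda>x. complex_of_real (deriv \<phi> x))"
      by (intro continuous_intros test_funD(2)[OF \<phi>])
    have i1: "(\<lambda>x. pv x * of_real (deriv \<phi> x)) absolutely_integrable_on {-pi..pi}"
      by (rule absolutely_integrable_mult_continuous[OF pva cd])
    have i2: "(\<lambda>x. G0 x * of_real (deriv \<phi> x)) absolutely_integrable_on {-pi..pi}"
      by (rule absolutely_integrable_mult_continuous[OF G0a cd])
    have i3: "(\<lambda>x. g x * of_real (\<phi> x)) absolutely_integrable_on {-pi..pi}"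
      by (intro absolutely_integrable_mult_continuous[OF ga] continuous_intros c\<phi>)
    have "(LINT z:{-pi<..<pi}|lebesgue. F z * complex_of_real (deriv \<phi> z))
        = integral {-pi..pi} (\<lambda>z. pv z * of_real (deriv \<phi> z) - G0 z * of_real (deriv \<phi> z))"
      unfolding F_def left_diff_distrib by (intro LINT_Ioo_eq_integral set_integral_diff(1) i1 i2)
    also have "\<dots> = integral {-pi..pi} (\<lambda>z. pv z * of_real (deriv \<phi> z)) - integral {-pi..pi} (\<lambda>z. G0 z * of_real (deriv \<phi> z))"
      by (intro integral_diff set_lebesgue_integral_eq_integral(1) i1 i2)
    also have "integral {-pi..pi} (\<lambda>z. pv z * of_real (deriv \<phi> z))
        = (LINT z:{-pi<..<pi}|lebesgue. pv z * of_real (deriv \<phi> z))"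
      by (rule LINT_Ioo_eq_integral[OF i1, symmetric])
    also have "\<dots> = (LINT z:{-pi<..<pi}|lebesgue. complex_of_real (c_star - U_star z) * v z * of_real (deriv \<phi> z))"
      by (rule set_lebesgue_integral_cong) (auto simp: c_star_minus_U_star pv_def mult.commute)
    also have "\<dots> = - (LINT z:{-pi<..<pi}|lebesgue. g z * complex_of_real (\<phi> z))"
      using dd \<phi> unfolding dist_deriv_def by blast
    also have "(LINT z:{-pi<..<pi}|lebesgue. g z * complex_of_real (\<phi> z)) = integral {-pi..pi} (\<lambda>z. g z * of_real (\<phi> z))"
      by (rule LINT_Ioo_eq_integral[OF i3])
    also have "\<dots> = G0 pi * of_real (\<phi> pi) - G0 (-pi) * of_real (\<phi> (-pi)) - integral {-pi..pi} (\<lambda>x. G0 x * of_real (deriv \<phi> x))"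
      by (rule antiderivative_on_by_parts[OF G0 _ test_fun_has_vector_derivative[OF \<phi>] cd]) auto
    finally show "(LINT z:{-pi<..<pi}|lebesgue. F z * complex_of_real (deriv \<phi> z)) = 0"
      by (simp add: test_funD(3,4)[OF \<phi>])
  qed
  define G where "G x = G0 x + c" for x
  have G: "antiderivative_on G g (-pi) pi" by (rule antiderivative_onI[OF ga]) (simp add: G_def G0_def)
  have vG: "AE x in lebesgue. x \<in> {-pi..pi} \<longrightarrow> of_real (wave_gap x) * v x = G x"
    using c by (rule AE_mp) (auto simp: F_def G_def pv_def algebra_simps)
  have "G pi = 0" "G (-pi) = 0"
    using gap_product_vanishes[OF va antiderivative_on_continuous[OF G] vG] by auto
  then show thesis using that v' g' G vG w unfolding ae_eq_on_def by blast
qed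

lemma AE_Icc_imp_Ioo:
  fixes a b :: real
  shows "AE x in lebesgue. x \<in> {a..b} \<longrightarrow> x \<in> {a<..<b}"
proof -
  have "negligible {a, b}" by simp
  then have "AE x in lebesgue. x \<notin> {a, b}" by (simp only: negligible_iff_null_sets AE_not_in)
  then show ?thesis by (rule AE_mp) (rule AE_I2, auto)
qed

lemma AE_on_obtain:
  fixes S :: "real set"
  assumes "AE x in lebesgue. x \<in> S \<longrightarrow> P x"
  obtains N where "negligible N" "\<And>x. x \<in> S \<Longrightarrow> x \<notin> N \<Longrightarrow> P x"
proof -
  obtain N where "N \<in> null_sets lebesgue" "{x \<in> space lebesgue. \<not> (x \<in> S \<longrightarrow> P x)} \<subseteq> N"
    using assms unfolding eventually_ae_filter by blast
  then show thesis using that[of N] by (auto simp: negligible_iff_null_sets)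
qed

text \<open>The converse of \<open>A_graphE\<close>: in the integration by parts the boundary terms
  vanish together with the test function.\<close>

lemma A_graphI:
  assumes v: "sq_integrable_on v {-pi..pi}" "integral {-pi..pi} v = 0"
    and g: "sq_integrable_on g {-pi..pi}" "integral {-pi..pi} g = 0"
    and G: "antiderivative_on G g (-pi) pi"
    and vG: "AE x in lebesgue. x \<in> {-pi..pi} \<longrightarrow> of_real (wave_gap x) * v x = G x"
    and w: "AE x in lebesgue. x \<in> {-pi..pi} \<longrightarrow> w x = g x + antideriv0 v x"
  shows "A_graph v w"
proof -
  note ga = antiderivative_on_absolutely_integrable[OF G]
  note va = sq_integrable_on_imp_absolutely_integrable[OF v(1)]
  obtain N where N: "negligible N" "\<And>x. x \<in> {-pi..pi} \<Longrightarrow> x \<notin> N \<Longrightarrow> of_real (wave_gap x) * v x = G x"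
    using AE_on_obtain[OF vG] by blast
  have "dist_deriv (\<lambda>z. complex_of_real (c_star - U_star z) * v z) g"
    unfolding dist_deriv_def
  proof (intro allI impI)
    fix \<phi> assume \<phi>: "test_fun \<phi>"
    have c\<phi>: "continuous_on {-pi..pi} \<phi>"
      using test_funD(1)[OF \<phi>] by (meson DERIV_continuous_on has_field_derivative_at_within)
    have cd: "continuous_on {-pi..pi} (\<lambda>x. complex_of_real (deriv \<phi> x))"
      by (intro continuous_intros test_funD(2)[OF \<phi>])
    have "(LINT z:{-pi<..<pi}|lebesgue. complex_of_real (c_star - U_star z) * v z * complex_of_real (deriv \<phi> z))
       = (LINT z:{-pi<..<pi}|lebesgue. v z * (complex_of_real (wave_gap z) * complex_of_real (deriv \<phi> z)))"
      by (rule set_lebesgue_integral_cong) (auto simp: c_star_minus_U_star)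
    also have "\<dots> = integral {-pi..pi} (\<lambda>z. v z * (complex_of_real (wave_gap z) * complex_of_real (deriv \<phi> z)))"
      by (intro LINT_Ioo_eq_integral absolutely_integrable_mult_continuous va continuous_on_mult cd
          continuous_on_of_real continuous_on_wave_gap)
    also have "\<dots> = integral {-pi..pi} (\<lambda>z. G z * complex_of_real (deriv \<phi> z))"
    proof (rule integral_spike[OF N(1)])
      fix z assume "z \<in> {-pi..pi} - N"
      then show "G z * complex_of_real (deriv \<phi> z) = v z * (complex_of_real (wave_gap z) * complex_of_real (deriv \<phi> z))"
        using N(2)[of z, symmetric] by simp
    qed
    also have "\<dots> = - integral {-pi..pi} (\<lambda>z. g z * of_real (\<phi> z))"
      using antiderivative_on_by_parts[OF G _ test_fun_has_vector_derivative[OF \<phi>] cd]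
      by (simp add: test_funD(3,4)[OF \<phi>])
    also have "integral {-pi..pi} (\<lambda>z. g z * of_real (\<phi> z)) = (LINT z:{-pi<..<pi}|lebesgue. g z * complex_of_real (\<phi> z))"
      by (intro LINT_Ioo_eq_integral[symmetric] absolutely_integrable_mult_continuous[OF ga] continuous_intros c\<phi>)
    finally show "(LINT z:{-pi<..<pi}|lebesgue. complex_of_real (c_star - U_star z) * v z * complex_of_real (deriv \<phi> z))
       = - (LINT z:{-pi<..<pi}|lebesgue. g z * complex_of_real (\<phi> z))" .
  qed
  then show ?thesis using v g w unfolding A_graph_def ae_eq_on_def L2per0_iff by blast
qed

subsection \<open>The closed strip\<close>

lemma integral_symmetric_tendsto:
  fixes h :: "real \<Rightarrow> 'a::euclidean_space"
  assumes h: "h integrable_on {-c..c}" and c: "c > 0"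
  shows "((\<lambda>b. integral {-b..b} h) \<longlongrightarrow> integral {-c..c} h) (at_left c)"
proof -
  define H where "H x = integral {-c..x} h" for x
  have cH: "continuous_on {-c..c} H"
    unfolding H_def by (rule indefinite_integral_continuous_1[OF h])
  have "continuous_on {0..c} (\<lambda>b. H b - H (- b))"
    by (intro continuous_intros continuous_on_subset[OF cH] continuous_on_compose2[OF cH]) auto
  from continuous_on_Icc_at_leftD[OF this c]
  have "((\<lambda>b. H b - H (- b)) \<longlongrightarrow> integral {-c..c} h) (at_left c)" by (simp add: H_def)
  moreover have "\<forall>\<^sub>F b in at_left c. H b - H (- b) = integral {-b..b} h"
  proof (rule eventually_at_leftI[OF _ c])
    fix b assume b: "b \<in> {0<..<c}"
    have "integral {-c..-b} h + integral {-b..b} h = integral {-c..b} h"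
      using b by (intro Henstock_Kurzweil_Integration.integral_combine integrable_on_subinterval[OF h]) auto
    then show "H b - H (- b) = integral {-b..b} h" by (simp add: H_def algebra_simps)
  qed
  ultimately show ?thesis by (rule Lim_transform_eventually)
qed

lemma continuous_on_compact_bound:
  fixes f :: "real \<Rightarrow> 'a::real_normed_vector"
  assumes "continuous_on {a..b} f"
  obtains K where "K > 0" "\<And>x. x \<in> {a..b} \<Longrightarrow> norm (f x) \<le> K"
  using compact_imp_bounded[OF compact_continuous_image[OF assms compact_Icc]]
  unfolding bounded_pos by blast

text \<open>Cauchy-Schwarz against the constant 1. This Hoelder bound of order one half is the
  square root decay that outweighs \<open>hom_factor\<close> in the open strip.\<close>

lemma norm_antiderivative_increment_le:
  fixes g G :: "real \<Rightarrow> 'a::{real_normed_field,euclidean_space}"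
  assumes G: "antiderivative_on G g a b" and g: "sq_integrable_on g {a..b}"
    and xy: "a \<le> x" "x \<le> y" "y \<le> b"
  shows "norm (G y - G x) \<le> sqrt (y - x) * sq_norm_on g {a..b}"
proof -
  have gs: "sq_integrable_on g {x..y}" using xy by (intro sq_integrable_on_subset[OF g]) auto
  have one: "sq_integrable_on (\<lambda>x. 1::'a) {x..y}" by (intro sq_integrable_on_continuous continuous_intros)
  have "norm (G y - G x) = norm (integral {x..y} (\<lambda>x. g x * 1))"
    using antiderivative_on_diff[OF G xy] by simp
  also have "\<dots> \<le> sq_norm_on g {x..y} * sq_norm_on (\<lambda>x. 1::'a) {x..y}"
    by (rule norm_integral_product_le[OF _ gs one]) simp
  also have "sq_norm_on (\<lambda>x. 1::'a) {x..y} = sqrt (y - x)" using xy by (simp add: sq_norm_on_def)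
  also have "sq_norm_on g {x..y} \<le> sq_norm_on g {a..b}"
    unfolding sq_norm_on_def using xy
    by (intro real_sqrt_le_mono integral_subset_le sq_integrable_on_square g gs) auto
  finally show ?thesis using xy by (simp add: mult.commute mult_right_mono)
qed

text \<open>At the left endpoint \<open>ell_minus\<close> turns the bound into the one at
  \<open>pi\<close> with \<open>- Re lam\<close>, which satisfies the same strip condition, so a
  single limit serves both ends.\<close>

lemma exp_ell_boundary_null:
  fixes f :: "real \<Rightarrow> complex"
  assumes lam: "\<bar>Re lam\<bar> < pi / 6" and C: "C \<ge> 0"
    and f: "\<And>b. b \<in> {-pi<..<pi} \<Longrightarrow> cmod (f b) \<le> C * (sqrt (pi - \<bar>b\<bar>) * exp (- Re lam * ell b))"
  shows "(f \<longlongrightarrow> 0) (at_left pi)" "((\<lambda>b. f (- b)) \<longlongrightarrow> 0) (at_left pi)"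
proof -
  have ev: "\<forall>\<^sub>F b in at_left pi. b \<in> {0<..<pi}" by (rule eventually_at_leftI[of 0]) auto
  have l1: "((\<lambda>b. C * (sqrt (pi - b) * exp (- Re lam * ell b))) \<longlongrightarrow> C * 0) (at_left pi)"
    by (intro tendsto_mult_left sqrt_times_exp_ell_tendsto_0 lam)
  then show "(f \<longlongrightarrow> 0) (at_left pi)"
  proof (rule Lim_null_comparison[rotated, OF tendsto_eq_rhs])
    show "\<forall>\<^sub>F b in at_left pi. norm (f b) \<le> C * (sqrt (pi - b) * exp (- Re lam * ell b))"
      using ev
    proof eventually_elim
      case (elim b)
      then show ?case using f[of b] by simp
    qed
  qed simp
  have l2: "((\<lambda>b. C * (sqrt (pi - b) * exp (- (- Re lam) * ell b))) \<longlongrightarrow> C * 0) (at_left pi)"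
    by (intro tendsto_mult_left sqrt_times_exp_ell_tendsto_0) (use lam in simp)
  then show "((\<lambda>b. f (- b)) \<longlongrightarrow> 0) (at_left pi)"
  proof (rule Lim_null_comparison[rotated, OF tendsto_eq_rhs])
    show "\<forall>\<^sub>F b in at_left pi. norm (f (- b)) \<le> C * (sqrt (pi - b) * exp (- (- Re lam) * ell b))"
      using ev
    proof eventually_elim
      case (elim b)
      then show ?case using f[of "- b"] by (simp add: ell_minus)
    qed
  qed simp
qed

text \<open>The gap vanishes linearly at both ends; only the square root of that decay is kept, to
  fit the common shape required by \<open>exp_ell_boundary_null\<close>.\<close>

lemma norm_adj_flux_le:
  obtains C where "C \<ge> 0"
    "\<And>b. b \<in> {-pi<..<pi} \<Longrightarrow> cmod (adj_flux lam b) \<le> C * (sqrt (pi - \<bar>b\<bar>) * exp (- Re lam * ell b))"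
proof -
  obtain K where K: "K > 0" "\<And>x. x \<in> {-pi..pi} \<Longrightarrow> cmod (poly_sol' lam x) \<le> K"
    using continuous_on_compact_bound[OF continuous_on_poly_sol'[of "{-pi..pi}" lam]] by blast
  define C where "C = sqrt pi * (2 * pi) / 6 * K"
  have "cmod (adj_flux lam b) \<le> C * (sqrt (pi - \<bar>b\<bar>) * exp (- Re lam * ell b))" if b: "b \<in> {-pi<..<pi}" for b
  proof -
    have "wave_gap b = (pi - \<bar>b\<bar>) * (pi + \<bar>b\<bar>) / 6" by (auto simp: wave_gap_factor abs_if)
    also have "\<dots> = sqrt (pi - \<bar>b\<bar>) * (sqrt (pi - \<bar>b\<bar>) * (pi + \<bar>b\<bar>)) / 6" using b by auto
    also have "\<dots> \<le> sqrt (pi - \<bar>b\<bar>) * (sqrt pi * (2 * pi)) / 6"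
      using b by (intro divide_right_mono mult_left_mono mult_mono) auto
    finally have p: "wave_gap b \<le> sqrt (pi - \<bar>b\<bar>) * (sqrt pi * (2 * pi)) / 6" .
    have "cmod (adj_flux lam b) = wave_gap b * exp (- Re lam * ell b) * cmod (poly_sol' lam b)"
      using wave_gap_pos[OF b] by (simp add: adj_flux_def norm_mult norm_hom_factor)
    also have "\<dots> \<le> (sqrt (pi - \<bar>b\<bar>) * (sqrt pi * (2 * pi)) / 6) * exp (- Re lam * ell b) * K"
      using p K(2)[of b] b wave_gap_pos[OF b] by (intro mult_mono mult_right_mono) auto
    finally show ?thesis by (simp add: C_def algebra_simps)
  qed
  moreover have "C \<ge> 0" using K(1) by (simp add: C_def)
  ultimately show thesis using that by blast
qed

lemma adj_flux_boundary_null: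
  assumes lam: "\<bar>Re lam\<bar> < pi / 6"
  shows "(adj_flux lam \<longlongrightarrow> 0) (at_left pi)" "((\<lambda>b. adj_flux lam (- b)) \<longlongrightarrow> 0) (at_left pi)"
proof -
  obtain C where C: "C \<ge> 0"
    "\<And>b. b \<in> {-pi<..<pi} \<Longrightarrow> cmod (adj_flux lam b) \<le> C * (sqrt (pi - \<bar>b\<bar>) * exp (- Re lam * ell b))"
    using norm_adj_flux_le by blast
  from exp_ell_boundary_null[of lam C "adj_flux lam", OF lam C]
  show "(adj_flux lam \<longlongrightarrow> 0) (at_left pi)" "((\<lambda>b. adj_flux lam (- b)) \<longlongrightarrow> 0) (at_left pi)" by auto
qed

section \<open>Orthogonality of the range to the adjoint solution\<close>

lemma sq_integrable_adj_sol:
  assumes lam: "\<bar>Re lam\<bar> < pi / 6"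
  shows "sq_integrable_on (adj_sol lam) {-pi..pi}"
proof -
  obtain K where K: "K > 0" "\<And>x. x \<in> {-pi..pi} \<Longrightarrow> cmod (poly_sol lam x) \<le> K"
    using continuous_on_compact_bound[OF continuous_on_poly_sol[of "{-pi..pi}" lam]] by blast
  show ?thesis
  proof (rule sq_integrable_on_bound[OF _ _ sq_integrable_hom_factor[OF lam]])
    show "adj_sol lam \<in> borel_measurable (lebesgue_on {-pi..pi})"
      unfolding adj_sol_def[abs_def]
      by (intro borel_measurable_times sq_integrable_on_measurable sq_integrable_hom_factor lam
          sq_integrable_on_continuous continuous_on_poly_sol)
    show "cmod (adj_sol lam x) \<le> K * cmod (hom_factor lam x)" if "x \<in> {-pi..pi}" for x
      using mult_left_mono[OF K(2)[OF that], of "cmod (hom_factor lam x)"] by (simp add: adj_sol_def norm_mult mult.commute)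
  qed simp
qed

lemma integral_adj_sol_sub:
  assumes b: "b \<in> {0<..<pi}"
  shows "integral {-b..b} (adj_sol lam) = adj_flux lam (- b) - adj_flux lam b"
proof -
  have "((\<lambda>x. - adj_sol lam x) has_integral adj_flux lam b - adj_flux lam (- b)) {-b..b}"
    using b by (intro fundamental_theorem_of_calculus has_vector_derivative_at_within[OF adj_flux_has_derivative]) auto
  from has_integral_neg[OF this] show ?thesis by (simp add: integral_unique)
qed

text \<open>\<open>- adj_sol\<close> is the derivative of \<open>adj_flux\<close>, which vanishes at
  both ends in the open strip. Hence the conjugate of \<open>adj_sol\<close> is an admissible
  right-hand side for the operator.\<close>

lemma integral_adj_sol:
  assumes lam: "\<bar>Re lam\<bar> < pi / 6"
  shows "integral {-pi..pi} (adj_sol lam) = 0"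
proof -
  have "adj_sol lam integrable_on {-pi..pi}"
    by (intro set_lebesgue_integral_eq_integral(1) sq_integrable_on_imp_absolutely_integrable sq_integrable_adj_sol lam)
  from integral_symmetric_tendsto[OF this]
  have 1: "((\<lambda>b. integral {-b..b} (adj_sol lam)) \<longlongrightarrow> integral {-pi..pi} (adj_sol lam)) (at_left pi)" by simp
  have "((\<lambda>b. adj_flux lam (- b) - adj_flux lam b) \<longlongrightarrow> 0 - 0) (at_left pi)"
    by (intro tendsto_diff adj_flux_boundary_null lam)
  moreover have "\<forall>\<^sub>F b in at_left pi. adj_flux lam (- b) - adj_flux lam b = integral {-b..b} (adj_sol lam)"
    by (rule eventually_at_leftI[of 0]) (auto simp: integral_adj_sol_sub)
  ultimately have "((\<lambda>b. integral {-b..b} (adj_sol lam)) \<longlongrightarrow> 0 - 0) (at_left pi)"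
    by (rule Lim_transform_eventually)
  from tendsto_unique[OF _ 1 this] show ?thesis by simp
qed

text \<open>Lagrange's identity for \<open>A - lam\<close> and its transpose: integrating
  \<open>g\<close> by parts against \<open>adj_sol\<close> and \<open>v\<close> against
  \<open>adj_flux\<close> leaves only boundary terms. Compact subintervals stay away from the
  singularities of \<open>hom_factor\<close>.\<close>

lemma range_pairing_on_subinterval:
  assumes v: "v absolutely_integrable_on {-pi..pi}"
    and G: "antiderivative_on G g (-pi) pi" and u: "antiderivative_on u v (-pi) pi"
    and vG: "AE x in lebesgue. x \<in> {-pi..pi} \<longrightarrow> of_real (wave_gap x) * v x = G x"
    and ab: "-pi < a" "a \<le> b" "b < pi"
  shows "integral {a..b} (\<lambda>z. (g z + u z - lam * v z) * adj_sol lam z) =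
    (G b * adj_sol lam b - u b * adj_flux lam b) - (G a * adj_sol lam a - u a * adj_flux lam a)"
proof -
  have sub: "{a..b} \<subseteq> {-pi<..<pi}" using ab by auto
  define w' where "w' z = hom_factor lam z * poly_sol' lam z + - lam * hom_factor lam z / of_real (wave_gap z) * poly_sol lam z" for z
  have cw': "continuous_on {a..b} w'"
    unfolding w'_def
  proof (intro continuous_intros continuous_on_hom_factor continuous_on_poly_sol continuous_on_poly_sol' sub continuous_on_wave_gap)
    show "\<forall>z\<in>{a..b}. complex_of_real (wave_gap z) \<noteq> 0"
    proof
      fix z assume "z \<in> {a..b}"
      then have "wave_gap z > 0" using sub by (intro wave_gap_pos) auto
      then show "complex_of_real (wave_gap z) \<noteq> 0" by simp
    qed
  qed
  note cw = continuous_on_adj_sol[OF sub, of lam] and cW = continuous_on_adj_flux[OF sub, of lam]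
  have Gs: "antiderivative_on G g a b" and us: "antiderivative_on u v a b"
    using ab by (auto intro: antiderivative_on_subinterval[OF G] antiderivative_on_subinterval[OF u])
  note ga = antiderivative_on_absolutely_integrable[OF Gs] and va = antiderivative_on_absolutely_integrable[OF us]
  note cu = antiderivative_on_continuous[OF us]
  have e1: "integral {a..b} (\<lambda>z. g z * adj_sol lam z) = G b * adj_sol lam b - G a * adj_sol lam a - integral {a..b} (\<lambda>z. G z * w' z)"
  proof (rule antiderivative_on_by_parts[OF Gs ab(2) _ cw'])
    fix x assume "x \<in> {a..b}"
    then show "(adj_sol lam has_vector_derivative w' x) (at x within {a..b})"
      unfolding w'_def using sub by (intro has_vector_derivative_at_within[OF adj_sol_has_derivative]) auto
  qed
  have e2: "integral {a..b} (\<lambda>z. v z * adj_flux lam z) = u b * adj_flux lam b - u a * adj_flux lam a - integral {a..b} (\<lambda>z. u z * - adj_sol lam z)"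
  proof (rule antiderivative_on_by_parts[OF us ab(2)])
    fix x assume "x \<in> {a..b}"
    then show "(adj_flux lam has_vector_derivative - adj_sol lam x) (at x within {a..b})"
      using sub by (intro has_vector_derivative_at_within[OF adj_flux_has_derivative]) auto
  qed (intro continuous_intros cw)
  obtain N where N: "negligible N" "\<And>x. x \<in> {-pi..pi} \<Longrightarrow> x \<notin> N \<Longrightarrow> of_real (wave_gap x) * v x = G x"
    using AE_on_obtain[OF vG] by blast
  \<comment> \<open>Almost everywhere \<open>G = p v\<close>, and
    \<open>p w' = adj_flux - lam * adj_sol\<close> for the derivative \<open>w'\<close> of
    \<open>adj_sol\<close>.\<close>
  have e3: "integral {a..b} (\<lambda>z. G z * w' z) = integral {a..b} (\<lambda>z. v z * adj_flux lam z - lam * (v z * adj_sol lam z))"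
  proof (rule integral_spike[of N])
    show "negligible N" by (rule N(1))
    fix z assume z: "z \<in> {a..b} - N"
    then have zz: "z \<in> {-pi<..<pi}" using sub by auto
    then have Gz: "G z = of_real (wave_gap z) * v z" using N(2)[of z] z zz by simp
    have nz: "complex_of_real (wave_gap z) \<noteq> 0" using wave_gap_pos[OF zz] by simp
    show "v z * adj_flux lam z - lam * (v z * adj_sol lam z) = G z * w' z"
      unfolding Gz w'_def adj_flux_def adj_sol_def using nz by (simp add: field_simps)
  qed
  have i: "(\<lambda>z. g z * adj_sol lam z) integrable_on {a..b}" "(\<lambda>z. v z * adj_sol lam z) integrable_on {a..b}"
     "(\<lambda>z. v z * adj_flux lam z) integrable_on {a..b}"
    by (intro set_lebesgue_integral_eq_integral(1) absolutely_integrable_mult_continuous ga va cw cW)+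
  have iu: "(\<lambda>z. u z * adj_sol lam z) integrable_on {a..b}"
    by (intro integrable_continuous_real continuous_intros cu cw)
  have "integral {a..b} (\<lambda>z. (g z + u z - lam * v z) * adj_sol lam z)
     = integral {a..b} (\<lambda>z. g z * adj_sol lam z + u z * adj_sol lam z - lam * (v z * adj_sol lam z))"
    by (simp add: algebra_simps)
  also have "\<dots> = integral {a..b} (\<lambda>z. g z * adj_sol lam z) + integral {a..b} (\<lambda>z. u z * adj_sol lam z)
      - lam * integral {a..b} (\<lambda>z. v z * adj_sol lam z)"
    by (simp add: integral_diff integral_add integrable_add i iu integrable_on_mult_right)
  also have "integral {a..b} (\<lambda>z. g z * adj_sol lam z) = G b * adj_sol lam b - G a * adj_sol lam a
      - (integral {a..b} (\<lambda>z. v z * adj_flux lam z) - lam * integral {a..b} (\<lambda>z. v z * adj_sol lam z))"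
    unfolding e1 e3 by (simp add: integral_diff i integrable_on_mult_right)
  finally show ?thesis using e2 by (simp add: algebra_simps)
qed

text \<open>The boundary terms of Lagrange's identity tend to 0: \<open>G\<close> vanishes at both
  ends, hence is bounded by a square root of the distance to the nearer one, and \<open>u\<close> is
  bounded while \<open>adj_flux\<close> obeys a bound of the same shape.\<close>

lemma range_orthogonal_adj_sol:
  assumes lam: "\<bar>Re lam\<bar> < pi / 6" and A: "A_graph v w"
  shows "integral {-pi..pi} (\<lambda>z. (w z - lam * v z) * adj_sol lam z) = 0"
proof -
  obtain G g where v: "sq_integrable_on v {-pi..pi}" and g: "sq_integrable_on g {-pi..pi}"
    and G: "antiderivative_on G g (-pi) pi" "G pi = 0" "G (-pi) = 0"
    and vG: "AE x in lebesgue. x \<in> {-pi..pi} \<longrightarrow> of_real (wave_gap x) * v x = G x"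
    and w: "AE x in lebesgue. x \<in> {-pi..pi} \<longrightarrow> w x = g x + antideriv0 v x"
    using A_graphE[OF A] by blast
  note va = sq_integrable_on_imp_absolutely_integrable[OF v]
  define u where "u = antideriv0 v"
  have u: "antiderivative_on u v (-pi) pi" unfolding u_def by (rule antideriv0_antiderivative(1)[OF va])
  note cu = antiderivative_on_continuous[OF u]
  define F where "F z = g z + u z - lam * v z" for z
  have F: "sq_integrable_on F {-pi..pi}"
    unfolding F_def
    by (intro sq_integrable_on_diff sq_integrable_on_add sq_integrable_on_cmult sq_integrable_on_continuous cu g v) auto
  have Fw: "(\<lambda>z. F z * adj_sol lam z) integrable_on {-pi..pi}"
    by (intro set_lebesgue_integral_eq_integral(1) sq_integrable_on_product F sq_integrable_adj_sol lam) auto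
  obtain K where K: "K > 0" "\<And>x. x \<in> {-pi..pi} \<Longrightarrow> cmod (poly_sol lam x) \<le> K"
    using continuous_on_compact_bound[OF continuous_on_poly_sol[of "{-pi..pi}" lam]] by blast
  obtain Ku where Ku: "Ku > 0" "\<And>x. x \<in> {-pi..pi} \<Longrightarrow> cmod (u x) \<le> Ku"
    using continuous_on_compact_bound[OF cu] by blast
  obtain C where C: "C \<ge> 0"
    "\<And>b. b \<in> {-pi<..<pi} \<Longrightarrow> cmod (adj_flux lam b) \<le> C * (sqrt (pi - \<bar>b\<bar>) * exp (- Re lam * ell b))"
    using norm_adj_flux_le by blast
  define T where "T b = G b * adj_sol lam b - u b * adj_flux lam b" for b
  have Gb: "cmod (G b) \<le> sqrt (pi - \<bar>b\<bar>) * sq_norm_on g {-pi..pi}" if b: "b \<in> {-pi<..<pi}" for b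
  proof (cases "b \<ge> 0")
    case True
    then show ?thesis using norm_antiderivative_increment_le[OF G(1) g, of b pi] b G(2) by simp
  next
    case False
    then show ?thesis using norm_antiderivative_increment_le[OF G(1) g, of "-pi" b] b G(3) by (simp add: add.commute)
  qed
  have Tb: "cmod (T b) \<le> (sq_norm_on g {-pi..pi} * K + Ku * C) * (sqrt (pi - \<bar>b\<bar>) * exp (- Re lam * ell b))"
    if b: "b \<in> {-pi<..<pi}" for b
  proof -
    have "cmod (T b) \<le> cmod (G b) * (exp (- Re lam * ell b) * cmod (poly_sol lam b)) + cmod (u b) * cmod (adj_flux lam b)"
      unfolding T_def adj_sol_def norm_hom_factor[symmetric] by (metis norm_mult norm_triangle_ineq4)
    also have "\<dots> \<le> (sqrt (pi - \<bar>b\<bar>) * sq_norm_on g {-pi..pi}) * (exp (- Re lam * ell b) * K)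
        + Ku * (C * (sqrt (pi - \<bar>b\<bar>) * exp (- Re lam * ell b)))"
    proof (intro add_mono mult_mono Gb[OF b] C(2)[OF b])
      show "cmod (poly_sol lam b) \<le> K" "cmod (u b) \<le> Ku" using K(2)[of b] Ku(2)[of b] b by auto
    qed (use b K Ku sq_norm_on_nonneg[of g "{-pi..pi}"] in auto)
    finally show ?thesis by (simp add: algebra_simps)
  qed
  have C': "sq_norm_on g {-pi..pi} * K + Ku * C \<ge> 0"
    using K(1) Ku(1) C(1) sq_norm_on_nonneg[of g "{-pi..pi}"] by simp
  note T0 = exp_ell_boundary_null[of lam _ T, OF lam C' Tb]
  have "((\<lambda>b. T b - T (- b)) \<longlongrightarrow> 0 - 0) (at_left pi)"
    by (intro tendsto_diff T0)
  moreover have "\<forall>\<^sub>F b in at_left pi. T b - T (- b) = integral {-b..b} (\<lambda>z. F z * adj_sol lam z)"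
  proof (rule eventually_at_leftI[of 0])
    fix b :: real assume b: "b \<in> {0<..<pi}"
    then have "-pi < -b" "-b \<le> b" "b < pi" by auto
    from range_pairing_on_subinterval[OF va G(1) u vG this, of lam]
    show "T b - T (- b) = integral {-b..b} (\<lambda>z. F z * adj_sol lam z)"
      by (simp only: F_def T_def)
  qed simp
  ultimately have "((\<lambda>b. integral {-b..b} (\<lambda>z. F z * adj_sol lam z)) \<longlongrightarrow> 0 - 0) (at_left pi)"
    by (rule Lim_transform_eventually)
  from tendsto_unique[OF _ integral_symmetric_tendsto[OF Fw] this]
  have "integral {-pi..pi} (\<lambda>z. F z * adj_sol lam z) = 0" by simp
  moreover obtain N where N: "negligible N" "\<And>x. x \<in> {-pi..pi} \<Longrightarrow> x \<notin> N \<Longrightarrow> w x = g x + antideriv0 v x"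
    using AE_on_obtain[OF w] by blast
  have "integral {-pi..pi} (\<lambda>z. (w z - lam * v z) * adj_sol lam z) = integral {-pi..pi} (\<lambda>z. F z * adj_sol lam z)"
  proof (rule integral_spike[of N])
    show "negligible N" by (rule N(1))
    show "F z * adj_sol lam z = (w z - lam * v z) * adj_sol lam z" if "z \<in> {-pi..pi} - N" for z
      using N(2)[of z] that by (simp add: F_def u_def)
  qed
  ultimately show ?thesis by simp
qed

text \<open>Since \<open>hom_factor\<close> has no zeros, a vanishing norm would make the polynomial
  factor vanish on \<open>{-1..1}\<close>, but its second difference at \<open>- 1, 0, 1\<close> is
  2.\<close>

lemma adj_sol_norm_pos:
  assumes lam: "\<bar>Re lam\<bar> < pi / 6"
  shows "sq_norm_on (adj_sol lam) {-pi..pi} > 0"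
proof (rule ccontr)
  assume "\<not> ?thesis"
  then have "sq_norm_on (adj_sol lam) {-pi..pi} = 0" using sq_norm_on_nonneg[of "adj_sol lam" "{-pi..pi}"] by linarith
  then have int0: "integral {-pi..pi} (\<lambda>x. (cmod (adj_sol lam x))\<^sup>2) = 0"
    using sq_norm_on_power2[of "adj_sol lam" "{-pi..pi}"] by simp
  have pi1: "1 < pi" using pi_gt3 by simp
  have sub: "{-1..1} \<subseteq> {-pi<..<pi}" using pi1 by auto
  have cont: "continuous_on {-1..1} (\<lambda>x. (cmod (adj_sol lam x))\<^sup>2)"
    by (intro continuous_intros continuous_on_adj_sol sub)
  have "integral {-1..1} (\<lambda>x. (cmod (adj_sol lam x))\<^sup>2) \<le> integral {-pi..pi} (\<lambda>x. (cmod (adj_sol lam x))\<^sup>2)"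
    using pi1 by (intro integral_subset_le integrable_continuous_real cont sq_integrable_on_square sq_integrable_adj_sol lam) auto
  moreover have "integral {-1..1} (\<lambda>x. (cmod (adj_sol lam x))\<^sup>2) \<ge> 0"
    by (intro integral_nonneg integrable_continuous_real cont) auto
  ultimately have "integral {-1..1} (\<lambda>x. (cmod (adj_sol lam x))\<^sup>2) = 0" using int0 by linarith
  then have "((\<lambda>x. (cmod (adj_sol lam x))\<^sup>2) has_integral 0) (cbox (-1) 1)"
    using integrable_integral[OF integrable_continuous_real[OF cont]] by simp
  then have "(cmod (adj_sol lam x))\<^sup>2 = 0" if "x \<in> {-1..1}" for x
    using has_integral_0_cbox_imp_0[of "-1" 1 "\<lambda>x. (cmod (adj_sol lam x))\<^sup>2" x] cont that by auto
  then have P0: "poly_sol lam x = 0" if "x \<in> {-1..1}" for x using that by (auto simp: adj_sol_def)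
  have "poly_sol lam 1 + poly_sol lam (-1) - 2 * poly_sol lam 0 = 2" by (simp add: poly_sol_def)
  then show False using P0[of 1] P0[of "-1"] P0[of 0] by simp
qed

lemma strip_in_spectrum:
  assumes strip: "\<bar>Re lam0\<bar> \<le> pi / 6"
  shows "lam0 \<notin> resolvent_A"
proof
  assume "lam0 \<in> resolvent_A"
  then obtain C0 where surj: "\<And>f. L2per0 f \<Longrightarrow> \<exists>v w. A_graph v w \<and> ae_eq_on (\<lambda>z. w z - lam0 * v z) f"
    and bnd0: "\<And>v w. A_graph v w \<Longrightarrow> L2norm v \<le> C0 * L2norm (\<lambda>z. w z - lam0 * v z)"
    unfolding resolvent_A_def by blast
  \<comment> \<open>The resolvent condition does not prescribe the sign of
    \<open>C0\<close>.\<close>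
  define C where "C = \<bar>C0\<bar> + 1"
  have "C > 0" by (simp add: C_def)
  \<comment> \<open>\<open>lam\<close> is \<open>lam0\<close> with its real part shrunk by the
    factor \<open>1 - e\<close>, so it lies in the open strip at distance
    \<open>e * \<bar>Re lam0\<bar>\<close> from \<open>lam0\<close>. As \<open>K\<close> bounds
    \<open>C * \<bar>Re lam0\<bar>\<close>, the choice \<open>e = 1 / (K + 1)\<close> makes this
    distance times \<open>C\<close> less than 1; the summand 1 in \<open>K\<close> keeps
    \<open>K\<close> positive on the imaginary axis too.\<close>
  define K where "K = C * (\<bar>Re lam0\<bar> + 1)"
  have "K > 0" using \<open>C > 0\<close> by (simp add: K_def)
  define e where "e = 1 / (K + 1)"
  have e: "0 < e" "e \<le> 1" "e * K < 1"
    using \<open>K > 0\<close> by (auto simp: e_def field_simps)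
  define lam where "lam = lam0 - of_real (e * Re lam0)"
  have Re_lam: "Re lam = (1 - e) * Re lam0" by (simp add: lam_def algebra_simps)
  have lam: "\<bar>Re lam\<bar> < pi / 6"
  proof (cases "Re lam0 = 0")
    case False
    have "\<bar>Re lam\<bar> = (1 - e) * \<bar>Re lam0\<bar>" using e by (simp add: Re_lam abs_mult)
    also have "\<dots> < 1 * \<bar>Re lam0\<bar>" using e False by (intro mult_strict_right_mono) auto
    finally show ?thesis using strip by simp
  qed (simp add: Re_lam)
  have diff: "cmod (lam - lam0) * C < 1"
  proof -
    have "cmod (lam - lam0) * C = e * (\<bar>Re lam0\<bar> * C)" using e by (simp add: lam_def norm_mult abs_mult)
    also have "\<dots> \<le> e * K" using e \<open>C > 0\<close> by (intro mult_left_mono) (auto simp: K_def algebra_simps)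
    finally show ?thesis using e(3) by simp
  qed
  let ?I = "{-pi..pi}"
  note ws = sq_integrable_adj_sol[OF lam]
  define f where "f z = cnj (adj_sol lam z)" for z
  have fm: "f \<in> borel_measurable (lebesgue_on ?I)"
    unfolding f_def[abs_def] using sq_integrable_on_measurable[OF ws]
    by (rule borel_measurable_continuous_on[OF continuous_on_cnj[OF continuous_on_id]])
  have fs: "sq_integrable_on f ?I"
    by (rule sq_integrable_on_bound[OF _ fm ws, where C = 1]) (auto simp: f_def)
  have fnorm: "sq_norm_on f ?I = sq_norm_on (adj_sol lam) ?I" by (simp add: sq_norm_on_def f_def)
  have "integral ?I f = cnj (integral ?I (adj_sol lam))"
    unfolding f_def using integral_cnj by metis
  then have "L2per0 f" using fs integral_adj_sol[OF lam] by (simp add: L2per0_iff)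
  then obtain v w where A: "A_graph v w" and vw: "ae_eq_on (\<lambda>z. w z - lam0 * v z) f"
    using surj by blast
  have v: "sq_integrable_on v ?I" using A unfolding A_graph_def L2per0_iff by blast
  have vw': "AE z in lebesgue. z \<in> ?I \<longrightarrow> w z - lam0 * v z = f z" using vw by (simp add: ae_eq_on_def)
  have ms: "sq_integrable_on (\<lambda>z. w z - lam0 * v z) ?I"
    by (rule sq_integrable_on_AE_cong[OF _ fs vw']) simp
  have "L2norm v \<le> C0 * sq_norm_on f ?I"
    using bnd0[OF A] L2norm_eq[OF ms] sq_norm_on_AE_cong[OF vw'] by simp
  also have "\<dots> \<le> C * sq_norm_on f ?I"
    by (intro mult_right_mono sq_norm_on_nonneg) (simp add: C_def)
  finally have vn: "sq_norm_on v ?I \<le> C * sq_norm_on (adj_sol lam) ?I" using L2norm_eq[OF v] fnorm by simp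
  obtain N where N: "negligible N" "\<And>z. z \<in> ?I \<Longrightarrow> z \<notin> N \<Longrightarrow> w z - lam0 * v z = f z"
    using AE_on_obtain[OF vw'] by blast
  have iv: "(\<lambda>z. v z * adj_sol lam z) integrable_on ?I"
    by (intro set_lebesgue_integral_eq_integral(1) sq_integrable_on_product v ws) auto
  have "0 = integral ?I (\<lambda>z. (w z - lam * v z) * adj_sol lam z)"
    using range_orthogonal_adj_sol[OF lam A] by simp
  \<comment> \<open>Almost everywhere \<open>w - lam * v = f - (lam - lam0) * v\<close>, and
    \<open>f\<close> times \<open>adj_sol\<close> is the squared modulus.\<close>
  also have "\<dots> = integral ?I (\<lambda>z. of_real ((cmod (adj_sol lam z))\<^sup>2) - (lam - lam0) * (v z * adj_sol lam z))"
  proof (rule integral_spike[of N])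
    show "negligible N" by (rule N(1))
    fix z assume "z \<in> ?I - N"
    then have "w z = f z + lam0 * v z" using N(2)[of z] by (simp add: diff_eq_eq)
    then show "of_real ((cmod (adj_sol lam z))\<^sup>2) - (lam - lam0) * (v z * adj_sol lam z) = (w z - lam * v z) * adj_sol lam z"
      unfolding complex_norm_square f_def by (simp add: algebra_simps)
  qed
  also have "\<dots> = integral ?I (\<lambda>z. complex_of_real ((cmod (adj_sol lam z))\<^sup>2)) - (lam - lam0) * integral ?I (\<lambda>z. v z * adj_sol lam z)"
    by (subst integral_diff)
      (simp_all only: integral_mult_right integrable_on_mult_right[OF iv]
        integrable_linear[OF sq_integrable_on_square[OF ws] bounded_linear_of_real, unfolded o_def])
  also have "integral ?I (\<lambda>z. complex_of_real ((cmod (adj_sol lam z))\<^sup>2)) = of_real ((sq_norm_on (adj_sol lam) ?I)\<^sup>2)"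
    using integral_linear[OF sq_integrable_on_square[OF ws] bounded_linear_of_real[where 'a=complex]]
    by (simp add: o_def sq_norm_on_power2)
  finally have "complex_of_real ((sq_norm_on (adj_sol lam) ?I)\<^sup>2) = (lam - lam0) * integral ?I (\<lambda>z. v z * adj_sol lam z)" by simp
  then have "(sq_norm_on (adj_sol lam) ?I)\<^sup>2 = cmod ((lam - lam0) * integral ?I (\<lambda>z. v z * adj_sol lam z))"
    by (metis norm_of_real abs_power2)
  also have "\<dots> \<le> cmod (lam - lam0) * (sq_norm_on v ?I * sq_norm_on (adj_sol lam) ?I)"
    unfolding norm_mult by (intro mult_left_mono norm_integral_product_le v ws) auto
  also have "\<dots> \<le> cmod (lam - lam0) * ((C * sq_norm_on (adj_sol lam) ?I) * sq_norm_on (adj_sol lam) ?I)"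
    by (intro mult_left_mono mult_right_mono vn sq_norm_on_nonneg) auto
  also have "\<dots> = (cmod (lam - lam0) * C) * (sq_norm_on (adj_sol lam) ?I)\<^sup>2"
    by (simp add: power2_eq_square)
  also have "\<dots> < 1 * (sq_norm_on (adj_sol lam) ?I)\<^sup>2"
    using diff adj_sol_norm_pos[OF lam] by (intro mult_strict_right_mono) auto
  finally show False by simp
qed

subsection \<open>A Hardy inequality\<close>

text \<open>Monotone convergence along compact symmetric intervals exhausting the open one; on each
  of them continuity gives integrability.\<close>

lemma integrable_on_if_bounded_symmetric_integrals:
  fixes f :: "real \<Rightarrow> real"
  assumes c: "c > 0" and cont: "continuous_on {-c<..<c} f" and nn: "\<And>x. x \<in> {-c<..<c} \<Longrightarrow> f x \<ge> 0"
    and bnd: "\<And>b. b \<in> {0<..<c} \<Longrightarrow> integral {-b..b} f \<le> K"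
  shows "f absolutely_integrable_on {-c..c}" and "integral {-c..c} f \<le> K"
proof -
  \<comment> \<open>The denominator \<open>k + 2\<close> keeps already \<open>b 0\<close> strictly
    positive.\<close>
  define b where "b k = c - c / (real k + 2)" for k
  have b: "b k \<in> {0<..<c}" "b k \<le> b (Suc k)" for k
    using c by (auto simp: b_def field_simps intro!: add_pos_nonneg mult_nonneg_nonneg)
  have blim: "b \<longlonglongrightarrow> c" unfolding b_def by real_asymp
  define fk where "fk k x = (if x \<in> {-b k..b k} then f x else 0)" for k x
  have sub: "{-b k..b k} \<subseteq> {-c<..<c}" for k using b(1)[of k] by auto
  have i: "f integrable_on {-b k..b k}" for k
    by (intro integrable_continuous_real continuous_on_subset[OF cont sub])
  have inter: "{-b k..b k} \<inter> {-c<..<c} = {-b k..b k}" for k using sub[of k] by blast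
  have fki: "fk k integrable_on {-c<..<c}" and fkint: "integral {-c<..<c} (fk k) = integral {-b k..b k} f" for k
    unfolding fk_def using i[of k] inter[of k] integrable_restrict_Int[of "{-b k..b k}" f "{-c<..<c}"]
      integral_restrict_Int[of "{-c<..<c}" "{-b k..b k}" f] by simp_all
  have "f integrable_on {-c<..<c} \<and> (\<lambda>k. integral {-c<..<c} (fk k)) \<longlonglongrightarrow> integral {-c<..<c} f"
  proof (rule monotone_convergence_increasing)
    show "fk k integrable_on {-c<..<c}" for k by (rule fki)
    show "fk k x \<le> fk (Suc k) x" if "x \<in> {-c<..<c}" for k x
      using nn[OF that] b(2)[of k] by (auto simp: fk_def)
    show "(\<lambda>k. fk k x) \<longlonglongrightarrow> f x" if x: "x \<in> {-c<..<c}" for x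
    proof (rule tendsto_eventually)
      have "\<forall>\<^sub>F k in sequentially. \<bar>x\<bar> < b k"
        using x by (intro order_tendstoD(1)[OF blim]) auto
      then show "\<forall>\<^sub>F k in sequentially. fk k x = f x"
        by eventually_elim (auto simp: fk_def)
    qed
    show "bounded (range (\<lambda>k. integral {-c<..<c} (fk k)))"
    proof (rule boundedI)
      fix y assume "y \<in> range (\<lambda>k. integral {-c<..<c} (fk k))"
      then obtain k where y: "y = integral {-b k..b k} f" using fkint by auto
      have "y \<ge> 0" unfolding y using sub[of k] by (intro integral_nonneg i nn) auto
      then show "norm y \<le> K" using bnd[OF b(1)[of k]] y by simp
    qed
  qed
  then have fi: "f integrable_on {-c<..<c}" and lim: "(\<lambda>k. integral {-b k..b k} f) \<longlonglongrightarrow> integral {-c<..<c} f"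
    by (auto simp: fkint)
  have "f absolutely_integrable_on {-c<..<c}"
    by (rule nonnegative_absolutely_integrable_1[OF fi nn])
  then show "f absolutely_integrable_on {-c..c}" by (simp add: absolutely_integrable_on_Icc_iff_Ioo)
  have "integral {-c<..<c} f \<le> K"
    by (rule LIMSEQ_le_const2[OF lim]) (use bnd b in blast)
  then show "integral {-c..c} f \<le> K" by (simp add: integral_open_interval_real)
qed

section \<open>The modulus of the integrating factor as a real weight\<close>

definition ell_weight :: "real \<Rightarrow> real \<Rightarrow> real" where
  "ell_weight r z = exp (- r * ell z)"

lemma ell_weight_pos [simp]: "ell_weight r z > 0" "ell_weight r z \<noteq> 0" "ell_weight r z \<ge> 0"
  by (auto simp: ell_weight_def)

lemma norm_hom_factor_weight: "cmod (hom_factor lam z) = ell_weight (Re lam) z"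
  by (simp add: norm_hom_factor ell_weight_def)

lemma ell_weight_has_derivative:
  assumes "z \<in> {-pi<..<pi}"
  shows "(ell_weight r has_real_derivative - r / wave_gap z * ell_weight r z) (at z)"
  unfolding ell_weight_def[abs_def]
  by (auto intro!: derivative_eq_intros ell_has_derivative assms)

lemma continuous_on_ell_weight: "S \<subseteq> {-pi<..<pi} \<Longrightarrow> continuous_on S (ell_weight r)"
  unfolding ell_weight_def by (intro continuous_intros continuous_on_ell)

lemma ell_weight_antimono:
  assumes "r \<ge> 0" "-pi < x" "x \<le> y" "y < pi"
  shows "ell_weight r y \<le> ell_weight r x"
  unfolding ell_weight_def using mult_left_mono[OF ell_mono[OF assms(2-4)] assms(1)] by simp

lemma measurable_ell [measurable]: "ell \<in> borel_measurable (lebesgue_on S)"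
  unfolding ell_def[abs_def]
  by (intro measurable_completion measurable_restrict_space1) measurable

lemma measurable_ell_weight [measurable]: "ell_weight r \<in> borel_measurable (lebesgue_on S)"
  unfolding ell_weight_def[abs_def] by measurable

lemma measurable_hom_factor [measurable]: "hom_factor lam \<in> borel_measurable (lebesgue_on S)"
  unfolding hom_factor_def[abs_def] by measurable

lemma measurable_wave_gap [measurable]: "wave_gap \<in> borel_measurable (lebesgue_on S)"
  unfolding wave_gap_def[abs_def]
  by (intro measurable_completion measurable_restrict_space1) measurable

lemma sq_integrable_ell_weight:
  assumes "r \<ge> 0" "-pi < z"
  shows "sq_integrable_on (ell_weight r) {z..pi}"
\<comment> \<open>\<open>ell pi\<close> is a default value stemming from \<open>ln 0\<close>, so
  monotonicity does not reach the endpoint; the summand \<open>ell_weight r pi\<close> covers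
  it.\<close>
proof (rule sq_integrable_on_bound[where C = "ell_weight r z + ell_weight r pi"])
  show "sq_integrable_on (\<lambda>x. 1::real) {z..pi}" by (intro sq_integrable_on_continuous continuous_intros)
  show "norm (ell_weight r x) \<le> (ell_weight r z + ell_weight r pi) * norm (1::real)" if "x \<in> {z..pi}" for x
    using that ell_weight_antimono[OF assms, of x] by (cases "x = pi") (auto simp: add_increasing2)
qed auto

lemma sq_integrable_hom_factor_right:
  assumes "Re lam \<ge> 0" "-pi < z"
  shows "sq_integrable_on (hom_factor lam) {z..pi}"
  by (rule sq_integrable_on_bound[OF _ _ sq_integrable_ell_weight[OF assms], where C = 1])
    (auto simp: norm_hom_factor_weight)

text \<open>The positive operator that dominates \<open>volterra\<close> for
  \<open>r = Re lam\<close>; replacing the complex kernel by its modulus makes the Schur test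
  available.\<close>

definition hardy :: "real \<Rightarrow> (real \<Rightarrow> real) \<Rightarrow> real \<Rightarrow> real" where
  "hardy r F z = integral {z..pi} (\<lambda>t. ell_weight r t * F t) / (wave_gap z * ell_weight r z)"

text \<open>Schur weight \<open>(r + t / 6) / sqrt p\<close>: chosen so that its weighted integral is explicit.\<close>

lemma schur_weight_has_integral:
  assumes r: "r > pi / 6" and z: "z \<in> {-pi<..<pi}"
  shows "((\<lambda>t. ell_weight r t * ((r + t / 6) / sqrt (wave_gap t))) has_integral ell_weight r z * sqrt (wave_gap z)) {z..pi}"
proof -
  have r0: "r > 0" using r pi_gt_zero by (smt (verit) divide_pos_pos)
  define B where "B t = ell_weight r t * sqrt (wave_gap t)" for t
  have "((\<lambda>t. - (ell_weight r t * ((r + t / 6) / sqrt (wave_gap t)))) has_integral B pi - B z) {z..pi}"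
  proof (rule fundamental_theorem_of_calculus_interior)
    show "z \<le> pi" using z by simp
    show "continuous_on {z..pi} B"
      unfolding continuous_on_def
    proof
      fix x assume x: "x \<in> {z..pi}"
      show "(B \<longlongrightarrow> B x) (at x within {z..pi})"
      proof (cases "x = pi")
        case False
        then have "x \<in> {-pi<..<pi}" using x z by auto
        then have "isCont B x"
          unfolding B_def[abs_def]
          by (intro continuous_intros DERIV_isCont[OF ell_weight_has_derivative]
              continuous_on_interior[OF continuous_on_wave_gap[of UNIV]]) auto
        then show ?thesis by (simp add: continuous_at_imp_continuous_at_within continuous_within[symmetric])
      next
        case True
        \<comment> \<open>Monotonicity bounds \<open>ell_weight r t\<close> by its value at
          \<open>z\<close>, so the factor \<open>sqrt (wave_gap t)\<close> forces the limit 0; this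
          agrees with \<open>B pi\<close>, whatever the default value of
          \<open>ell_weight r pi\<close>.\<close>
        have lim: "((\<lambda>t. ell_weight r z * sqrt (wave_gap t)) \<longlongrightarrow> ell_weight r z * sqrt (wave_gap pi)) (at pi within {z..pi})"
          using continuous_on_wave_gap[of "{z..pi}"] z unfolding continuous_on_def
          by (intro tendsto_intros) auto
        have "(B \<longlongrightarrow> 0) (at pi within {z..pi})"
        proof (rule Lim_null_comparison)
          show "((\<lambda>t. ell_weight r z * sqrt (wave_gap t)) \<longlongrightarrow> 0) (at pi within {z..pi})"
            using lim by (simp add: wave_gap_def)
          show "\<forall>\<^sub>F t in at pi within {z..pi}. norm (B t) \<le> ell_weight r z * sqrt (wave_gap t)"
            unfolding eventually_at_filter
          proof (intro always_eventually allI impI)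
            fix t assume t: "t \<noteq> pi" "t \<in> {z..pi}"
            then have "ell_weight r t \<le> ell_weight r z" "wave_gap t \<ge> 0"
              using z r0 by (auto intro!: ell_weight_antimono wave_gap_nonneg)
            then show "norm (B t) \<le> ell_weight r z * sqrt (wave_gap t)"
              by (simp add: B_def mult_right_mono)
          qed
        qed
        then show ?thesis using True by (simp add: B_def wave_gap_def)
      qed
    qed
    fix t assume "t \<in> {z<..<pi}"
    then have t: "t \<in> {-pi<..<pi}" using z by auto
    have p: "wave_gap t > 0" by (rule wave_gap_pos[OF t])
    have "(wave_gap has_real_derivative - t / 3) (at t)"
      unfolding wave_gap_def[abs_def] by (auto intro!: derivative_eq_intros)
    then have "((\<lambda>t. sqrt (wave_gap t)) has_real_derivative (- t / 3) * (inverse (sqrt (wave_gap t)) / 2)) (at t)"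
      using p by (auto intro!: derivative_eq_intros)
    then have "(B has_real_derivative ell_weight r t * ((- t / 3) * (inverse (sqrt (wave_gap t)) / 2))
      + (- r / wave_gap t * ell_weight r t) * sqrt (wave_gap t)) (at t)"
      unfolding B_def[abs_def] by (intro DERIV_mult' ell_weight_has_derivative[OF t])
    moreover have "ell_weight r t * ((- t / 3) * (inverse (sqrt (wave_gap t)) / 2))
      + (- r / wave_gap t * ell_weight r t) * sqrt (wave_gap t) = - (ell_weight r t * ((r + t / 6) / sqrt (wave_gap t)))"
    proof -
      define q where "q = sqrt (wave_gap t)"
      have "q > 0" "wave_gap t = q * q" using p by (auto simp: q_def)
      then show ?thesis unfolding q_def[symmetric] by (simp add: field_simps)
    qed
    ultimately show "(B has_vector_derivative - (ell_weight r t * ((r + t / 6) / sqrt (wave_gap t)))) (at t)"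
      by (simp add: has_real_derivative_iff_has_vector_derivative)
  qed
  from has_integral_neg[OF this] show ?thesis by (simp add: B_def wave_gap_def)
qed

text \<open>By \<open>schur_weight_has_integral\<close> both sides are integrals up to
  \<open>pi\<close> of one function, nonnegative because \<open>r > pi / 6\<close>, over nested
  intervals.\<close>

lemma weight_sqrt_gap_antimono:
  assumes r: "r > pi / 6" and zt: "-pi < z" "z \<le> t" "t < pi"
  shows "ell_weight r t * sqrt (wave_gap t) \<le> ell_weight r z * sqrt (wave_gap z)"
proof -
  have z: "z \<in> {-pi<..<pi}" and t: "t \<in> {-pi<..<pi}" using zt by auto
  note i = schur_weight_has_integral[OF r z] schur_weight_has_integral[OF r t]
  have "integral {t..pi} (\<lambda>t. ell_weight r t * ((r + t / 6) / sqrt (wave_gap t)))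
      \<le> integral {z..pi} (\<lambda>t. ell_weight r t * ((r + t / 6) / sqrt (wave_gap t)))"
  proof (rule integral_subset_le)
    show "\<forall>x\<in>{z..pi}. 0 \<le> ell_weight r x * ((r + x / 6) / sqrt (wave_gap x))"
    proof
      fix x assume "x \<in> {z..pi}"
      then have "r + x / 6 \<ge> 0" "wave_gap x \<ge> 0" using r zt by (auto intro!: wave_gap_nonneg)
      then show "0 \<le> ell_weight r x * ((r + x / 6) / sqrt (wave_gap x))" by simp
    qed
  qed (use zt i in auto)
  then show ?thesis using i by (simp add: integral_unique)
qed

text \<open>First half of the Schur test: with \<open>R\<close> for \<open>ell_weight r\<close> and
  \<open>h\<close> the Schur weight, \<open>R * F\<close> is split as \<open>sqrt (R * h)\<close>
  times \<open>sqrt (R / h) * F\<close> before Cauchy-Schwarz. The first factor has an explicit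
  square integral, and \<open>j\<close> is the square of the second. The open interval is used
  because \<open>h\<close> divides by zero at \<open>pi\<close>.\<close>

lemma hardy_pointwise:
  assumes r: "r > pi / 6" and z: "z \<in> {-pi<..<pi}" and F: "sq_integrable_on F {-pi..pi}"
  defines "j \<equiv> (\<lambda>t. ell_weight r t * sqrt (wave_gap t) / (r + t / 6) * (F t)\<^sup>2)"
  shows "j absolutely_integrable_on {z..pi}"
    and "(integral {z..pi} (\<lambda>t. ell_weight r t * F t))\<^sup>2 \<le> ell_weight r z * sqrt (wave_gap z) * integral {z..pi} j"
proof -
  have d: "r + t / 6 > 0" if "t \<in> {z..pi}" for t using that z r by auto
  let ?S = "{z<..<pi}"
  have S: "?S \<in> sets lebesgue" by simp
  have Sp: "t \<in> {-pi<..<pi}" if "t \<in> ?S" for t using that z by auto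
  have FS: "sq_integrable_on F ?S" using z by (intro sq_integrable_on_subset[OF F]) auto
  define h where "h t = (r + t / 6) / sqrt (wave_gap t)" for t
  have hpos: "h t > 0" if "t \<in> ?S" for t
    using d[of t] wave_gap_pos[OF Sp[OF that]] that by (simp add: h_def)
  have hm: "h \<in> borel_measurable (lebesgue_on ?S)"
  proof -
    have "(\<lambda>t::real. t) \<in> borel_measurable (lebesgue_on ?S)"
      by (intro measurable_completion measurable_restrict_space1) measurable
    then show ?thesis unfolding h_def[abs_def] by measurable
  qed
  define A where "A t = sqrt (ell_weight r t * h t)" for t
  define B where "B t = sqrt (ell_weight r t / h t) * F t" for t
  have A2: "(A t)\<^sup>2 = ell_weight r t * h t" if "t \<in> ?S" for t using hpos[OF that] by (simp add: A_def)
  have B2: "(B t)\<^sup>2 = j t" if "t \<in> ?S" for t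
  proof -
    have "(B t)\<^sup>2 = (ell_weight r t / h t) * (F t)\<^sup>2"
      using hpos[OF that] by (simp add: B_def power_mult_distrib)
    then show ?thesis by (simp add: j_def h_def)
  qed
  have AB: "A t * B t = ell_weight r t * F t" if "t \<in> ?S" for t
  proof -
    have "A t * B t = sqrt ((ell_weight r t * h t) * (ell_weight r t / h t)) * F t"
      by (simp only: A_def B_def real_sqrt_mult mult.assoc)
    also have "(ell_weight r t * h t) * (ell_weight r t / h t) = (ell_weight r t)\<^sup>2"
      using hpos[OF that] by (simp add: power2_eq_square)
    finally show ?thesis by simp
  qed
  have iA: "(\<lambda>t. ell_weight r t * h t) integrable_on ?S" "integral ?S (\<lambda>t. ell_weight r t * h t) = ell_weight r z * sqrt (wave_gap z)"
  proof -
    have I: "((\<lambda>t. ell_weight r t * h t) has_integral ell_weight r z * sqrt (wave_gap z)) {z..pi}"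
      using schur_weight_has_integral[OF r z] unfolding h_def .
    then show "(\<lambda>t. ell_weight r t * h t) integrable_on ?S"
      unfolding integrable_on_Icc_iff_Ioo[symmetric] by blast
    show "integral ?S (\<lambda>t. ell_weight r t * h t) = ell_weight r z * sqrt (wave_gap z)"
      unfolding integral_open_interval_real[symmetric] using I by (rule integral_unique)
  qed
  have A: "sq_integrable_on A ?S"
    unfolding sq_integrable_on_def
  proof
    show "A \<in> borel_measurable (lebesgue_on ?S)" unfolding A_def[abs_def] using hm by measurable
    have "(\<lambda>t. ell_weight r t * h t) absolutely_integrable_on ?S"
      using hpos by (intro nonnegative_absolutely_integrable_1 iA(1)) (simp add: less_imp_le)
    then show "(\<lambda>x. (norm (A x))\<^sup>2) absolutely_integrable_on ?S"
      by (subst set_integrable_cong[OF refl refl, of _ _ "\<lambda>t. ell_weight r t * h t"]) (auto simp: A2)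
  qed
  define K where "K = sqrt (ell_weight r z * sqrt (wave_gap z) / (r - pi / 6))"
  have B: "sq_integrable_on B ?S"
  proof (rule sq_integrable_on_bound[OF S _ FS])
    show "B \<in> borel_measurable (lebesgue_on ?S)"
      unfolding B_def[abs_def] using hm sq_integrable_on_measurable[OF FS] by measurable
    show "norm (B t) \<le> K * norm (F t)" if t: "t \<in> ?S" for t
    proof -
      have "ell_weight r t / h t = ell_weight r t * sqrt (wave_gap t) / (r + t / 6)" by (simp add: h_def)
      also have "\<dots> \<le> ell_weight r z * sqrt (wave_gap z) / (r - pi / 6)"
        using t z r wave_gap_pos[OF z] by (intro frac_le weight_sqrt_gap_antimono[OF r]) auto
      finally have "sqrt (ell_weight r t / h t) \<le> K" unfolding K_def by (rule real_sqrt_le_mono)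
      moreover have "ell_weight r t / h t \<ge> 0" using hpos[OF t] by (simp add: less_imp_le)
      ultimately show ?thesis by (simp add: B_def abs_mult mult_right_mono)
    qed
  qed
  have "(\<lambda>x. (norm (B x))\<^sup>2) absolutely_integrable_on ?S" using B by (simp add: sq_integrable_on_def)
  then have "j absolutely_integrable_on ?S"
    by (subst set_integrable_cong[OF refl refl, of _ _ "\<lambda>x. (norm (B x))\<^sup>2"]) (auto simp: B2)
  then show "j absolutely_integrable_on {z..pi}" by (simp add: absolutely_integrable_on_Icc_iff_Ioo)
  have "(integral ?S (\<lambda>t. A t * B t))\<^sup>2 \<le> integral ?S (\<lambda>x. (A x)\<^sup>2) * integral ?S (\<lambda>x. (B x)\<^sup>2)"
    by (rule Cauchy_Schwarz_integral[OF S A B])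
  also have "integral ?S (\<lambda>t. A t * B t) = integral ?S (\<lambda>t. ell_weight r t * F t)"
    by (rule integral_cong) (rule AB)
  also have "integral ?S (\<lambda>x. (A x)\<^sup>2) = integral ?S (\<lambda>t. ell_weight r t * h t)"
    by (rule integral_cong) (rule A2)
  also have "integral ?S (\<lambda>x. (B x)\<^sup>2) = integral ?S j"
    by (rule integral_cong) (rule B2)
  finally show "(integral {z..pi} (\<lambda>t. ell_weight r t * F t))\<^sup>2 \<le> ell_weight r z * sqrt (wave_gap z) * integral {z..pi} j"
    by (simp add: iA(2) integral_open_interval_real)
qed

lemma continuous_on_integral_right:
  fixes f :: "real \<Rightarrow> 'a::euclidean_space"
  assumes "\<And>a. a \<in> {c<..<d} \<Longrightarrow> f integrable_on {a..d}"
  shows "continuous_on {c<..<d} (\<lambda>z. integral {z..d} f)"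
proof (rule continuous_at_imp_continuous_on, rule ballI)
  fix x assume x: "x \<in> {c<..<d}"
  define a where "a = (c + x) / 2"
  have a: "a \<in> {c<..<d}" "a < x" using x by (auto simp: a_def)
  have "continuous_on {a..d} (\<lambda>z. integral {z..d} f)"
    by (rule indefinite_integral_continuous_1'[OF assms[OF a(1)]])
  then have "continuous_on {a<..<d} (\<lambda>z. integral {z..d} f)" by (rule continuous_on_subset) auto
  then show "isCont (\<lambda>z. integral {z..d} f) x"
    using x a(2) by (simp add: continuous_on_eq_continuous_at)
qed

lemma antiderivative_on_integral_right:
  fixes f :: "real \<Rightarrow> 'a::{real_normed_field,euclidean_space}"
  assumes f: "f absolutely_integrable_on {a..d}" and bd: "b \<le> d"
  shows "antiderivative_on (\<lambda>z. integral {z..d} f) (\<lambda>z. - f z) a b"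
proof (rule antiderivative_onI)
  have fi: "f integrable_on {a..d}" using f by (rule set_lebesgue_integral_eq_integral(1))
  have "f absolutely_integrable_on {a..b}" using bd by (intro set_integrable_subset[OF f]) auto
  from set_integrable_mult_right[OF this, of "-1"] show "(\<lambda>z. - f z) absolutely_integrable_on {a..b}" by simp
  fix x assume "x \<in> {a..b}"
  then have "integral {a..x} f + integral {x..d} f = integral {a..d} f"
    using bd by (intro Henstock_Kurzweil_Integration.integral_combine fi) auto
  then show "integral {x..d} f = integral {a..d} f + integral {a..x} (\<lambda>z. - f z)"
    by (simp add: algebra_simps)
qed

lemma weight_product_integrable:
  assumes r: "r \<ge> 0" and F: "sq_integrable_on F {-pi..pi}" and z: "-pi < z"
  shows "(\<lambda>t. ell_weight r t * F t) absolutely_integrable_on {z..pi}"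
  by (intro sq_integrable_on_product sq_integrable_ell_weight r z sq_integrable_on_subset[OF F]) (use z in auto)

lemma continuous_on_hardy:
  assumes r: "r \<ge> 0" and F: "sq_integrable_on F {-pi..pi}"
  shows "continuous_on {-pi<..<pi} (hardy r F)"
  unfolding hardy_def
proof (intro continuous_on_divide continuous_on_mult continuous_on_ell_weight continuous_on_wave_gap continuous_on_integral_right)
  show "(\<lambda>t. ell_weight r t * F t) integrable_on {a..pi}" if "a \<in> {-pi<..<pi}" for a
    using that by (intro set_lebesgue_integral_eq_integral(1) weight_product_integrable r F) auto
  show "\<forall>z\<in>{-pi<..<pi}. wave_gap z * ell_weight r z \<noteq> 0"
  proof
    fix z assume "z \<in> {-pi<..<pi}"
    then have "wave_gap z > 0" by (rule wave_gap_pos)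
    then show "wave_gap z * ell_weight r z \<noteq> 0" by simp
  qed
qed auto

lemma hardy_square_le:
  assumes r: "r > pi / 6" and z: "z \<in> {-pi<..<pi}" and F: "sq_integrable_on F {-pi..pi}"
  shows "(hardy r F z)\<^sup>2 \<le> integral {z..pi} (\<lambda>t. ell_weight r t * sqrt (wave_gap t) / (r + t / 6) * (F t)\<^sup>2)
    / (ell_weight r z * wave_gap z * sqrt (wave_gap z))"
proof -
  define R q I J where "R = ell_weight r z" and "q = sqrt (wave_gap z)"
    and "I = integral {z..pi} (\<lambda>t. ell_weight r t * F t)"
    and "J = integral {z..pi} (\<lambda>t. ell_weight r t * sqrt (wave_gap t) / (r + t / 6) * (F t)\<^sup>2)"
  have p: "wave_gap z = q * q" "q > 0" "R > 0" using wave_gap_pos[OF z] by (auto simp: q_def R_def)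
  have IJ: "I\<^sup>2 \<le> R * q * J"
    using hardy_pointwise(2)[OF r z F] by (simp add: I_def J_def R_def q_def)
  have "(hardy r F z)\<^sup>2 = I\<^sup>2 / (q * q * R)\<^sup>2"
    by (simp add: hardy_def I_def R_def p(1) power_divide)
  also have "\<dots> \<le> R * q * J / (q * q * R)\<^sup>2" by (rule divide_right_mono[OF IJ]) simp
  also have "\<dots> = J / (R * (q * q) * q)" using p by (simp add: power2_eq_square)
  finally show ?thesis using wave_gap_pos[OF z] unfolding J_def R_def q_def by simp
qed

text \<open>Second half of the Schur test. In place of an exchange of integrals, the tail integral
  \<open>J\<close> of \<open>j\<close> is integrated by parts against \<open>B\<close>, whose
  derivative is the weight of \<open>hardy_square_le\<close> times \<open>r + z / 6\<close>. One
  factor \<open>1 / d\<close> comes from inserting \<open>r + z / 6 \<ge> d\<close> there, the other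
  from \<open>j * B = F^2 / (r + z / 6)\<close>.\<close>

lemma hardy_integral_bound:
  assumes r: "r > pi / 6" and F: "sq_integrable_on F {-pi..pi}" and b: "b \<in> {0<..<pi}"
  shows "integral {-b..b} (\<lambda>z. (hardy r F z)\<^sup>2) \<le> (sq_norm_on F {-pi..pi} / (r - pi / 6))\<^sup>2"
proof -
  define d where "d = r - pi / 6"
  have d: "d > 0" using r by (simp add: d_def)
  have r0: "r \<ge> 0" using r pi_gt_zero by (smt (verit) divide_pos_pos)
  have sub: "{-b..b} \<subseteq> {-pi<..<pi}" and bb: "-b \<le> b" and bI: "- b \<in> {-pi<..<pi}" "b \<in> {-pi<..<pi}" using b by auto
  have \<theta>: "r + t / 6 \<ge> d" if "t \<in> {-pi..pi}" for t using that by (auto simp: d_def)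
  define j where "j t = ell_weight r t * sqrt (wave_gap t) / (r + t / 6) * (F t)\<^sup>2" for t
  have j: "j absolutely_integrable_on {z..pi}" if "z \<in> {-pi<..<pi}" for z
    using hardy_pointwise(1)[OF r that F] unfolding j_def .
  have ji: "j integrable_on {z..pi}" if "z \<in> {-pi<..<pi}" for z
    using j[OF that] by (rule set_lebesgue_integral_eq_integral(1))
  have jnn: "j t \<ge> 0" if "t \<in> {-pi..pi}" for t
    using \<theta>[OF that] d wave_gap_nonneg[OF that] by (simp add: j_def)
  define J where "J z = integral {z..pi} j" for z
  have J: "antiderivative_on J (\<lambda>z. - j z) (-b) b"
    unfolding J_def using b by (intro antiderivative_on_integral_right j bI) auto
  have Jnn: "J z \<ge> 0" if "z \<in> {-pi<..<pi}" for z
    unfolding J_def using that by (intro integral_nonneg ji jnn) auto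
  define B where "B z = 1 / (ell_weight r z * sqrt (wave_gap z))" for z
  define B' where "B' z = (r + z / 6) / (ell_weight r z * wave_gap z * sqrt (wave_gap z))" for z
  have BD: "(B has_vector_derivative B' z) (at z within {-b..b})" if "z \<in> {-b..b}" for z
  proof -
    have z: "z \<in> {-pi<..<pi}" using that sub by auto
    have p: "wave_gap z > 0" by (rule wave_gap_pos[OF z])
    have "(wave_gap has_real_derivative - z / 3) (at z)"
      unfolding wave_gap_def[abs_def] by (auto intro!: derivative_eq_intros)
    then have "((\<lambda>z. sqrt (wave_gap z)) has_real_derivative (- z / 3) * (inverse (sqrt (wave_gap z)) / 2)) (at z)"
      using p by (auto intro!: derivative_eq_intros)
    from DERIV_mult'[OF ell_weight_has_derivative[OF z, of r] this]
    have "((\<lambda>z. ell_weight r z * sqrt (wave_gap z)) has_real_derivative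
       ell_weight r z * ((- z / 3) * (inverse (sqrt (wave_gap z)) / 2)) + (- r / wave_gap z * ell_weight r z) * sqrt (wave_gap z)) (at z)" .
    from DERIV_inverse'[OF this]
    have "(B has_real_derivative - (inverse (ell_weight r z * sqrt (wave_gap z)) *
        (ell_weight r z * ((- z / 3) * (inverse (sqrt (wave_gap z)) / 2)) + (- r / wave_gap z * ell_weight r z) * sqrt (wave_gap z)) *
        inverse (ell_weight r z * sqrt (wave_gap z)))) (at z)"
      using p by (simp add: B_def[abs_def] inverse_eq_divide)
    also have "- (inverse (ell_weight r z * sqrt (wave_gap z)) *
        (ell_weight r z * ((- z / 3) * (inverse (sqrt (wave_gap z)) / 2)) + (- r / wave_gap z * ell_weight r z) * sqrt (wave_gap z)) *
        inverse (ell_weight r z * sqrt (wave_gap z))) = B' z"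
    proof -
      define q R where "q = sqrt (wave_gap z)" and "R = ell_weight r z"
      have "q > 0" "wave_gap z = q * q" "R > 0" using p by (auto simp: q_def R_def)
      then show ?thesis unfolding B'_def q_def[symmetric] R_def[symmetric] by (simp add: field_simps)
    qed
    finally show ?thesis
      by (rule has_vector_derivative_at_within[OF has_real_derivative_iff_has_vector_derivative[THEN iffD1]])
  qed
  have nz: "\<forall>z\<in>{-b..b}. ell_weight r z * wave_gap z * sqrt (wave_gap z) \<noteq> 0"
  proof
    fix z assume "z \<in> {-b..b}"
    then have "wave_gap z > 0" using sub by (intro wave_gap_pos) auto
    then show "ell_weight r z * wave_gap z * sqrt (wave_gap z) \<noteq> 0" by simp
  qed
  have cB': "continuous_on {-b..b} B'"
    unfolding B'_def
    by (intro continuous_intros continuous_on_ell_weight continuous_on_wave_gap sub nz) auto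
  have cJ: "continuous_on {-b..b} J" by (rule antiderivative_on_continuous[OF J])
  have F2: "(\<lambda>t. (F t)\<^sup>2) integrable_on {-pi..pi}" using sq_integrable_on_square[OF F] by simp
  have F2s: "(\<lambda>t. (F t)\<^sup>2) integrable_on {x..y}" if "-pi \<le> x" "y \<le> pi" for x y
    using that by (intro integrable_on_subinterval[OF F2]) auto
  have jBi: "(\<lambda>z. - j z * B z) absolutely_integrable_on {-b..b}"
    using ac_by_parts(1)[OF bb antiderivative_on_absolutely_integrable[OF J] antiderivative_onD[OF J] BD cB'] .
  from antiderivative_on_by_parts[OF J bb BD cB']
  have parts: "integral {-b..b} (\<lambda>z. J z * B' z) = J b * B b - J (-b) * B (-b) - integral {-b..b} (\<lambda>z. - j z * B z)"
    by simp
  have t1: "- integral {-b..b} (\<lambda>z. - j z * B z) \<le> integral {-b..b} (\<lambda>t. (F t)\<^sup>2 / d)"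
  proof -
    have "- integral {-b..b} (\<lambda>z. - j z * B z) = integral {-b..b} (\<lambda>z. - (- j z * B z))" by simp
    also have "\<dots> \<le> integral {-b..b} (\<lambda>t. (F t)\<^sup>2 / d)"
    proof (rule integral_le)
      show "(\<lambda>z. - (- j z * B z)) integrable_on {-b..b}"
        by (intro integrable_neg set_lebesgue_integral_eq_integral(1) jBi)
      show "(\<lambda>t. (F t)\<^sup>2 / d) integrable_on {-b..b}"
        using b by (intro integrable_on_divide F2s) auto
      fix z assume "z \<in> {-b..b}"
      then have z: "z \<in> {-pi<..<pi}" "z \<in> {-pi..pi}" using sub by auto
      have "- (- j z * B z) = (F z)\<^sup>2 / (r + z / 6)"
        using wave_gap_pos[OF z(1)] by (simp add: j_def B_def)
      also have "\<dots> \<le> (F z)\<^sup>2 / d" using \<theta>[OF z(2)] d by (intro divide_left_mono) auto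
      finally show "- (- j z * B z) \<le> (F z)\<^sup>2 / d" .
    qed
    finally show ?thesis .
  qed
  \<comment> \<open>This boundary term is not small but can be absorbed:
    \<open>ell_weight r t * sqrt (wave_gap t)\<close> decreases in \<open>t\<close>, so
    \<open>j t * B b\<close> is at most \<open>F^2 / d\<close> on \<open>{b..pi}\<close>, precisely
    the piece missing from \<open>t1\<close>. The term at \<open>- b\<close> has the favourable
    sign.\<close>
  have t2: "J b * B b \<le> integral {b..pi} (\<lambda>t. (F t)\<^sup>2 / d)"
  proof -
    have Bb: "B b > 0" using wave_gap_pos[OF bI(2)] by (simp add: B_def)
    have "J b * B b = integral {b..pi} (\<lambda>t. j t * B b)" unfolding J_def by simp
    also have "\<dots> \<le> integral {b..pi} (\<lambda>t. (F t)\<^sup>2 / d)"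
    proof (rule integral_le)
      show "(\<lambda>t. j t * B b) integrable_on {b..pi}" by (intro integrable_on_mult_left ji bI)
      show "(\<lambda>t. (F t)\<^sup>2 / d) integrable_on {b..pi}"
        using b by (intro integrable_on_divide F2s) auto
      fix t assume t: "t \<in> {b..pi}"
      show "j t * B b \<le> (F t)\<^sup>2 / d"
      proof (cases "t = pi")
        case True
        then show ?thesis using d by (simp add: j_def wave_gap_def)
      next
        case False
        have "t \<in> {-pi..pi}" using t b by auto
        have "ell_weight r t * sqrt (wave_gap t) \<le> ell_weight r b * sqrt (wave_gap b)"
          using t b False by (intro weight_sqrt_gap_antimono r) auto
        then have le1: "ell_weight r t * sqrt (wave_gap t) * B b \<le> 1"
          using wave_gap_pos[OF bI(2)] by (simp add: B_def divide_le_eq_1)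
        have "j t * B b = (ell_weight r t * sqrt (wave_gap t) * B b) * ((F t)\<^sup>2 / (r + t / 6))"
          by (simp add: j_def)
        also have "\<dots> \<le> 1 * ((F t)\<^sup>2 / (r + t / 6))"
          using \<theta>[OF \<open>t \<in> {-pi..pi}\<close>] d by (intro mult_right_mono le1) auto
        also have "\<dots> \<le> (F t)\<^sup>2 / d" using \<theta>[OF \<open>t \<in> {-pi..pi}\<close>] d by (simp add: divide_left_mono)
        finally show ?thesis .
      qed
    qed
    finally show ?thesis .
  qed
  have t3: "J (-b) * B (-b) \<ge> 0"
    using Jnn[OF bI(1)] wave_gap_pos[OF bI(1)] by (simp add: B_def)
  have "integral {-b..b} (\<lambda>t. (F t)\<^sup>2 / d) + integral {b..pi} (\<lambda>t. (F t)\<^sup>2 / d) = integral {-b..pi} (\<lambda>t. (F t)\<^sup>2 / d)"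
    using b by (intro Henstock_Kurzweil_Integration.integral_combine integrable_on_divide F2s) auto
  also have "\<dots> \<le> integral {-pi..pi} (\<lambda>t. (F t)\<^sup>2 / d)"
    using b d by (intro integral_subset_le integrable_on_divide F2s) auto
  also have "\<dots> = (sq_norm_on F {-pi..pi})\<^sup>2 / d" by (simp add: sq_norm_on_power2)
  finally have JB: "integral {-b..b} (\<lambda>z. J z * B' z) \<le> (sq_norm_on F {-pi..pi})\<^sup>2 / d"
    using parts t1 t2 t3 by linarith
  have "integral {-b..b} (\<lambda>z. (hardy r F z)\<^sup>2) \<le> integral {-b..b} (\<lambda>z. J z * B' z / d)"
  proof (rule integral_le)
    show "(\<lambda>z. (hardy r F z)\<^sup>2) integrable_on {-b..b}"
      by (intro integrable_continuous_real continuous_intros continuous_on_subset[OF continuous_on_hardy[OF r0 F] sub])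
    show "(\<lambda>z. J z * B' z / d) integrable_on {-b..b}"
      using d by (intro integrable_continuous_real continuous_intros cJ cB') auto
    fix z assume "z \<in> {-b..b}"
    then have z: "z \<in> {-pi<..<pi}" "z \<in> {-pi..pi}" using sub by auto
    define Q where "Q = ell_weight r z * wave_gap z * sqrt (wave_gap z)"
    have Q: "Q > 0" using wave_gap_pos[OF z(1)] by (simp add: Q_def)
    have "(hardy r F z)\<^sup>2 \<le> J z / Q"
      using hardy_square_le[OF r z(1) F] unfolding J_def j_def[abs_def] Q_def .
    also have "\<dots> \<le> J z * ((r + z / 6) / d) / Q"
    proof (intro divide_right_mono)
      have "1 \<le> (r + z / 6) / d" using \<theta>[OF z(2)] d by simp
      from mult_left_mono[OF this Jnn[OF z(1)]] show "J z \<le> J z * ((r + z / 6) / d)" by simp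
    qed (use Q in simp)
    also have "\<dots> = J z * B' z / d" by (simp add: B'_def Q_def)
    finally show "(hardy r F z)\<^sup>2 \<le> J z * B' z / d" .
  qed
  also have "\<dots> = integral {-b..b} (\<lambda>z. J z * B' z) / d" by simp
  also have "\<dots> \<le> ((sq_norm_on F {-pi..pi})\<^sup>2 / d) / d" using JB d by (intro divide_right_mono) auto
  finally show ?thesis by (simp add: d_def power_divide power2_eq_square)
qed

lemma sq_integrable_on_Icc_if_Ioo:
  fixes f :: "real \<Rightarrow> 'a::{real_normed_field,euclidean_space}"
  assumes f: "sq_integrable_on f {a<..<b}"
  shows "sq_integrable_on f {a..b}"
  unfolding sq_integrable_on_def
proof
  have "sq_integrable_on (\<lambda>x. 1::'a) {a<..<b}"
    by (rule sq_integrable_on_subset[OF sq_integrable_on_continuous[of a b]]) (auto intro: continuous_intros)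
  from sq_integrable_on_product[OF _ f this]
  have "f absolutely_integrable_on {a..b}" by (simp add: absolutely_integrable_on_Icc_iff_Ioo)
  then show "f \<in> borel_measurable (lebesgue_on {a..b})" by (rule absolutely_integrable_measurable[THEN iffD1, THEN conjunct1, rotated]) simp
  show "(\<lambda>x. (norm (f x))\<^sup>2) absolutely_integrable_on {a..b}"
    using f by (simp add: sq_integrable_on_def absolutely_integrable_on_Icc_iff_Ioo)
qed

lemma hardy_inequality:
  assumes r: "r > pi / 6" and F: "sq_integrable_on F {-pi..pi}"
  shows "sq_integrable_on (hardy r F) {-pi..pi}"
    and "sq_norm_on (hardy r F) {-pi..pi} \<le> sq_norm_on F {-pi..pi} / (r - pi / 6)"
proof -
  have r0: "r \<ge> 0" using r pi_gt_zero by (smt (verit) divide_pos_pos)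
  note cont = continuous_on_hardy[OF r0 F]
  have a: "(\<lambda>z. (hardy r F z)\<^sup>2) absolutely_integrable_on {-pi..pi}"
    and le: "integral {-pi..pi} (\<lambda>z. (hardy r F z)\<^sup>2) \<le> (sq_norm_on F {-pi..pi} / (r - pi / 6))\<^sup>2"
    using integrable_on_if_bounded_symmetric_integrals[OF pi_gt_zero continuous_on_power[OF cont]
        zero_le_power2 hardy_integral_bound[OF r F]] by blast+
  have "hardy r F \<in> borel_measurable (lebesgue_on {-pi<..<pi})"
    by (intro continuous_imp_measurable_on_sets_lebesgue cont) auto
  then have "sq_integrable_on (hardy r F) {-pi<..<pi}"
    using a by (simp add: sq_integrable_on_def absolutely_integrable_on_Icc_iff_Ioo)
  then show "sq_integrable_on (hardy r F) {-pi..pi}" by (rule sq_integrable_on_Icc_if_Ioo)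
  show "sq_norm_on (hardy r F) {-pi..pi} \<le> sq_norm_on F {-pi..pi} / (r - pi / 6)"
    using real_sqrt_le_mono[OF le] r sq_norm_on_nonneg[of F "{-pi..pi}"] by (simp add: sq_norm_on_def)
qed

subsection \<open>The resolvent outside the strip\<close>

text \<open>With the integrating factor \<open>E\<close>, the equation
  \<open>(p v)' - lam v = \<Phi>\<close> reads \<open>(E p v)' = E \<Phi>\<close>; this is its
  solution for which \<open>E p v\<close> vanishes at \<open>pi\<close>.\<close>

definition volterra :: "complex \<Rightarrow> (real \<Rightarrow> complex) \<Rightarrow> real \<Rightarrow> complex" where
  "volterra lam \<Phi> z = - integral {z..pi} (\<lambda>t. hom_factor lam t * \<Phi> t) / (of_real (wave_gap z) * hom_factor lam z)"

lemma pos_if_gt_pi_sixth: "r > pi / 6 \<Longrightarrow> r > (0::real)"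
  using pi_gt_zero by (smt (verit) divide_pos_pos)

lemma hom_factor_product_integrable:
  assumes "Re lam > pi / 6" "sq_integrable_on \<Phi> {-pi..pi}" "-pi < z"
  shows "(\<lambda>t. hom_factor lam t * \<Phi> t) absolutely_integrable_on {z..pi}"
  using assms pos_if_gt_pi_sixth[OF assms(1)]
  by (intro sq_integrable_on_product sq_integrable_hom_factor_right sq_integrable_on_subset[OF assms(2)]) auto

text \<open>At the endpoints both \<^const>\<open>volterra\<close> and \<^const>\<open>hardy\<close> are 0, because the gap vanishes there and
  \<open>x / 0 = 0\<close>.\<close>

lemma norm_volterra_le:
  assumes lam: "Re lam > pi / 6" and \<Phi>: "sq_integrable_on \<Phi> {-pi..pi}" and z: "z \<in> {-pi..pi}"
  shows "cmod (volterra lam \<Phi> z) \<le> hardy (Re lam) (\<lambda>t. cmod (\<Phi> t)) z"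
proof (cases "z = pi \<or> z = -pi")
  case True
  then have "wave_gap z = 0" by (auto simp: wave_gap_def)
  then show ?thesis by (simp add: volterra_def hardy_def)
next
  case False
  then have z: "z \<in> {-pi<..<pi}" using z by auto
  have r0: "Re lam \<ge> 0" using pos_if_gt_pi_sixth[OF lam] by simp
  have "cmod (integral {z..pi} (\<lambda>t. hom_factor lam t * \<Phi> t)) \<le> integral {z..pi} (\<lambda>t. ell_weight (Re lam) t * cmod (\<Phi> t))"
    using z by (intro integral_norm_bound_integral set_lebesgue_integral_eq_integral(1)
        hom_factor_product_integrable lam \<Phi> weight_product_integrable r0 sq_integrable_on_norm)
      (auto simp: norm_mult norm_hom_factor_weight)
  then show ?thesis
    using wave_gap_pos[OF z]
    by (simp add: volterra_def hardy_def norm_divide norm_mult norm_hom_factor_weight divide_right_mono)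
qed

lemma continuous_on_volterra:
  assumes lam: "Re lam > pi / 6" and \<Phi>: "sq_integrable_on \<Phi> {-pi..pi}"
  shows "continuous_on {-pi<..<pi} (volterra lam \<Phi>)"
  unfolding volterra_def
proof (intro continuous_on_divide continuous_on_mult continuous_on_minus continuous_on_of_real continuous_on_hom_factor
    continuous_on_wave_gap continuous_on_integral_right)
  show "(\<lambda>t. hom_factor lam t * \<Phi> t) integrable_on {a..pi}" if "a \<in> {-pi<..<pi}" for a
    using that by (intro set_lebesgue_integral_eq_integral(1) hom_factor_product_integrable lam \<Phi>) auto
  show "\<forall>z\<in>{-pi<..<pi}. complex_of_real (wave_gap z) * hom_factor lam z \<noteq> 0"
  proof
    fix z assume "z \<in> {-pi<..<pi}"
    then have "wave_gap z > 0" by (rule wave_gap_pos)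
    then show "complex_of_real (wave_gap z) * hom_factor lam z \<noteq> 0" by simp
  qed
qed auto

lemma sq_integrable_volterra:
  assumes lam: "Re lam > pi / 6" and \<Phi>: "sq_integrable_on \<Phi> {-pi..pi}"
  shows "sq_integrable_on (volterra lam \<Phi>) {-pi..pi}"
proof (rule sq_integrable_on_Icc_if_Ioo)
  have "sq_integrable_on (hardy (Re lam) (\<lambda>t. cmod (\<Phi> t))) {-pi<..<pi}"
    by (rule sq_integrable_on_subset[OF hardy_inequality(1)[OF lam sq_integrable_on_norm[OF \<Phi>]]]) auto
  then show "sq_integrable_on (volterra lam \<Phi>) {-pi<..<pi}"
  proof (rule sq_integrable_on_bound[rotated 2, where C = 1])
    show "volterra lam \<Phi> \<in> borel_measurable (lebesgue_on {-pi<..<pi})"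
      by (intro continuous_imp_measurable_on_sets_lebesgue continuous_on_volterra lam \<Phi>) auto
    show "cmod (volterra lam \<Phi> x) \<le> 1 * norm (hardy (Re lam) (\<lambda>t. cmod (\<Phi> t)) x)" if "x \<in> {-pi<..<pi}" for x
      using norm_volterra_le[OF lam \<Phi>, of x] that by simp
  qed simp
qed

lemma sq_norm_volterra_le:
  assumes lam: "Re lam > pi / 6" and \<Phi>: "sq_integrable_on \<Phi> {-pi..pi}"
  shows "sq_norm_on (volterra lam \<Phi>) {-pi..pi} \<le> sq_norm_on \<Phi> {-pi..pi} / (Re lam - pi / 6)"
proof -
  note \<Phi>n = sq_integrable_on_norm[OF \<Phi>]
  have "sq_norm_on (volterra lam \<Phi>) {-pi..pi} \<le> sq_norm_on (hardy (Re lam) (\<lambda>t. cmod (\<Phi> t))) {-pi..pi}"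
  proof (rule sq_norm_on_mono[OF sq_integrable_volterra[OF lam \<Phi>] hardy_inequality(1)[OF lam \<Phi>n]])
    show "cmod (volterra lam \<Phi> x) \<le> norm (hardy (Re lam) (\<lambda>t. cmod (\<Phi> t)) x)" if "x \<in> {-pi..pi}" for x
      using norm_volterra_le[OF lam \<Phi> that] by simp
  qed
  also have "\<dots> \<le> sq_norm_on (\<lambda>t. cmod (\<Phi> t)) {-pi..pi} / (Re lam - pi / 6)"
    by (rule hardy_inequality(2)[OF lam \<Phi>n])
  finally show ?thesis by (simp add: sq_norm_on_def)
qed

lemma volterra_diff:
  assumes lam: "Re lam > pi / 6" and \<Phi>: "sq_integrable_on \<Phi> {-pi..pi}" and \<Psi>: "sq_integrable_on \<Psi> {-pi..pi}"
    and z: "z \<in> {-pi..pi}"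
  shows "volterra lam (\<lambda>t. \<Phi> t - \<Psi> t) z = volterra lam \<Phi> z - volterra lam \<Psi> z"
proof (cases "z = -pi")
  case True
  then have "wave_gap z = 0" by (auto simp: wave_gap_def)
  then show ?thesis by (simp add: volterra_def)
next
  case False
  then have "-pi < z" using z by auto
  then have "integral {z..pi} (\<lambda>t. hom_factor lam t * (\<Phi> t - \<Psi> t))
     = integral {z..pi} (\<lambda>t. hom_factor lam t * \<Phi> t) - integral {z..pi} (\<lambda>t. hom_factor lam t * \<Psi> t)"
    unfolding right_diff_distrib
    by (intro integral_diff set_lebesgue_integral_eq_integral(1) hom_factor_product_integrable lam \<Phi> \<Psi>)
  then show ?thesis by (simp add: volterra_def diff_divide_distrib)
qed

text \<open>The flux \<open>p v\<close> is the product of the tail integral \<open>J\<close> and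
  \<open>\<Psi> = - 1 / E\<close>. Integration by parts of this product yields
  \<open>(p v)' = \<Phi> + lam v\<close> in integrated form.\<close>

lemma volterra_flux_increment:
  assumes lam: "Re lam > pi / 6" and \<Phi>: "sq_integrable_on \<Phi> {-pi..pi}"
    and ab: "-pi < a" "a \<le> b" "b < pi"
  shows "of_real (wave_gap b) * volterra lam \<Phi> b - of_real (wave_gap a) * volterra lam \<Phi> a
    = integral {a..b} (\<lambda>z. \<Phi> z + lam * volterra lam \<Phi> z)"
proof -
  have sub: "{a..b} \<subseteq> {-pi<..<pi}" using ab by auto
  define J where "J z = integral {z..pi} (\<lambda>t. hom_factor lam t * \<Phi> t)" for z
  have J: "antiderivative_on J (\<lambda>z. - (hom_factor lam z * \<Phi> z)) a b"
    unfolding J_def using ab by (intro antiderivative_on_integral_right hom_factor_product_integrable lam \<Phi>) auto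
  define \<Psi> where "\<Psi> z = - inverse (hom_factor lam z)" for z
  define \<Psi>' where "\<Psi>' z = - (lam / (of_real (wave_gap z) * hom_factor lam z))" for z
  \<comment> \<open>The reciprocal of the factor is the factor for \<open>- lam\<close>, whose
    derivative is already known.\<close>
  have \<Psi>eq: "\<Psi> = (\<lambda>z. - hom_factor (- lam) z)"
    by (auto simp: \<Psi>_def hom_factor_def exp_minus)
  have \<Psi>'eq: "\<Psi>' z = - (- (- lam) * hom_factor (- lam) z / of_real (wave_gap z))" for z
    by (simp add: \<Psi>'_def hom_factor_def exp_minus field_simps)
  have D: "(\<Psi> has_vector_derivative \<Psi>' z) (at z within {a..b})" if "z \<in> {a..b}" for z
  proof -
    have z: "z \<in> {-pi<..<pi}" using that sub by auto
    have "(\<Psi> has_vector_derivative \<Psi>' z) (at z)"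
      unfolding \<Psi>eq \<Psi>'eq by (rule has_vector_derivative_minus[OF hom_factor_has_derivative[OF z]])
    then show ?thesis by (rule has_vector_derivative_at_within)
  qed
  have nz: "\<forall>z\<in>{a..b}. complex_of_real (wave_gap z) * hom_factor lam z \<noteq> 0"
  proof
    fix z assume "z \<in> {a..b}"
    then have "wave_gap z > 0" using sub by (intro wave_gap_pos) auto
    then show "complex_of_real (wave_gap z) * hom_factor lam z \<noteq> 0" by simp
  qed
  have c\<Psi>': "continuous_on {a..b} \<Psi>'"
    unfolding \<Psi>'_def by (intro continuous_intros continuous_on_wave_gap continuous_on_hom_factor sub nz)
  have cv: "continuous_on {a..b} (volterra lam \<Phi>)"
    by (rule continuous_on_subset[OF continuous_on_volterra[OF lam \<Phi>] sub])
  have \<Phi>i: "\<Phi> integrable_on {a..b}"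
    using ab by (intro set_lebesgue_integral_eq_integral(1) sq_integrable_on_imp_absolutely_integrable
        sq_integrable_on_subset[OF \<Phi>]) auto
  have G: "J z * \<Psi> z = of_real (wave_gap z) * volterra lam \<Phi> z" if "z \<in> {a..b}" for z
    using nz that by (auto simp: J_def \<Psi>_def volterra_def field_simps)
  have "integral {a..b} \<Phi> = integral {a..b} (\<lambda>z. - (hom_factor lam z * \<Phi> z) * \<Psi> z)"
    by (rule integral_cong) (simp add: \<Psi>_def)
  also have "\<dots> = J b * \<Psi> b - J a * \<Psi> a - integral {a..b} (\<lambda>z. J z * \<Psi>' z)"
    by (rule antiderivative_on_by_parts[OF J ab(2) D c\<Psi>'])
  also have "integral {a..b} (\<lambda>z. J z * \<Psi>' z) = integral {a..b} (\<lambda>z. lam * volterra lam \<Phi> z)"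
    by (rule integral_cong) (simp add: J_def \<Psi>'_def volterra_def)
  finally have "J b * \<Psi> b - J a * \<Psi> a = integral {a..b} \<Phi> + integral {a..b} (\<lambda>z. lam * volterra lam \<Phi> z)"
    by (simp add: algebra_simps)
  also have "\<dots> = integral {a..b} (\<lambda>z. \<Phi> z + lam * volterra lam \<Phi> z)"
    by (intro integral_add[symmetric] \<Phi>i integrable_continuous_real continuous_intros cv)
  finally show ?thesis using G[of a] G[of b] ab by simp
qed

lemma volterra_flux:
  assumes lam: "Re lam > pi / 6" and \<Phi>: "sq_integrable_on \<Phi> {-pi..pi}"
  obtains G where "antiderivative_on G (\<lambda>z. \<Phi> z + lam * volterra lam \<Phi> z) (-pi) pi"
    "\<And>z. z \<in> {-pi<..<pi} \<Longrightarrow> of_real (wave_gap z) * volterra lam \<Phi> z = G z"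
proof -
  define g where "g z = \<Phi> z + lam * volterra lam \<Phi> z" for z
  have gs: "sq_integrable_on g {-pi..pi}"
    unfolding g_def by (intro sq_integrable_on_add sq_integrable_on_cmult sq_integrable_volterra lam \<Phi>) auto
  note ga = sq_integrable_on_imp_absolutely_integrable[OF gs]
  \<comment> \<open>Anchored at 0, because the flux identity is available only on compact
    subintervals of the open interval.\<close>
  define G where "G z = of_real (wave_gap 0) * volterra lam \<Phi> 0 - integral {-pi..0} g + integral {-pi..z} g" for z
  have G: "antiderivative_on G g (-pi) pi"
    by (rule antiderivative_onI[OF ga]) (simp add: G_def)
  have "of_real (wave_gap z) * volterra lam \<Phi> z = G z" if z: "z \<in> {-pi<..<pi}" for z
  proof (cases "z \<ge> 0")
    case True
    have "G z - G 0 = integral {0..z} g" using True z by (intro antiderivative_on_diff[OF G]) auto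
    moreover have "G 0 = of_real (wave_gap 0) * volterra lam \<Phi> 0" by (simp add: G_def)
    ultimately show ?thesis
      using volterra_flux_increment[OF lam \<Phi>, of 0 z] True z unfolding g_def[symmetric] by (simp add: algebra_simps)
  next
    case False
    have "G 0 - G z = integral {z..0} g" using False z by (intro antiderivative_on_diff[OF G]) auto
    moreover have "G 0 = of_real (wave_gap 0) * volterra lam \<Phi> 0" by (simp add: G_def)
    ultimately show ?thesis
      using volterra_flux_increment[OF lam \<Phi>, of z 0] False z unfolding g_def[symmetric] by (simp add: algebra_simps)
  qed
  then show thesis using that G unfolding g_def by blast
qed

lemma sq_integrable_one: "sq_integrable_on (\<lambda>t. 1::real) {a..b}"
  by (intro sq_integrable_on_continuous continuous_intros)

text \<open>The factor decays like \<open>1 / sqrt k\<close>, which gives a contraction in an exponentially weighted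
  supremum norm.\<close>

lemma norm_integral_volterra_le:
  assumes lam: "Re lam > pi / 6" and \<Phi>: "sq_integrable_on \<Phi> {-pi..pi}" and k: "k > 0" and M: "M \<ge> 0"
    and bnd: "\<And>t. t \<in> {-pi..pi} \<Longrightarrow> cmod (\<Phi> t) \<le> M * exp (- k * t)" and z: "z \<in> {-pi..pi}"
  shows "cmod (integral {z..pi} (volterra lam \<Phi>))
    \<le> M * exp (- k * z) * (sq_norm_on (hardy (Re lam) (\<lambda>t. 1)) {-pi..pi} / sqrt (2 * k))"
proof -
  define k1 where "k1 = hardy (Re lam) (\<lambda>t. 1)"
  have r0: "Re lam \<ge> 0" using pos_if_gt_pi_sixth[OF lam] by simp
  have k1: "sq_integrable_on k1 {-pi..pi}" unfolding k1_def by (rule hardy_inequality(1)[OF lam sq_integrable_one])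
  have k1z: "sq_integrable_on k1 {z..pi}" using z by (intro sq_integrable_on_subset[OF k1]) auto
  have ez: "sq_integrable_on (\<lambda>s. exp (- k * s)) {z..pi}" by (intro sq_integrable_on_continuous continuous_intros)
  \<comment> \<open>For \<open>t \<ge> s\<close> the weight \<open>exp (- k * t)\<close> is at most
    \<open>exp (- k * s)\<close> and can be pulled out of the tail integral, which leaves
    \<open>hardy\<close> of the constant 1.\<close>
  have pt: "cmod (volterra lam \<Phi> s) \<le> M * (exp (- k * s) * k1 s)" if s: "s \<in> {-pi..pi}" for s
  proof (cases "s = pi \<or> s = -pi")
    case True
    then have "wave_gap s = 0" by (auto simp: wave_gap_def)
    then show ?thesis by (simp add: volterra_def k1_def hardy_def)
  next
    case False
    then have s': "s \<in> {-pi<..<pi}" using s by auto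
    have "integral {s..pi} (\<lambda>t. ell_weight (Re lam) t * cmod (\<Phi> t)) \<le> integral {s..pi} (\<lambda>t. (ell_weight (Re lam) t * 1) * (M * exp (- k * s)))"
    proof (rule integral_le)
      show "(\<lambda>t. ell_weight (Re lam) t * cmod (\<Phi> t)) integrable_on {s..pi}"
        using s' by (intro set_lebesgue_integral_eq_integral(1) weight_product_integrable r0 sq_integrable_on_norm \<Phi>) auto
      show "(\<lambda>t. (ell_weight (Re lam) t * 1) * (M * exp (- k * s))) integrable_on {s..pi}"
        using s' by (intro integrable_on_mult_left set_lebesgue_integral_eq_integral(1) weight_product_integrable r0 sq_integrable_one) auto
      fix t assume t: "t \<in> {s..pi}"
      have "cmod (\<Phi> t) \<le> M * exp (- k * t)" using t s by (intro bnd) auto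
      also have "\<dots> \<le> M * exp (- k * s)" using t k M by (intro mult_left_mono) auto
      finally show "ell_weight (Re lam) t * cmod (\<Phi> t) \<le> (ell_weight (Re lam) t * 1) * (M * exp (- k * s))"
        by (simp add: mult_left_mono)
    qed
    also have "\<dots> = (M * exp (- k * s)) * integral {s..pi} (\<lambda>t. ell_weight (Re lam) t * 1)"
      by (simp only: integral_mult_left mult.commute)
    finally have "hardy (Re lam) (\<lambda>t. cmod (\<Phi> t)) s \<le> (M * exp (- k * s)) * k1 s"
      unfolding hardy_def k1_def times_divide_eq_right using wave_gap_pos[OF s'] by (intro divide_right_mono) auto
    then show ?thesis using norm_volterra_le[OF lam \<Phi> s] by simp
  qed
  have vi: "volterra lam \<Phi> integrable_on {z..pi}"
    using z by (intro set_lebesgue_integral_eq_integral(1) sq_integrable_on_imp_absolutely_integrable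
        sq_integrable_on_subset[OF sq_integrable_volterra[OF lam \<Phi>]]) auto
  have "cmod (integral {z..pi} (volterra lam \<Phi>)) \<le> integral {z..pi} (\<lambda>s. M * (exp (- k * s) * k1 s))"
  proof (rule integral_norm_bound_integral[OF vi])
    show "(\<lambda>s. M * (exp (- k * s) * k1 s)) integrable_on {z..pi}"
      by (intro integrable_on_mult_right set_lebesgue_integral_eq_integral(1) sq_integrable_on_product ez k1z) simp
  qed (use pt z in auto)
  also have "\<dots> = M * integral {z..pi} (\<lambda>s. exp (- k * s) * k1 s)" by simp
  also have "\<dots> \<le> M * (sq_norm_on (\<lambda>s. exp (- k * s)) {z..pi} * sq_norm_on k1 {z..pi})"
    using norm_integral_product_le[OF _ ez k1z] M by (intro mult_left_mono) auto
  also have "\<dots> \<le> M * ((exp (- k * z) / sqrt (2 * k)) * sq_norm_on k1 {-pi..pi})"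
  proof (intro mult_left_mono[OF _ M] mult_mono)
    have e: "exp (- (2 * k) * s) = (exp (- k * s))\<^sup>2" for s
      unfolding exp_double[symmetric] by (simp add: mult.assoc)
    have "((\<lambda>s. exp (- (2 * k) * s)) has_integral - exp (- (2 * k) * pi) / (2 * k) - - exp (- (2 * k) * z) / (2 * k)) {z..pi}"
      using z k unfolding has_real_derivative_iff_has_vector_derivative[symmetric]
      by (intro fundamental_theorem_of_calculus)
        (auto intro!: derivative_eq_intros simp: has_real_derivative_iff_has_vector_derivative[symmetric])
    then have "integral {z..pi} (\<lambda>s. exp (- (2 * k) * s)) = exp (- (2 * k) * z) / (2 * k) - exp (- (2 * k) * pi) / (2 * k)"
      by (simp add: integral_unique)
    also have "\<dots> \<le> exp (- (2 * k) * z) / (2 * k)" using k by simp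
    finally have "integral {z..pi} (\<lambda>s. (norm (exp (- k * s)))\<^sup>2) \<le> (exp (- k * z))\<^sup>2 / (2 * k)"
      unfolding e by simp
    then have "sq_norm_on (\<lambda>s. exp (- k * s)) {z..pi} \<le> sqrt ((exp (- k * z))\<^sup>2 / (2 * k))"
      unfolding sq_norm_on_def by (rule real_sqrt_le_mono)
    then show "sq_norm_on (\<lambda>s. exp (- k * s)) {z..pi} \<le> exp (- k * z) / sqrt (2 * k)"
      by (simp add: real_sqrt_divide)
    show "sq_norm_on k1 {z..pi} \<le> sq_norm_on k1 {-pi..pi}"
      unfolding sq_norm_on_def using z
      by (intro real_sqrt_le_mono integral_subset_le sq_integrable_on_square k1 k1z) auto
  qed (use k sq_norm_on_nonneg in auto)
  finally show ?thesis by (simp add: k1_def algebra_simps)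
qed

lemma volterra_contraction_weight:
  obtains k where "k > 0" "sq_norm_on (hardy r (\<lambda>t. 1)) {-pi..pi} / sqrt (2 * k) \<le> 1 / 2"
proof -
  define n where "n = sq_norm_on (hardy r (\<lambda>t. 1)) {-pi..pi}"
  have n: "n \<ge> 0" unfolding n_def by (rule sq_norm_on_nonneg)
  \<comment> \<open>Makes \<open>2 * k \<ge> (2 * n)^2\<close>, hence
    \<open>n / sqrt (2 * k) \<le> 1 / 2\<close>; the summand 1 keeps \<open>k\<close> positive when
    \<open>n = 0\<close>.\<close>
  define k where "k = 2 * n\<^sup>2 + 1"
  have k: "k > 0" by (simp add: k_def add_nonneg_pos)
  have "2 * n \<le> sqrt (2 * k)" by (rule real_le_rsqrt) (simp add: k_def power_mult_distrib)
  then have "n / sqrt (2 * k) \<le> 1 / 2" using k by (simp add: field_simps)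
  then show thesis using that k unfolding n_def by blast
qed

text \<open>The unknown is \<open>h = exp (k * z) * u\<close>, so the weighted supremum norm of
  \<open>u\<close> becomes the plain one of \<open>h\<close>, and Banach's theorem applies in the
  complete space of bounded continuous functions. Clamping by \<open>cl\<close> extends functions
  from the interval to the line.\<close>

lemma volterra_fixed_point:
  assumes lam: "Re lam > pi / 6" and f: "sq_integrable_on f {-pi..pi}"
  obtains u where "continuous_on {-pi..pi} u"
    "\<And>z. z \<in> {-pi..pi} \<Longrightarrow> u z = - integral {z..pi} (volterra lam (\<lambda>t. f t - u t))"
proof -
  obtain k where k: "k > 0" "sq_norm_on (hardy (Re lam) (\<lambda>t. 1)) {-pi..pi} / sqrt (2 * k) \<le> 1 / 2"
    using volterra_contraction_weight by blast
  define cl where "cl z = max (-pi) (min pi z)" for z :: real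
  have cl: "cl z \<in> {-pi..pi}" for z by (auto simp: cl_def)
  have cl_id: "cl z = z" if "z \<in> {-pi..pi}" for z using that by (auto simp: cl_def)
  have ccl: "continuous_on UNIV cl" unfolding cl_def by (intro continuous_intros)
  define U where "U h t = complex_of_real (exp (- k * t)) * apply_bcontfun h t" for h :: "real \<Rightarrow>\<^sub>C complex" and t
  have cU: "continuous_on {-pi..pi} (U h)" for h unfolding U_def by (intro continuous_intros continuous_on_apply_bcontfun)
  have sU: "sq_integrable_on (U h) {-pi..pi}" for h by (rule sq_integrable_on_continuous[OF cU])
  have sfU: "sq_integrable_on (\<lambda>t. f t - U h t) {-pi..pi}" for h
    by (intro sq_integrable_on_diff f sU) auto
  define T where "T h z = complex_of_real (exp (k * z)) * - integral {z..pi} (volterra lam (\<lambda>t. f t - U h t))" for h z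
  have vi: "volterra lam \<Phi> integrable_on {z..pi}" if "sq_integrable_on \<Phi> {-pi..pi}" "z \<in> {-pi..pi}" for \<Phi> z
    using that(2) by (intro set_lebesgue_integral_eq_integral(1) sq_integrable_on_imp_absolutely_integrable
        sq_integrable_on_subset[OF sq_integrable_volterra[OF lam that(1)]]) auto
  have cT: "continuous_on {-pi..pi} (T h)" for h
    unfolding T_def by (intro continuous_intros indefinite_integral_continuous_1' vi sfU) auto
  have bT: "(\<lambda>z. T h (cl z)) \<in> bcontfun" for h
    unfolding bcontfun_def
  proof (intro CollectI conjI)
    show "continuous_on UNIV (\<lambda>z. T h (cl z))"
      by (rule continuous_on_compose2[OF cT ccl]) (use cl in auto)
    have "bounded (T h ` {-pi..pi})"
      by (intro compact_imp_bounded compact_continuous_image cT compact_Icc)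
    then show "bounded (range (\<lambda>z. T h (cl z)))"
      by (rule bounded_subset) (use cl in auto)
  qed
  define S where "S h = Bcontfun (\<lambda>z. T h (cl z))" for h
  have S: "apply_bcontfun (S h) z = T h (cl z)" for h z
    unfolding S_def using Bcontfun_inverse[OF bT] by simp
  have "dist (S h) (S h') \<le> 1 / 2 * dist h h'" for h h'
  proof (rule dist_bound)
    fix z0
    define z where "z = cl z0"
    have z: "z \<in> {-pi..pi}" unfolding z_def by (rule cl)
    define \<Phi> where "\<Phi> t = U h' t - U h t" for t
    have \<Phi>: "sq_integrable_on \<Phi> {-pi..pi}" unfolding \<Phi>_def by (intro sq_integrable_on_diff sU) auto
    have dif: "volterra lam (\<lambda>t. f t - U h t) s - volterra lam (\<lambda>t. f t - U h' t) s = volterra lam \<Phi> s"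
      if "s \<in> {-pi..pi}" for s
      using volterra_diff[OF lam sfU[of h] sfU[of h'] that] by (simp add: \<Phi>_def[abs_def])
    have "integral {z..pi} (volterra lam (\<lambda>t. f t - U h t)) - integral {z..pi} (volterra lam (\<lambda>t. f t - U h' t))
       = integral {z..pi} (\<lambda>s. volterra lam (\<lambda>t. f t - U h t) s - volterra lam (\<lambda>t. f t - U h' t) s)"
      by (intro integral_diff[symmetric] vi sfU z)
    also have "\<dots> = integral {z..pi} (volterra lam \<Phi>)"
      by (rule integral_cong) (use dif z in auto)
    finally have "T h z - T h' z = - (complex_of_real (exp (k * z)) * integral {z..pi} (volterra lam \<Phi>))"
      unfolding T_def by (simp add: algebra_simps)
    then have "dist (T h z) (T h' z) = exp (k * z) * cmod (integral {z..pi} (volterra lam \<Phi>))"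
      by (simp add: dist_norm norm_mult)
    also have "\<dots> \<le> exp (k * z) * (dist h h' * exp (- k * z) * (sq_norm_on (hardy (Re lam) (\<lambda>t. 1)) {-pi..pi} / sqrt (2 * k)))"
    proof (intro mult_left_mono norm_integral_volterra_le lam \<Phi> k(1) z)
      fix t
      have "cmod (\<Phi> t) = exp (- k * t) * dist (apply_bcontfun h' t) (apply_bcontfun h t)"
        unfolding \<Phi>_def U_def right_diff_distrib[symmetric] norm_mult by (simp add: dist_norm)
      also have "\<dots> \<le> exp (- k * t) * dist h h'"
        using dist_bounded[of h' t h] by (intro mult_left_mono) (auto simp: dist_commute)
      finally show "cmod (\<Phi> t) \<le> dist h h' * exp (- k * t)" by (simp add: mult.commute)
    qed auto
    also have "\<dots> = (exp (k * z) * exp (- k * z)) * dist h h' * (sq_norm_on (hardy (Re lam) (\<lambda>t. 1)) {-pi..pi} / sqrt (2 * k))"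
      by (simp only: mult_ac)
    also have "\<dots> = dist h h' * (sq_norm_on (hardy (Re lam) (\<lambda>t. 1)) {-pi..pi} / sqrt (2 * k))"
      by (simp flip: exp_add)
    also have "\<dots> \<le> dist h h' * (1 / 2)" by (intro mult_left_mono k) auto
    finally show "dist (apply_bcontfun (S h) z0) (apply_bcontfun (S h') z0) \<le> 1 / 2 * dist h h'"
      unfolding S z_def by simp
  qed
  then have "\<exists>!h. S h = h" by (intro banach_fix_type[of "1/2"]) auto
  then obtain h where h: "S h = h" by blast
  have "U h z = - integral {z..pi} (volterra lam (\<lambda>t. f t - U h t))" if z: "z \<in> {-pi..pi}" for z
  proof -
    have "apply_bcontfun h z = T h z" using S[of h z] h cl_id[OF z] by simp
    then have "U h z = complex_of_real (exp (- k * z) * exp (k * z)) * - integral {z..pi} (volterra lam (\<lambda>t. f t - U h t))"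
      by (simp add: U_def T_def)
    also have "exp (- k * z) * exp (k * z) = 1" by (simp flip: exp_add)
    finally show ?thesis by simp
  qed
  then show thesis using that cU by blast
qed

section \<open>The homogeneous solution and surjectivity\<close>

lemma antiderivative_on_add_cmult:
  assumes "antiderivative_on G g a b" "antiderivative_on H h a b"
  shows "antiderivative_on (\<lambda>z. G z + c * H z) (\<lambda>z. g z + c * h z) a b"
proof (rule antiderivative_onI)
  show "(\<lambda>z. g z + c * h z) absolutely_integrable_on {a..b}"
    by (intro set_integral_add(1) set_integrable_mult_right antiderivative_on_absolutely_integrable[OF assms(1)]
        antiderivative_on_absolutely_integrable[OF assms(2)])
  fix x assume x: "x \<in> {a..b}"
  have "g integrable_on {a..x}" "h integrable_on {a..x}"
    using x by (auto intro: integrable_on_subinterval[OF antiderivative_on_integrable[OF assms(1)]]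
      integrable_on_subinterval[OF antiderivative_on_integrable[OF assms(2)]])
  then have e: "integral {a..x} (\<lambda>z. g z + c * h z) = integral {a..x} g + c * integral {a..x} h"
    by (simp add: integral_add integrable_on_mult_right)
  show "G x + c * H x = G a + c * H a + integral {a..x} (\<lambda>z. g z + c * h z)"
    unfolding e antiderivative_onD[OF assms(1) x] antiderivative_onD[OF assms(2) x]
    by (simp add: algebra_simps)
qed

lemma antiderivative_on_cong:
  assumes "antiderivative_on G g a b" "\<And>x. x \<in> {a..b} \<Longrightarrow> H x = G x"
  shows "antiderivative_on H g a b"
proof (rule antiderivative_onI[OF antiderivative_on_absolutely_integrable[OF assms(1)]])
  fix x assume x: "x \<in> {a..b}"
  then have "a \<in> {a..b}" by auto
  show "H x = H a + integral {a..x} g"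
    unfolding assms(2)[OF x] assms(2)[OF \<open>a \<in> {a..b}\<close>] by (rule antiderivative_onD[OF assms(1) x])
qed

lemma antiderivative_on_C1:
  fixes \<Phi> :: "real \<Rightarrow> 'a::{real_normed_field,euclidean_space}"
  assumes "\<And>x. x \<in> {a..b} \<Longrightarrow> (\<Phi> has_vector_derivative \<phi> x) (at x within {a..b})" "continuous_on {a..b} \<phi>"
  shows "antiderivative_on \<Phi> \<phi> a b"
proof (rule antiderivative_onI[OF absolutely_integrable_continuous_real[OF assms(2)]])
  fix x assume x: "x \<in> {a..b}"
  have "(\<phi> has_integral (\<Phi> x - \<Phi> a)) {a..x}"
    using x by (intro fundamental_theorem_of_calculus has_vector_derivative_within_subset[OF assms(1)]) auto
  then show "\<Phi> x = \<Phi> a + integral {a..x} \<phi>" by (simp add: integral_unique)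
qed

lemma poly_sol_antiderivative: "antiderivative_on (poly_sol lam) (poly_sol' lam) a b"
  by (intro antiderivative_on_C1 poly_sol_has_derivative continuous_on_poly_sol')

text \<open>The homogeneous equation \<open>(p P')' + P = lam P'\<close> as a statement about
  primitives: adding a multiple of \<open>P\<close> to \<open>u\<close> and the same multiple of
  \<open>P'\<close> to \<open>v\<close> leaves the right-hand side unchanged.\<close>

lemma poly_flux_antiderivative:
  "antiderivative_on (\<lambda>z. of_real (wave_gap z) * poly_sol' lam z) (\<lambda>z. - poly_sol lam z + lam * poly_sol' lam z) a b"
proof (rule antiderivative_on_C1)
  fix x
  have "((\<lambda>z. of_real (wave_gap z) * poly_sol' lam z) has_vector_derivative
      (of_real (wave_gap x) * 2 + of_real (- x / 3) * poly_sol' lam x)) (at x within {a..b})"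
    by (intro has_vector_derivative_mult wave_gap_has_derivative poly_sol'_has_derivative)
  also have "of_real (wave_gap x) * 2 + of_real (- x / 3) * poly_sol' lam x = - poly_sol lam x + lam * poly_sol' lam x"
    by (simp add: wave_gap_def poly_sol_def poly_sol'_def field_simps power2_eq_square)
  finally show "((\<lambda>z. of_real (wave_gap z) * poly_sol' lam z) has_vector_derivative
      (- poly_sol lam x + lam * poly_sol' lam x)) (at x within {a..b})" .
qed (intro continuous_intros continuous_on_poly_sol continuous_on_poly_sol')

lemma poly_sol_endpoint_diff: "poly_sol lam pi - poly_sol lam (- pi) = 6 * of_real pi * lam"
  by (simp add: poly_sol_def)

text \<open>As a polynomial in \<open>lam\<close> the value at \<open>pi\<close> has the roots
  \<open>- pi / 3\<close> and \<open>- 2 * pi / 3\<close>, both in the left half plane. This permits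
  the normalization \<open>u pi = 0\<close> in \<open>resolvent_bounded\<close>.\<close>

lemma poly_sol_pi_nonzero:
  assumes "Re lam > 0"
  shows "poly_sol lam pi \<noteq> 0"
proof -
  have "poly_sol lam pi = 3 * (lam + of_real (pi / 3)) * (lam + of_real (2 * pi / 3))"
    by (simp add: poly_sol_def field_simps power2_eq_square)
  moreover have "Re (lam + of_real (pi / 3)) > 0" "Re (lam + of_real (2 * pi / 3)) > 0"
    using assms by (auto intro: add_pos_pos)
  then have "lam + of_real (pi / 3) \<noteq> 0" "lam + of_real (2 * pi / 3) \<noteq> 0"
    by (metis less_irrefl zero_complex.sel(1))+
  ultimately show ?thesis by (metis mult_eq_0_iff zero_neq_numeral)
qed

text \<open>The fixed point solves the equation with a primitive normalized at \<open>pi\<close>,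
  whereas the operator asks for zero means of both \<open>v\<close> and \<open>u\<close>. One free
  multiple of the homogeneous solution suffices, because the mean of \<open>u\<close> follows from
  the equation once \<open>v\<close> has zero mean.\<close>

lemma resolvent_surjective:
  assumes lam: "Re lam > pi / 6" and f: "L2per0 f"
  shows "\<exists>v w. A_graph v w \<and> ae_eq_on (\<lambda>z. w z - lam * v z) f"
proof -
  let ?I = "{-pi..pi}"
  have fs: "sq_integrable_on f ?I" and f0: "integral ?I f = 0" using f by (auto simp: L2per0_iff)
  have lam0: "lam \<noteq> 0" using pos_if_gt_pi_sixth[OF lam] by auto
  obtain u0 where cu0: "continuous_on ?I u0"
    and u0: "\<And>z. z \<in> ?I \<Longrightarrow> u0 z = - integral {z..pi} (volterra lam (\<lambda>t. f t - u0 t))"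
    using volterra_fixed_point[OF lam fs] by blast
  define \<Phi> where "\<Phi> t = f t - u0 t" for t
  have \<Phi>: "sq_integrable_on \<Phi> ?I"
    unfolding \<Phi>_def by (intro sq_integrable_on_diff fs sq_integrable_on_continuous cu0) auto
  define v0 where "v0 = volterra lam \<Phi>"
  have v0s: "sq_integrable_on v0 ?I" unfolding v0_def by (rule sq_integrable_volterra[OF lam \<Phi>])
  have u0': "u0 z = - integral {z..pi} v0" if "z \<in> ?I" for z
    using u0[OF that] unfolding v0_def \<Phi>_def .
  obtain G0 where G0: "antiderivative_on G0 (\<lambda>z. \<Phi> z + lam * v0 z) (-pi) pi"
    and vG0: "\<And>z. z \<in> {-pi<..<pi} \<Longrightarrow> of_real (wave_gap z) * v0 z = G0 z"
    using volterra_flux[OF lam \<Phi>] unfolding v0_def by blast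
  have "antiderivative_on (\<lambda>z. 0::complex) (\<lambda>z. 0) (-pi) pi" by (rule antiderivative_onI) simp_all
  from antiderivative_on_add_cmult[OF this antiderivative_on_integral_right[OF
      sq_integrable_on_imp_absolutely_integrable[OF v0s] order_refl], of "-1"]
  have "antiderivative_on (\<lambda>z. 0 + (-1) * integral {z..pi} v0) (\<lambda>z. 0 + (-1) * (- v0 z)) (-pi) pi" .
  then have "antiderivative_on u0 (\<lambda>z. 0 + (-1) * (- v0 z)) (-pi) pi"
    by (rule antiderivative_on_cong) (simp add: u0')
  then have u0v0: "antiderivative_on u0 v0 (-pi) pi" by simp
  \<comment> \<open>As \<open>u0 pi = 0\<close>, this choice makes \<open>u\<close> equal at both
    endpoints, that is, it gives \<open>v\<close> zero mean; the denominator is the endpoint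
    difference of \<open>poly_sol\<close>.\<close>
  define c where "c = u0 (-pi) / (6 * of_real pi * lam)"
  define v where "v z = v0 z + c * poly_sol' lam z" for z
  define u where "u z = u0 z + c * poly_sol lam z" for z
  define g where "g z = (\<Phi> z + lam * v0 z) + c * (- poly_sol lam z + lam * poly_sol' lam z)" for z
  define G where "G z = G0 z + c * (of_real (wave_gap z) * poly_sol' lam z)" for z
  have uv: "antiderivative_on u v (-pi) pi"
    unfolding u_def v_def by (intro antiderivative_on_add_cmult u0v0 poly_sol_antiderivative)
  have Gg: "antiderivative_on G g (-pi) pi"
    unfolding G_def g_def by (intro antiderivative_on_add_cmult G0 poly_flux_antiderivative)
  have vs: "sq_integrable_on v ?I"
    unfolding v_def by (intro sq_integrable_on_add sq_integrable_on_cmult v0s sq_integrable_on_continuous continuous_on_poly_sol') auto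
  have gs: "sq_integrable_on g ?I"
    unfolding g_def
    by (intro sq_integrable_on_add sq_integrable_on_cmult v0s \<Phi> sq_integrable_on_continuous
        continuous_on_poly_sol' continuous_on_poly_sol continuous_intros) auto
  have geq: "g z = f z - u z + lam * v z" for z
    unfolding g_def u_def v_def \<Phi>_def by (simp add: algebra_simps)
  have "u0 pi = 0" using u0'[of pi] by simp
  then have "u pi - u (-pi) = c * (poly_sol lam pi - poly_sol lam (-pi)) - u0 (-pi)"
    by (simp add: u_def algebra_simps)
  also have "\<dots> = 0" unfolding poly_sol_endpoint_diff using lam0 by (simp add: c_def)
  finally have v0: "integral ?I v = 0"
    using antiderivative_on_diff[OF uv, of "-pi" pi] by simp
  have vG: "AE x in lebesgue. x \<in> ?I \<longrightarrow> of_real (wave_gap x) * v x = G x"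
    using AE_Icc_imp_Ioo[of "-pi" pi] by (rule AE_mp) (rule AE_I2, simp add: v_def G_def vG0[symmetric] algebra_simps)
  note va = sq_integrable_on_imp_absolutely_integrable[OF vs]
  have "G pi = 0" "G (-pi) = 0"
    using gap_product_vanishes[OF va antiderivative_on_continuous[OF Gg] vG] by auto
  then have g0: "integral ?I g = 0" using antiderivative_on_diff[OF Gg, of "-pi" pi] by simp
  have fi: "f integrable_on ?I" "v integrable_on ?I"
    using sq_integrable_on_imp_absolutely_integrable[OF fs] va by (auto intro: set_lebesgue_integral_eq_integral(1))
  have ui: "u integrable_on ?I" by (intro integrable_continuous_real antiderivative_on_continuous[OF uv])
  \<comment> \<open>The equation is integrated: \<open>f\<close>, \<open>v\<close> and
    \<open>g\<close> have zero mean, hence so has \<open>u\<close>.\<close>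
  have "integral ?I g = integral ?I f - integral ?I u + lam * integral ?I v"
    unfolding geq by (simp add: integral_add integral_diff integrable_diff integrable_on_mult_right fi ui)
  then have "integral ?I u = 0" using g0 f0 v0 by simp
  then have au: "antideriv0 v x = u x" if "x \<in> ?I" for x using antideriv0_unique[OF uv _ that] by simp
  have "A_graph v (\<lambda>z. g z + antideriv0 v z)"
    by (rule A_graphI[OF vs v0 gs g0 Gg vG]) simp
  moreover have "ae_eq_on (\<lambda>z. (g z + antideriv0 v z) - lam * v z) f"
    unfolding ae_eq_on_def by (rule AE_I2) (simp add: au geq)
  ultimately show ?thesis by blast
qed

section \<open>Uniqueness and the bound on the resolvent\<close>

lemma ell_weight_tendsto_0:
  assumes "r > 0"
  shows "(ell_weight r \<longlongrightarrow> 0) (at_left pi)"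
proof -
  have "((\<lambda>y. exp (- r * y)) \<longlongrightarrow> 0) at_top" using assms by real_asymp
  from filterlim_compose[OF this ell_at_top] show ?thesis by (simp add: ell_weight_def[abs_def])
qed

text \<open>Since \<open>(E G)' = E (g - lam v)\<close> and \<open>E\<close> tends to 0 at
  \<open>pi\<close> for \<open>Re lam > 0\<close>, integration up to \<open>pi\<close> leaves no
  boundary term there. This determines the flux of every domain element and is the uniqueness behind
  the resolvent bound.\<close>

lemma domain_flux_eq_volterra:
  assumes lam: "Re lam > pi / 6" and g: "sq_integrable_on g {-pi..pi}" and v: "sq_integrable_on v {-pi..pi}"
    and G: "antiderivative_on G g (-pi) pi"
    and vG: "AE x in lebesgue. x \<in> {-pi..pi} \<longrightarrow> of_real (wave_gap x) * v x = G x"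
    and z: "z \<in> {-pi<..<pi}"
  shows "G z = of_real (wave_gap z) * volterra lam (\<lambda>t. g t - lam * v t) z"
proof -
  define h where "h t = g t - lam * v t" for t
  have hs: "sq_integrable_on h {-pi..pi}"
    unfolding h_def by (intro sq_integrable_on_diff sq_integrable_on_cmult g v) auto
  have Eh: "(\<lambda>t. hom_factor lam t * h t) integrable_on {z..pi}"
    using z by (intro set_lebesgue_integral_eq_integral(1) hom_factor_product_integrable lam hs) auto
  obtain N where N: "negligible N" "\<And>x. x \<in> {-pi..pi} \<Longrightarrow> x \<notin> N \<Longrightarrow> of_real (wave_gap x) * v x = G x"
    using AE_on_obtain[OF vG] by blast
  have fin: "integral {z..b} (\<lambda>t. hom_factor lam t * h t) = G b * hom_factor lam b - G z * hom_factor lam z"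
    if b: "b \<in> {z<..<pi}" for b
  proof -
    have sub: "{z..b} \<subseteq> {-pi<..<pi}" using z b by auto
    have zb: "z \<le> b" using b by auto
    have Gs: "antiderivative_on G g z b" using z b by (intro antiderivative_on_subinterval[OF G]) auto
    define E' where "E' t = - lam * hom_factor lam t / of_real (wave_gap t)" for t
    have nz: "\<forall>t\<in>{z..b}. complex_of_real (wave_gap t) \<noteq> 0"
    proof
      fix t assume "t \<in> {z..b}"
      then have "wave_gap t > 0" using sub by (intro wave_gap_pos) auto
      then show "complex_of_real (wave_gap t) \<noteq> 0" by simp
    qed
    have cE: "continuous_on {z..b} (hom_factor lam)" by (rule continuous_on_hom_factor[OF sub])
    have cE': "continuous_on {z..b} E'"
      unfolding E'_def by (intro continuous_intros cE continuous_on_wave_gap nz)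
    have D: "(hom_factor lam has_vector_derivative E' t) (at t within {z..b})" if "t \<in> {z..b}" for t
      unfolding E'_def using that sub by (intro has_vector_derivative_at_within[OF hom_factor_has_derivative]) auto
    have vi: "(\<lambda>t. v t * hom_factor lam t) integrable_on {z..b}" "(\<lambda>t. g t * hom_factor lam t) integrable_on {z..b}"
      using z b by (intro set_lebesgue_integral_eq_integral(1) absolutely_integrable_mult_continuous cE
          sq_integrable_on_imp_absolutely_integrable sq_integrable_on_subset[OF v] sq_integrable_on_subset[OF g]; auto)+
    have "integral {z..b} (\<lambda>t. g t * hom_factor lam t) = G b * hom_factor lam b - G z * hom_factor lam z - integral {z..b} (\<lambda>t. G t * E' t)"
      by (rule antiderivative_on_by_parts[OF Gs zb D cE'])
    also have "integral {z..b} (\<lambda>t. G t * E' t) = integral {z..b} (\<lambda>t. - lam * (v t * hom_factor lam t))"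
    proof (rule integral_spike[OF N(1)])
      fix t assume t: "t \<in> {z..b} - N"
      then have "G t = of_real (wave_gap t) * v t" using N(2)[of t] sub by fastforce
      then show "- lam * (v t * hom_factor lam t) = G t * E' t" using nz t by (simp add: E'_def)
    qed
    also have "\<dots> = - lam * integral {z..b} (\<lambda>t. v t * hom_factor lam t)" by (rule integral_mult_right)
    finally have e: "integral {z..b} (\<lambda>t. g t * hom_factor lam t) - lam * integral {z..b} (\<lambda>t. v t * hom_factor lam t)
      = G b * hom_factor lam b - G z * hom_factor lam z" by (simp add: algebra_simps)
    have "integral {z..b} (\<lambda>t. hom_factor lam t * h t) = integral {z..b} (\<lambda>t. g t * hom_factor lam t - lam * (v t * hom_factor lam t))"
      by (simp add: h_def algebra_simps)
    also have "\<dots> = integral {z..b} (\<lambda>t. g t * hom_factor lam t) - lam * integral {z..b} (\<lambda>t. v t * hom_factor lam t)"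
      by (simp add: integral_diff vi integrable_on_mult_right)
    finally show ?thesis using e by simp
  qed
  have zpi: "z < pi" using z by auto
  have lim1: "((\<lambda>b. integral {z..b} (\<lambda>t. hom_factor lam t * h t)) \<longlongrightarrow> integral {z..pi} (\<lambda>t. hom_factor lam t * h t)) (at_left pi)"
    by (rule continuous_on_Icc_at_leftD[OF indefinite_integral_continuous_1[OF Eh] zpi])
  have "(G \<longlongrightarrow> G pi) (at_left pi)"
    by (rule continuous_on_Icc_at_leftD[OF antiderivative_on_continuous[OF G]]) simp
  moreover have "(hom_factor lam \<longlongrightarrow> 0) (at_left pi)"
    by (rule tendsto_norm_zero_cancel)
      (use ell_weight_tendsto_0[OF pos_if_gt_pi_sixth[OF lam]] in \<open>simp add: norm_hom_factor_weight\<close>)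
  ultimately have "((\<lambda>b. G b * hom_factor lam b - G z * hom_factor lam z) \<longlongrightarrow> G pi * 0 - G z * hom_factor lam z) (at_left pi)"
    by (intro tendsto_intros)
  moreover have "\<forall>\<^sub>F b in at_left pi. G b * hom_factor lam b - G z * hom_factor lam z = integral {z..b} (\<lambda>t. hom_factor lam t * h t)"
    by (rule eventually_at_leftI[OF _ zpi]) (simp only: fin)
  ultimately have lim2: "((\<lambda>b. integral {z..b} (\<lambda>t. hom_factor lam t * h t)) \<longlongrightarrow> G pi * 0 - G z * hom_factor lam z) (at_left pi)"
    by (rule Lim_transform_eventually)
  have "integral {z..pi} (\<lambda>t. hom_factor lam t * h t) = - G z * hom_factor lam z"
    using tendsto_unique[OF _ lim1 lim2] by simp
  then show ?thesis
    using wave_gap_pos[OF z] by (simp add: volterra_def h_def)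
qed

text \<open>\<open>f\<close> is only square integrable, so its share in \<open>u\<close> is
  estimated through \<open>sq_norm_volterra_le\<close> and Cauchy-Schwarz. The share of
  \<open>u\<close> itself is halved in the weighted supremum norm and absorbed on the left; the norm
  bound then follows from the pointwise one.\<close>

lemma resolvent_apriori_volterra:
  assumes lam: "Re lam > pi / 6"
  obtains D where "D \<ge> 0"
    "\<And>f u. \<lbrakk>sq_integrable_on f {-pi..pi}; continuous_on {-pi..pi} u;
        \<And>z. z \<in> {-pi..pi} \<Longrightarrow> u z = - integral {z..pi} (volterra lam (\<lambda>t. f t - u t))\<rbrakk>
      \<Longrightarrow> (\<forall>z\<in>{-pi..pi}. cmod (u z) \<le> D * sq_norm_on f {-pi..pi}) \<and>
        sq_norm_on (volterra lam (\<lambda>t. f t - u t)) {-pi..pi} \<le> D * sq_norm_on f {-pi..pi}"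
proof -
  let ?I = "{-pi..pi}"
  obtain k where k: "k > 0" "sq_norm_on (hardy (Re lam) (\<lambda>t. 1)) ?I / sqrt (2 * k) \<le> 1 / 2"
    using volterra_contraction_weight by blast
  define d where "d = Re lam - pi / 6"
  have d: "d > 0" using lam by (simp add: d_def)
  \<comment> \<open>\<open>D1\<close> bounds \<open>u\<close> pointwise: one
    \<open>exp (k * pi)\<close> comes from the weight at the maximum point, the other from removing
    the weight, and the 2 from absorbing one half. \<open>D2\<close> is the resulting constant for
    the Volterra term.\<close>
  define D1 where "D1 = exp (k * pi) * (2 * (exp (k * pi) * (sqrt (2 * pi) / d)))"
  define D2 where "D2 = (1 + sqrt (2 * pi) * D1) / d"
  have D1: "D1 \<ge> 0" using d by (simp add: D1_def)
  have D2: "D2 \<ge> 0" using d D1 by (simp add: D2_def)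
  have "(\<forall>z\<in>?I. cmod (u z) \<le> (D1 + D2) * sq_norm_on f ?I) \<and>
      sq_norm_on (volterra lam (\<lambda>t. f t - u t)) ?I \<le> (D1 + D2) * sq_norm_on f ?I"
    if f: "sq_integrable_on f ?I" and cu: "continuous_on ?I u"
      and u: "\<And>z. z \<in> ?I \<Longrightarrow> u z = - integral {z..pi} (volterra lam (\<lambda>t. f t - u t))" for f u
  proof -
    define n where "n = sq_norm_on f ?I"
    have n: "n \<ge> 0" unfolding n_def by (rule sq_norm_on_nonneg)
    have us: "sq_integrable_on u ?I" by (rule sq_integrable_on_continuous[OF cu])
    have fus: "sq_integrable_on (\<lambda>t. f t - u t) ?I" by (intro sq_integrable_on_diff f us) simp
    have vf: "sq_integrable_on (volterra lam f) ?I" by (rule sq_integrable_volterra[OF lam f])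
    have vi: "volterra lam \<Phi> integrable_on {z..pi}" if "sq_integrable_on \<Phi> ?I" "z \<in> ?I" for \<Phi> z
      using that(2) by (intro set_lebesgue_integral_eq_integral(1) sq_integrable_on_imp_absolutely_integrable
          sq_integrable_on_subset[OF sq_integrable_volterra[OF lam that(1)]]) auto
    have "continuous_on ?I (\<lambda>z. exp (k * z) * cmod (u z))" by (intro continuous_intros cu)
    from continuous_attains_sup[OF compact_Icc _ this]
    obtain z0 where z0: "z0 \<in> ?I" and max: "\<And>z. z \<in> ?I \<Longrightarrow> exp (k * z) * cmod (u z) \<le> exp (k * z0) * cmod (u z0)"
      by fastforce
    define M where "M = exp (k * z0) * cmod (u z0)"
    have M: "M \<ge> 0" by (simp add: M_def)
    have ub: "cmod (u z) \<le> M * exp (- k * z)" if "z \<in> ?I" for z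
    proof -
      have "cmod (u z) = exp (- k * z) * (exp (k * z) * cmod (u z))" by (simp flip: mult.assoc exp_add)
      also have "\<dots> \<le> exp (- k * z) * M" unfolding M_def by (intro mult_left_mono max that) simp
      finally show ?thesis by (simp add: mult.commute)
    qed
    have "u z0 = - integral {z0..pi} (\<lambda>z. volterra lam f z - volterra lam u z)"
      unfolding u[OF z0] using volterra_diff[OF lam f us] z0 by (intro arg_cong[where f = uminus] integral_cong) auto
    also have "integral {z0..pi} (\<lambda>z. volterra lam f z - volterra lam u z)
        = integral {z0..pi} (volterra lam f) - integral {z0..pi} (volterra lam u)"
      by (intro integral_diff vi f us z0)
    finally have "cmod (u z0) \<le> cmod (integral {z0..pi} (volterra lam f)) + cmod (integral {z0..pi} (volterra lam u))"
      by (simp only: norm_minus_cancel norm_triangle_ineq4)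
    also have "cmod (integral {z0..pi} (volterra lam f)) \<le> sqrt (2 * pi) / d * n"
    proof -
      have "cmod (integral {z0..pi} (volterra lam f)) = cmod (integral {z0..pi} (\<lambda>x. volterra lam f x * 1))" by simp
      also have "\<dots> \<le> sq_norm_on (volterra lam f) {z0..pi} * sq_norm_on (\<lambda>x. 1::complex) {z0..pi}"
        using z0 by (intro norm_integral_product_le sq_integrable_on_subset[OF vf] sq_integrable_on_continuous continuous_intros) auto
      also have "\<dots> \<le> sq_norm_on (volterra lam f) ?I * sqrt (2 * pi)"
      proof (intro mult_mono sq_norm_on_nonneg)
        show "sq_norm_on (volterra lam f) {z0..pi} \<le> sq_norm_on (volterra lam f) ?I"
          unfolding sq_norm_on_def using z0
          by (intro real_sqrt_le_mono integral_subset_le sq_integrable_on_square vf sq_integrable_on_subset[OF vf]) auto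
        show "sq_norm_on (\<lambda>x. 1::complex) {z0..pi} \<le> sqrt (2 * pi)"
          using z0 by (simp add: sq_norm_on_def)
      qed
      also have "\<dots> \<le> (n / d) * sqrt (2 * pi)"
        using sq_norm_volterra_le[OF lam f] unfolding n_def d_def by (intro mult_right_mono) auto
      finally show ?thesis by (simp add: mult.commute)
    qed
    also have "cmod (integral {z0..pi} (volterra lam u)) \<le> M * exp (- k * z0) * (1 / 2)"
    proof (rule order_trans[OF norm_integral_volterra_le[OF lam us k(1) M ub z0]])
      show "M * exp (- k * z0) * (sq_norm_on (hardy (Re lam) (\<lambda>t. 1)) ?I / sqrt (2 * k)) \<le> M * exp (- k * z0) * (1 / 2)"
        using M by (intro mult_left_mono k(2)) simp
    qed
    finally have "cmod (u z0) \<le> sqrt (2 * pi) / d * n + M * exp (- k * z0) * (1 / 2)" by simp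
    then have "M \<le> exp (k * z0) * (sqrt (2 * pi) / d * n + M * exp (- k * z0) * (1 / 2))"
      unfolding M_def by (intro mult_left_mono) auto
    also have "\<dots> = exp (k * z0) * (sqrt (2 * pi) / d * n) + M / 2 * (exp (k * z0) * exp (- k * z0))"
      by (simp add: algebra_simps)
    also have "exp (k * z0) * exp (- k * z0) = 1" by (simp flip: exp_add)
    finally have "M \<le> 2 * (exp (k * z0) * (sqrt (2 * pi) / d * n))" by simp
    also have "\<dots> \<le> 2 * (exp (k * pi) * (sqrt (2 * pi) / d * n))"
      using z0 k(1) n d by (intro mult_left_mono mult_right_mono) auto
    finally have "exp (k * pi) * M \<le> exp (k * pi) * (2 * (exp (k * pi) * (sqrt (2 * pi) / d * n)))"
      by (rule mult_left_mono) simp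
    then have MD: "exp (k * pi) * M \<le> D1 * n"
      unfolding D1_def by (simp only: mult.assoc)
    have uD: "cmod (u z) \<le> D1 * n" if z: "z \<in> ?I" for z
    proof -
      have "cmod (u z) \<le> M * exp (- k * z)" by (rule ub[OF z])
      also have "\<dots> \<le> M * exp (k * pi)"
      proof (rule mult_left_mono[OF _ M])
        have "k * (- z) \<le> k * pi" using z k(1) by (intro mult_left_mono) auto
        then show "exp (- k * z) \<le> exp (k * pi)" by simp
      qed
      finally show ?thesis using MD by (simp add: mult.commute)
    qed
    have "sq_norm_on u ?I \<le> sq_norm_on (\<lambda>z. complex_of_real (D1 * n)) ?I"
      using uD D1 n by (intro sq_norm_on_mono us sq_integrable_on_continuous continuous_intros) (simp_all add: abs_mult norm_mult)
    also have "\<dots> = sqrt (2 * pi) * (D1 * n)"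
      using D1 n by (simp add: sq_norm_on_def norm_mult power_mult_distrib real_sqrt_mult)
    finally have un: "sq_norm_on u ?I \<le> sqrt (2 * pi) * (D1 * n)" .
    have "sq_norm_on (volterra lam (\<lambda>t. f t - u t)) ?I \<le> sq_norm_on (\<lambda>t. f t - u t) ?I / d"
      unfolding d_def by (rule sq_norm_volterra_le[OF lam fus])
    also have "\<dots> \<le> (n + sqrt (2 * pi) * (D1 * n)) / d"
    proof (rule divide_right_mono)
      have "sq_norm_on (\<lambda>t. f t + (-1) * u t) ?I \<le> sq_norm_on f ?I + sq_norm_on (\<lambda>t. (-1) * u t) ?I"
        by (intro sq_norm_on_triangle f sq_integrable_on_cmult us) auto
      also have "sq_norm_on (\<lambda>t. (-1) * u t) ?I = sq_norm_on u ?I" by (subst sq_norm_on_cmult) simp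
      finally show "sq_norm_on (\<lambda>t. f t - u t) ?I \<le> n + sqrt (2 * pi) * (D1 * n)"
        using un by (simp add: n_def)
    qed (use d in simp)
    also have "\<dots> = D2 * n" by (simp add: D2_def algebra_simps add_divide_distrib)
    finally have vn: "sq_norm_on (volterra lam (\<lambda>t. f t - u t)) ?I \<le> D2 * n" .
    have le: "D1 * n \<le> (D1 + D2) * n" "D2 * n \<le> (D1 + D2) * n"
      using D1 D2 n by (auto intro: mult_right_mono)
    then show ?thesis using uD vn unfolding n_def by (meson order_trans)
  qed
  then show thesis using that[of "D1 + D2"] D1 D2 by auto
qed

text \<open>The Volterra equation fits only primitives that vanish at \<open>pi\<close>. Adding
  \<open>c\<close> times the homogeneous solution achieves this, and \<open>c\<close> is estimated
  afterwards from the zero mean of the original \<open>v\<close>.\<close>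

lemma resolvent_bounded:
  assumes lam: "Re lam > pi / 6"
  obtains C where "\<And>v w. A_graph v w \<Longrightarrow> L2norm v \<le> C * L2norm (\<lambda>z. w z - lam * v z)"
proof -
  let ?I = "{-pi..pi}"
  have r0: "Re lam > 0" by (rule pos_if_gt_pi_sixth[OF lam])
  then have lam0: "lam \<noteq> 0" by auto
  obtain D where D: "D \<ge> 0" and apriori: "\<And>f u. \<lbrakk>sq_integrable_on f ?I; continuous_on ?I u;
        \<And>z. z \<in> ?I \<Longrightarrow> u z = - integral {z..pi} (volterra lam (\<lambda>t. f t - u t))\<rbrakk>
      \<Longrightarrow> (\<forall>z\<in>?I. cmod (u z) \<le> D * sq_norm_on f ?I) \<and>
        sq_norm_on (volterra lam (\<lambda>t. f t - u t)) ?I \<le> D * sq_norm_on f ?I"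
    using resolvent_apriori_volterra[OF lam] by blast
  define C where "C = D + D / cmod (6 * of_real pi * lam) * sq_norm_on (poly_sol' lam) ?I"
  have "L2norm v \<le> C * L2norm (\<lambda>z. w z - lam * v z)" if A: "A_graph v w" for v w
  proof -
    obtain G g where v: "sq_integrable_on v ?I" and v0: "integral ?I v = 0" and g: "sq_integrable_on g ?I"
      and G: "antiderivative_on G g (-pi) pi"
      and vG: "AE x in lebesgue. x \<in> ?I \<longrightarrow> of_real (wave_gap x) * v x = G x"
      and w: "AE x in lebesgue. x \<in> ?I \<longrightarrow> w x = g x + antideriv0 v x"
      using A_graphE[OF A] by blast
    note va = sq_integrable_on_imp_absolutely_integrable[OF v]
    define u where "u = antideriv0 v"
    have uv: "antiderivative_on u v (-pi) pi" unfolding u_def by (rule antideriv0_antiderivative(1)[OF va])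
    note cu = antiderivative_on_continuous[OF uv]
    define f where "f z = g z + u z - lam * v z" for z
    have f: "sq_integrable_on f ?I"
      unfolding f_def
      by (intro sq_integrable_on_diff sq_integrable_on_add sq_integrable_on_cmult sq_integrable_on_continuous cu g v) auto
    have wf: "AE x in lebesgue. x \<in> ?I \<longrightarrow> w x - lam * v x = f x"
      using w by (rule AE_mp) (rule AE_I2, simp add: f_def u_def)
    have wnorm: "L2norm (\<lambda>z. w z - lam * v z) = sq_norm_on f ?I"
      using L2norm_eq[OF sq_integrable_on_AE_cong[OF _ f wf]] sq_norm_on_AE_cong[OF wf] by simp
    define c where "c = - (u pi / poly_sol lam pi)"
    define u' where "u' z = u z + c * poly_sol lam z" for z
    define v' where "v' z = v z + c * poly_sol' lam z" for z
    define g' where "g' z = g z + c * (- poly_sol lam z + lam * poly_sol' lam z)" for z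
    define G' where "G' z = G z + c * (of_real (wave_gap z) * poly_sol' lam z)" for z
    have uv': "antiderivative_on u' v' (-pi) pi"
      unfolding u'_def v'_def by (intro antiderivative_on_add_cmult uv poly_sol_antiderivative)
    have G': "antiderivative_on G' g' (-pi) pi"
      unfolding G'_def g'_def by (intro antiderivative_on_add_cmult G poly_flux_antiderivative)
    have v's: "sq_integrable_on v' ?I"
      unfolding v'_def by (intro sq_integrable_on_add sq_integrable_on_cmult v sq_integrable_on_continuous continuous_on_poly_sol') auto
    have g's: "sq_integrable_on g' ?I"
      unfolding g'_def
      by (intro sq_integrable_on_add sq_integrable_on_cmult g sq_integrable_on_continuous
          continuous_on_poly_sol' continuous_on_poly_sol continuous_intros) auto
    have vG': "AE x in lebesgue. x \<in> ?I \<longrightarrow> of_real (wave_gap x) * v' x = G' x"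
      using vG by (rule AE_mp) (rule AE_I2, simp add: v'_def G'_def algebra_simps)
    have eq: "g' z - lam * v' z = f z - u' z" for z
      unfolding g'_def v'_def f_def u'_def by (simp add: algebra_simps)
    have u'pi: "u' pi = 0" using poly_sol_pi_nonzero[OF r0] by (simp add: u'_def c_def)
    have flux: "G' z = of_real (wave_gap z) * volterra lam (\<lambda>t. f t - u' t) z" if "z \<in> {-pi<..<pi}" for z
      using domain_flux_eq_volterra[OF lam g's v's G' vG' that] unfolding eq .
    have v'V: "AE x in lebesgue. x \<in> ?I \<longrightarrow> v' x = volterra lam (\<lambda>t. f t - u' t) x"
      using vG' AE_Icc_imp_Ioo[of "-pi" pi]
    proof eventually_elim
      case (elim x)
      show ?case
      proof
        assume "x \<in> ?I"
        then have x: "x \<in> {-pi<..<pi}" "of_real (wave_gap x) * v' x = G' x" using elim by auto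
        then show "v' x = volterra lam (\<lambda>t. f t - u' t) x"
          using wave_gap_pos[OF x(1)] flux[OF x(1)] by simp
      qed
    qed
    obtain N where N: "negligible N" "\<And>x. x \<in> ?I \<Longrightarrow> x \<notin> N \<Longrightarrow> v' x = volterra lam (\<lambda>t. f t - u' t) x"
      using AE_on_obtain[OF v'V] by blast
    have u'eq: "u' z = - integral {z..pi} (volterra lam (\<lambda>t. f t - u' t))" if z: "z \<in> ?I" for z
    proof -
      have "u' pi - u' z = integral {z..pi} v'" using z by (intro antiderivative_on_diff[OF uv']) auto
      also have "\<dots> = integral {z..pi} (volterra lam (\<lambda>t. f t - u' t))"
        by (rule integral_spike[OF N(1)]) (use N(2) z in auto)
      finally have "- u' z = integral {z..pi} (volterra lam (\<lambda>t. f t - u' t))" using u'pi by simp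
      then show ?thesis by (metis minus_minus)
    qed
    from apriori[OF f antiderivative_on_continuous[OF uv'] u'eq]
    have ub: "cmod (u' (-pi)) \<le> D * sq_norm_on f ?I"
      and vb: "sq_norm_on (volterra lam (\<lambda>t. f t - u' t)) ?I \<le> D * sq_norm_on f ?I" by auto
    \<comment> \<open>Since \<open>u\<close> takes equal values at the endpoints, the endpoint
      difference of \<open>u'\<close> is that of \<open>c * poly_sol\<close>. With
      \<open>u' pi = 0\<close> this expresses \<open>c\<close> through \<open>u' (- pi)\<close>,
      which \<open>apriori\<close> bounds.\<close>
    have "u pi - u (-pi) = 0" using antiderivative_on_diff[OF uv, of "-pi" pi] v0 by simp
    then have "u' pi - u' (-pi) = c * (6 * of_real pi * lam)"
      unfolding u'_def poly_sol_endpoint_diff[symmetric] by (simp add: algebra_simps)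
    then have "- u' (-pi) = c * (6 * of_real pi * lam)" using u'pi by simp
    then have "cmod (u' (-pi)) = cmod c * cmod (6 * of_real pi * lam)" by (metis norm_minus_cancel norm_mult)
    then have cb: "cmod c \<le> D * sq_norm_on f ?I / cmod (6 * of_real pi * lam)"
      using ub lam0 by (simp add: field_simps)
    have "sq_norm_on v ?I = sq_norm_on (\<lambda>z. v' z + (- c) * poly_sol' lam z) ?I" by (simp add: v'_def)
    also have "\<dots> \<le> sq_norm_on v' ?I + sq_norm_on (\<lambda>z. (- c) * poly_sol' lam z) ?I"
      by (intro sq_norm_on_triangle v's sq_integrable_on_cmult sq_integrable_on_continuous continuous_on_poly_sol') auto
    also have "\<dots> = sq_norm_on (volterra lam (\<lambda>t. f t - u' t)) ?I + cmod c * sq_norm_on (poly_sol' lam) ?I"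
      unfolding sq_norm_on_cmult sq_norm_on_AE_cong[OF v'V] by simp
    also have "\<dots> \<le> D * sq_norm_on f ?I + D * sq_norm_on f ?I / cmod (6 * of_real pi * lam) * sq_norm_on (poly_sol' lam) ?I"
      by (intro add_mono vb mult_right_mono cb sq_norm_on_nonneg)
    also have "\<dots> = C * sq_norm_on f ?I" by (simp add: C_def algebra_simps)
    finally show ?thesis using L2norm_eq[OF v] wnorm by simp
  qed
  then show thesis using that by blast
qed

lemma L2norm_eq_0_imp:
  assumes v: "sq_integrable_on v {-pi..pi}" and "L2norm v \<le> 0"
  shows "ae_eq_on v (\<lambda>z. 0)"
proof -
  have "sq_norm_on v {-pi..pi} = 0" using assms L2norm_eq[OF v] sq_norm_on_nonneg[of v "{-pi..pi}"] by simp
  then have int0: "integral {-pi..pi} (\<lambda>x. (cmod (v x))\<^sup>2) = 0"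
    using sq_norm_on_power2[of v "{-pi..pi}"] by simp
  have a: "(\<lambda>x. (cmod (v x))\<^sup>2) absolutely_integrable_on {-pi..pi}"
    using v by (simp add: sq_integrable_on_def)
  have i: "(\<lambda>x. (cmod (v x))\<^sup>2) integrable_on {-pi..pi}" by (rule sq_integrable_on_square[OF v])
  have "AE x in lebesgue. x \<in> {-pi..pi} \<longrightarrow> (cmod (v x))\<^sup>2 = 0"
  proof (rule AE_zero_if_indefinite_integral_zero[OF a])
    fix x assume x: "x \<in> {-pi..pi}"
    have "(\<lambda>x. (cmod (v x))\<^sup>2) integrable_on {-pi..x}" using x by (intro integrable_on_subinterval[OF i]) auto
    then have "integral {-pi..x} (\<lambda>x. (cmod (v x))\<^sup>2) \<ge> 0"
      "integral {-pi..x} (\<lambda>x. (cmod (v x))\<^sup>2) \<le> integral {-pi..pi} (\<lambda>x. (cmod (v x))\<^sup>2)"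
      using x i by (intro integral_nonneg integral_subset_le; simp)+
    then show "integral {-pi..x} (\<lambda>x. (cmod (v x))\<^sup>2) = 0" using int0 by linarith
  qed
  then show ?thesis by (simp add: ae_eq_on_def)
qed

text \<open>Injectivity is the case of right-hand side 0 in the bound.\<close>

lemma resolvent_AI:
  assumes surj: "\<And>f. L2per0 f \<Longrightarrow> \<exists>v w. A_graph v w \<and> ae_eq_on (\<lambda>z. w z - lam * v z) f"
    and bnd: "\<And>v w. A_graph v w \<Longrightarrow> L2norm v \<le> C * L2norm (\<lambda>z. w z - lam * v z)"
  shows "lam \<in> resolvent_A"
  unfolding resolvent_A_def
proof (intro CollectI conjI allI impI)
  fix v w assume vw: "A_graph v w \<and> ae_eq_on (\<lambda>z. w z - lam * v z) (\<lambda>z. 0)"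
  then have v: "sq_integrable_on v {-pi..pi}" unfolding A_graph_def L2per0_iff by blast
  have z: "sq_integrable_on (\<lambda>z. 0::complex) {-pi..pi}" by (intro sq_integrable_on_continuous continuous_intros)
  have ae: "AE z in lebesgue. z \<in> {-pi..pi} \<longrightarrow> w z - lam * v z = 0" using vw by (simp add: ae_eq_on_def)
  have "L2norm (\<lambda>z. w z - lam * v z) = sq_norm_on (\<lambda>z. 0::complex) {-pi..pi}"
    using L2norm_eq[OF sq_integrable_on_AE_cong[OF _ z ae]] sq_norm_on_AE_cong[OF ae] by simp
  also have "\<dots> = 0" by (simp add: sq_norm_on_def)
  finally have "L2norm v \<le> 0" using bnd[of v w] vw by simp
  then show "ae_eq_on v (\<lambda>z. 0)" by (rule L2norm_eq_0_imp[OF v])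
qed (use surj bnd in blast)+

lemma right_half_plane_in_resolvent:
  assumes "Re lam > pi / 6"
  shows "lam \<in> resolvent_A"
  using resolvent_surjective[OF assms] resolvent_bounded[OF assms] resolvent_AI by metis

section \<open>Reflection and the left half plane\<close>

lemma integral_reflect_sym:
  fixes f :: "real \<Rightarrow> 'a::real_normed_vector"
  shows "integral {-c..c} (\<lambda>x. f (- x)) = integral {-c..c} f"
  using Henstock_Kurzweil_Integration.integral_reflect_real[where f = f and a = "-c" and b = c] by simp

lemma sq_integrable_on_reflect:
  fixes f :: "real \<Rightarrow> 'a::{real_normed_field,euclidean_space}"
  assumes f: "sq_integrable_on f {-c..c}"
  shows "sq_integrable_on (\<lambda>x. f (- x)) {-c..c}"
  unfolding sq_integrable_on_def
proof
  have "(\<lambda>x. f (- x)) absolutely_integrable_on {-c..c}"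
    using absolutely_integrable_reflect_real[where f = f and a = "-c" and b = c]
      sq_integrable_on_imp_absolutely_integrable[OF f] by simp
  then show "(\<lambda>x. f (- x)) \<in> borel_measurable (lebesgue_on {-c..c})"
    by (rule absolutely_integrable_measurable[THEN iffD1, THEN conjunct1, rotated]) simp
  show "(\<lambda>x. (norm (f (- x)))\<^sup>2) absolutely_integrable_on {-c..c}"
    using absolutely_integrable_reflect_real[where f = "\<lambda>x. (norm (f x))\<^sup>2" and a = "-c" and b = c] f
    by (simp add: sq_integrable_on_def)
qed

lemma sq_norm_on_reflect: "sq_norm_on (\<lambda>x. f (- x)) {-c..c} = sq_norm_on f {-c..c}"
  unfolding sq_norm_on_def using integral_reflect_sym[of c "\<lambda>x. (norm (f x))\<^sup>2"] by simp

lemma antiderivative_on_reflect: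
  fixes g G :: "real \<Rightarrow> 'a::{real_normed_field,euclidean_space}"
  assumes G: "antiderivative_on G g (-c) c"
  shows "antiderivative_on (\<lambda>x. G (- x)) (\<lambda>x. - g (- x)) (-c) c"
proof (rule antiderivative_onI)
  have "(\<lambda>x. g (- x)) absolutely_integrable_on {-c..c}"
    using absolutely_integrable_reflect_real[where f = g and a = "-c" and b = c]
      antiderivative_on_absolutely_integrable[OF G] by simp
  from set_integrable_mult_right[OF this, of "-1"]
  show "(\<lambda>x. - g (- x)) absolutely_integrable_on {-c..c}" by simp
  fix x assume x: "x \<in> {-c..c}"
  have "integral {-c..x} (\<lambda>x. - g (- x)) = - integral {-c..x} (\<lambda>x. g (- x))" by simp
  also have "integral {-c..x} (\<lambda>x. g (- x)) = integral {-x..c} g"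
    using Henstock_Kurzweil_Integration.integral_reflect_real[where f = g and a = "-x" and b = c] by simp
  also have "\<dots> = G c - G (- x)" using x by (intro antiderivative_on_diff[OF G, symmetric]) auto
  finally show "G (- x) = G (- (- c)) + integral {-c..x} (\<lambda>x. - g (- x))" by simp
qed

text \<open>\<open>wave_gap\<close> is even, while differentiation and the zero-mean antiderivative
  both change sign under reflection; for the latter this is an instance of
  \<open>antideriv0_unique\<close>.\<close>

lemma A_graph_reflect:
  assumes A: "A_graph v w"
  shows "A_graph (\<lambda>z. v (- z)) (\<lambda>z. - w (- z))"
proof -
  let ?I = "{-pi..pi}"
  obtain G g where v: "sq_integrable_on v ?I" and v0: "integral ?I v = 0" and g: "sq_integrable_on g ?I"
    and G: "antiderivative_on G g (-pi) pi" "G pi = 0" "G (-pi) = 0"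
    and vG: "AE x in lebesgue. x \<in> ?I \<longrightarrow> of_real (wave_gap x) * v x = G x"
    and w: "AE x in lebesgue. x \<in> ?I \<longrightarrow> w x = g x + antideriv0 v x"
    using A_graphE[OF A] by blast
  note u = antideriv0_antiderivative[OF sq_integrable_on_imp_absolutely_integrable[OF v]]
  have au: "antideriv0 (\<lambda>z. v (- z)) x = - antideriv0 v (- x)" if "x \<in> ?I" for x
  proof (rule antideriv0_unique[OF _ _ that])
    have z: "antiderivative_on (\<lambda>z. 0::complex) (\<lambda>z. 0) (-pi) pi" by (rule antiderivative_onI) simp_all
    show "antiderivative_on (\<lambda>x. - antideriv0 v (- x)) (\<lambda>z. v (- z)) (-pi) pi"
      using antiderivative_on_add_cmult[OF z antiderivative_on_reflect[OF u(1)], of "-1"] by simp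
    show "integral ?I (\<lambda>x. - antideriv0 v (- x)) = 0"
      using u(2) integral_reflect_sym[of pi "antideriv0 v"] by simp
  qed
  show ?thesis
  proof (rule A_graphI)
    show "sq_integrable_on (\<lambda>z. v (- z)) ?I" by (rule sq_integrable_on_reflect[OF v])
    show "integral ?I (\<lambda>z. v (- z)) = 0" using v0 integral_reflect_sym[of pi v] by simp
    show "sq_integrable_on (\<lambda>z. - g (- z)) ?I"
      using sq_integrable_on_cmult[OF _ sq_integrable_on_reflect[OF g], of "-1"] by simp
    have "integral ?I g = 0" using antiderivative_on_diff[OF G(1), of "-pi" pi] G by simp
    then show "integral ?I (\<lambda>z. - g (- z)) = 0" using integral_reflect_sym[of pi g] by simp
    show "antiderivative_on (\<lambda>z. G (- z)) (\<lambda>z. - g (- z)) (-pi) pi" by (rule antiderivative_on_reflect[OF G(1)])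
    show "AE x in lebesgue. x \<in> ?I \<longrightarrow> of_real (wave_gap x) * v (- x) = G (- x)"
      using AE_lebesgue_reflect[OF vG] by (rule AE_mp) (rule AE_I2, auto simp: wave_gap_def)
    show "AE x in lebesgue. x \<in> ?I \<longrightarrow> - w (- x) = - g (- x) + antideriv0 (\<lambda>z. v (- z)) x"
      using AE_lebesgue_reflect[OF w] by (rule AE_mp) (rule AE_I2, auto simp: au)
  qed
qed

lemma resolvent_reflect:
  assumes "lam \<in> resolvent_A"
  shows "- lam \<in> resolvent_A"
proof -
  let ?I = "{-pi..pi}"
  obtain C where surj: "\<And>f. L2per0 f \<Longrightarrow> \<exists>v w. A_graph v w \<and> ae_eq_on (\<lambda>z. w z - lam * v z) f"
    and bnd: "\<And>v w. A_graph v w \<Longrightarrow> L2norm v \<le> C * L2norm (\<lambda>z. w z - lam * v z)"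
    using assms unfolding resolvent_A_def by blast
  show ?thesis
  proof (rule resolvent_AI)
    fix f assume f: "L2per0 f"
    have fr: "sq_integrable_on (\<lambda>z. - f (- z)) ?I"
      using sq_integrable_on_cmult[OF _ sq_integrable_on_reflect[of f pi], of "-1"] f by (simp add: L2per0_iff)
    moreover have "integral ?I (\<lambda>z. - f (- z)) = 0"
      using integral_reflect_sym[of pi f] f by (simp add: L2per0_iff)
    ultimately obtain v w where A: "A_graph v w" and e: "ae_eq_on (\<lambda>z. w z - lam * v z) (\<lambda>z. - f (- z))"
      using surj[of "\<lambda>z. - f (- z)"] by (auto simp: L2per0_iff)
    have "AE z in lebesgue. - z \<in> ?I \<longrightarrow> w (- z) - lam * v (- z) = - f (- (- z))"
      using AE_lebesgue_reflect[OF e[unfolded ae_eq_on_def]] .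
    then have "ae_eq_on (\<lambda>z. - w (- z) - - lam * v (- z)) f"
      unfolding ae_eq_on_def by (rule AE_mp) (rule AE_I2, auto simp: algebra_simps)
    then show "\<exists>v w. A_graph v w \<and> ae_eq_on (\<lambda>z. w z - - lam * v z) f"
      using A_graph_reflect[OF A] by blast
  next
    fix v w assume A: "A_graph v w"
    have v: "sq_integrable_on v ?I" using A unfolding A_graph_def L2per0_iff by blast
    obtain g where g: "sq_integrable_on g ?I" and w: "AE x in lebesgue. x \<in> ?I \<longrightarrow> w x = g x + antideriv0 v x"
      using A_graphE[OF A] by blast
    note u = antideriv0_antiderivative(1)[OF sq_integrable_on_imp_absolutely_integrable[OF v]]
    have "sq_integrable_on (\<lambda>x. g x + antideriv0 v x) ?I"
      by (intro sq_integrable_on_add g sq_integrable_on_continuous antiderivative_on_continuous[OF u]) simp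
    then have ws: "sq_integrable_on w ?I" by (rule sq_integrable_on_AE_cong[OF _ _ w, rotated]) simp
    define h where "h z = w z - - lam * v z" for z
    have h: "sq_integrable_on h ?I"
      unfolding h_def by (intro sq_integrable_on_diff sq_integrable_on_cmult ws v) auto
    have hr: "sq_integrable_on (\<lambda>z. (-1) * h (- z)) ?I"
      by (intro sq_integrable_on_cmult sq_integrable_on_reflect h) simp
    have "L2norm (\<lambda>z. v (- z)) \<le> C * L2norm (\<lambda>z. (-1) * h (- z))"
      using bnd[OF A_graph_reflect[OF A]] by (simp add: h_def algebra_simps)
    then show "L2norm v \<le> C * L2norm (\<lambda>z. w z - - lam * v z)"
      unfolding h_def[symmetric]
      unfolding L2norm_eq[OF v] L2norm_eq[OF h] L2norm_eq[OF hr] L2norm_eq[OF sq_integrable_on_reflect[OF v]]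
        sq_norm_on_cmult sq_norm_on_reflect by simp
  qed
qed

theorem theorem2p2:
  shows "spectrum_A = {lam. - (pi / 6) \<le> Re lam \<and> Re lam \<le> pi / 6}
         \<and> \<not> (spectrum_A \<subseteq> {lam. Re lam = 0})"
proof
  show eq: "spectrum_A = {lam. - (pi / 6) \<le> Re lam \<and> Re lam \<le> pi / 6}"
  proof (intro set_eqI iffI)
    fix lam assume "lam \<in> spectrum_A"
    then have "lam \<notin> resolvent_A" "- lam \<notin> resolvent_A"
      using resolvent_reflect[of "- lam"] by (auto simp: spectrum_A_def)
    then show "lam \<in> {lam. - (pi / 6) \<le> Re lam \<and> Re lam \<le> pi / 6}"
      using right_half_plane_in_resolvent[of lam] right_half_plane_in_resolvent[of "- lam"] by force
  next
    fix lam assume "lam \<in> {lam. - (pi / 6) \<le> Re lam \<and> Re lam \<le> pi / 6}"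
    then have "\<bar>Re lam\<bar> \<le> pi / 6" by (auto intro: abs_leI)
    then show "lam \<in> spectrum_A"
      using strip_in_spectrum[of lam] unfolding spectrum_A_def by blast
  qed
  show "\<not> (spectrum_A \<subseteq> {lam. Re lam = 0})"
  proof
    assume "spectrum_A \<subseteq> {lam. Re lam = 0}"
    moreover have "complex_of_real (pi / 6) \<in> spectrum_A" unfolding eq by simp
    ultimately show False by auto
  qed
qed

end
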